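(* Let $(S,T)\sim p(s,t)$ be a pair of discrete random variables on finite alphabets $\mathcal S,\mathcal T$, let $K=f(S)=g(T)$ be the common part of $(S,T)$ in the sense of Gács–Körner–Witsenhausen, and let $p(y_1y_2|x_1x_2)$ be a discrete memoryless interference channel with finite alphabets. Then the source pair $(S,T)$ is admissible for the interference channel $p(y_1y_2|x_1x_2)$ if there exist auxiliary random variables $W_0,W_1,W_2$ (on finite alphabets) and channel inputs $X_1,X_2$ such that the joint distribution of all the variables factors as $$p(s,t,w_0,w_1,w_2,x_1,x_2,y_1,y_2)=p(s,t)\,p(w_0)\,p(w_1|w_0)\,p(w_2|w_0)\,p(x_1|s,w_1,w_0)\,p(x_2|t,w_2,w_0)\,p(y_1y_2|x_1x_2),$$ and the following conditions are all satisfied: \begin{align*} H(S|K)&<I(SX_1;Y_1|W_0W_2K),\\ H(T|K)&<I(TX_2;Y_2|W_0W_1K),\\ H(S)&<I(W_0W_2SX_1;Y_1),\\ H(T)&<I(W_0W_1TX_2;Y_2),\\ H(S|K)+H(T|K)&<I(SX_1;Y_1|W_0W_1W_2K)+I(W_1TX_2;Y_2|W_0K),\\ H(S|K)+H(T|K)&<I(TX_2;Y_2|W_0W_1W_2K)+I(W_2SX_1;Y_1|W_0K),\\ H(S|K)+H(T|K)&<I(SW_2X_1;Y_1|W_0W_1K)+I(TW_1X_2;Y_2|W_0W_2K),\\ H(S|K)+H(T)&<I(W_0W_1TX_2;Y_2)+I(SX_1;Y_1|W_0W_1W_2K),\\ H(S)+H(T|K)&<I(W_0W_2SX_1;Y_1)+I(TX_2;Y_2|W_0W_1W_2K),\\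 2H(S|K)+H(T|K)&<I(SX_1;Y_1|W_0W_1W_2K)+I(SW_2X_1;Y_1|W_0K)+I(TW_1X_2;Y_2|W_0W_2K),\\ H(S|K)+2H(T|K)&<I(TX_2;Y_2|W_0W_1W_2K)+I(TW_1X_2;Y_2|W_0K)+I(SW_2X_1;Y_1|W_0W_1K),\\ H(S)+H(S|K)+H(T|K)&<I(SX_1;Y_1|W_0W_1W_2K)+I(W_0W_2SX_1;Y_1)+I(TW_1X_2;Y_2|W_0W_2K),\\ H(T)+H(S|K)+H(T|K)&<I(TX_2;Y_2|W_0W_1W_2K)+I(W_0W_1TX_2;Y_2)+I(SW_2X_1;Y_1|W_0W_1K). \end{align*}
   Context: Juxtaposition of random variables inside $H(\cdot)$ and $I(\cdot;\cdot|\cdot)$ denotes the tuple, e.g. $I(SX_1;Y_1|W_0W_2K)=I((S,X_1);Y_1|(W_0,W_2,K))$. $H$ and $I$ are Shannon entropy and (conditional) mutual information. All alphabets are finite. Source: $(S^n,T^n)$ is i.i.d., $p(s^n,t^n)=\prod_{i=1}^n p(s_i,t_i)$. Channel: a discrete memoryless interference channel (DMIC) is a transition probability $p(y_1y_2|x_1x_2)$ with finite input alphabets $\mathcal X_1,\mathcal X_2$ and output alphabets $\mathcal Y_1,\mathcal Y_2$; over $n$ uses, $p(y_1^n y_2^n|x_1^n x_2^n)=\prod_{i=1}^n p(y_{1i}y_{2i}|x_{1i}x_{2i})$. Code: a length-$n$ source-channel block code consists of encoders $f_1:\mathcal S^n\to\mathcal X_1^n$, $f_2:\mathcal T^n\to\mathcal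 X_2^n$ and decoders $\phi_1:\mathcal Y_1^n\to\mathcal S^n$, $\phi_2:\mathcal Y_2^n\to\mathcal T^n$. The channel inputs are $X_1^n=f_1(S^n)$ and $X_2^n=f_2(T^n)$. The error probabilities are $P_{e1}=\sum_{s^n}p(s^n)\Pr\{s^n\ne\phi_1(Y_1^n)\mid S^n=s^n\}$ and $P_{e2}=\sum_{t^n}p(t^n)\Pr\{t^n\ne\phi_2(Y_2^n)\mid T^n=t^n\}$. Admissibility: $(S,T)$ is admissible for the channel if for every $\epsilon\in(0,1)$ and all sufficiently large $n$ there exists a length-$n$ block code $(f_1,f_2,\phi_1,\phi_2)$ with $\max\{P_{e1},P_{e2}\}\le\epsilon$. Common part (Gács–Körner, Witsenhausen): $K=f(S)=g(T)$, where $f,g$ are functions such that $\Pr\{f(S)=g(T)\}=1$ and the number of values taken with positive probability by $f(S)$ is the largest possible among all such pairs of functions. Equivalently, $K$ is the index of the connected component containing $(S,T)$ in the bipartite graph on $\mathcal S\sqcup\mathcal T$ with an edge between $s$ and $t$ whenever $p(s,t)>0$. *)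

theory Defs
  imports "HOL-Probability.Probability"
begin

text \<open>
  These are the library's quantities for simple functions (base 2), specialised to a discrete
  sample space; for a \<open>pmf\<close> the image of the sample space under \<open>X\<close> is \<open>range X\<close>.
\<close>

definition pmf_entropy :: "'a pmf \<Rightarrow> ('a \<Rightarrow> 'b) \<Rightarrow> real" ("\<H>[_]'(_')") where
  "\<H>[P](X) = prob_space.entropy (measure_pmf P) 2 (count_space (range X)) X"

definition pmf_conditional_entropy :: "'a pmf \<Rightarrow> ('a \<Rightarrow> 'b) \<Rightarrow> ('a \<Rightarrow> 'c) \<Rightarrow> real"
  ("\<H>[_]'(_ | _')") where
  "\<H>[P](X | Y) =
     prob_space.conditional_entropy (measure_pmf P) 2
       (count_space (range X)) (count_space (range Y)) X Y"

definition pmf_mutual_information :: "'a pmf \<Rightarrow> ('a \<Rightarrow> 'b) \<Rightarrow> ('a \<Rightarrow> 'c) \<Rightarrow> real"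
  ("\<I>[_]'(_ ; _')") where
  "\<I>[P](X ; Y) =
     prob_space.mutual_information (measure_pmf P) 2
       (count_space (range X)) (count_space (range Y)) X Y"

definition pmf_conditional_mutual_information ::
    "'a pmf \<Rightarrow> ('a \<Rightarrow> 'b) \<Rightarrow> ('a \<Rightarrow> 'c) \<Rightarrow> ('a \<Rightarrow> 'd) \<Rightarrow> real"
  ("\<I>[_]'(_ ; _ | _')") where
  "\<I>[P](X ; Y | Z) =
     prob_space.conditional_mutual_information (measure_pmf P) 2
       (count_space (range X)) (count_space (range Y)) (count_space (range Z)) X Y Z"

abbreviation joint_rv :: "('a \<Rightarrow> 'b) \<Rightarrow> ('a \<Rightarrow> 'c) \<Rightarrow> 'a \<Rightarrow> 'b \<times> 'c"  (infixr "\<diamondop>" 65)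
  where "X \<diamondop> Y \<equiv> (\<lambda>\<omega>. (X \<omega>, Y \<omega>))"

definition agree_as :: "('s \<times> 't) pmf \<Rightarrow> ('s \<Rightarrow> 'k) \<Rightarrow> ('t \<Rightarrow> 'k) \<Rightarrow> bool" where
  "agree_as p f g \<longleftrightarrow> measure_pmf.prob p {(s, t). f s = g t} = 1"

definition num_values :: "('s \<times> 't) pmf \<Rightarrow> ('s \<Rightarrow> 'k) \<Rightarrow> nat" where
  "num_values p f = card (set_pmf (map_pmf (\<lambda>(s, t). f s) p))"

text \<open>
  The competing pairs of functions take values in \<^typ>\<open>nat\<close>.  This is no restriction for finite
  alphabets, since the finitely many values taken can be relabelled injectively by natural numbers.
\<close>

definition common_part ::
    "('s::finite \<times> 't::finite) pmf \<Rightarrow> ('s \<Rightarrow> 'k) \<Rightarrow> ('t \<Rightarrow> 'k) \<Rightarrow> bool" where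
  "common_part p f g \<longleftrightarrow>
     agree_as p f g \<and>
     (\<forall>(f' :: 's \<Rightarrow> nat) (g' :: 't \<Rightarrow> nat).
        agree_as p f' g' \<longrightarrow> num_values p f' \<le> num_values p f)"

definition seqs :: "nat \<Rightarrow> 'a list set" where
  "seqs n = {xs. length xs = n}"

type_synonym ('x1, 'x2, 'y1, 'y2) channel = "'x1 \<Rightarrow> 'x2 \<Rightarrow> ('y1 \<times> 'y2) pmf"

definition channel_power ::
    "('x1, 'x2, 'y1, 'y2) channel \<Rightarrow> nat \<Rightarrow> 'x1 list \<Rightarrow> 'x2 list \<Rightarrow> ('y1 \<times> 'y2) list pmf" where
  "channel_power W n x1 x2 =
     map_pmf (\<lambda>y. map y [0..<n]) (Pi_pmf {..<n} undefined (\<lambda>i. W (x1 ! i) (x2 ! i)))"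

lemma pmf_channel_power:
  assumes "length ys = n"
  shows "pmf (channel_power W n x1 x2) ys = (\<Prod>i<n. pmf (W (x1 ! i) (x2 ! i)) (ys ! i))"
proof -
  let ?P = "Pi_pmf {..<n} undefined (\<lambda>i. W (x1 ! i) (x2 ! i))"
  let ?y = "\<lambda>i. if i < n then ys ! i else undefined"
  have "map y [0..<n] = ys \<longleftrightarrow> y = ?y" if "y \<in> set_pmf ?P" for y
    using that assms set_Pi_pmf_subset[of "{..<n}" undefined "\<lambda>i. W (x1 ! i) (x2 ! i)"]
    by (auto simp: list_eq_iff_nth_eq fun_eq_iff)
  then have "measure_pmf.prob ?P {y. map y [0..<n] = ys} = measure_pmf.prob ?P {?y}"
    by (intro measure_pmf.finite_measure_eq_AE) (auto simp: AE_measure_pmf_iff)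
  then have "pmf (channel_power W n x1 x2) ys = pmf ?P ?y"
    by (simp add: channel_power_def pmf_map vimage_def measure_pmf_single)
  also have "\<dots> = (\<Prod>i<n. pmf (W (x1 ! i) (x2 ! i)) (?y i))"
    by (subst pmf_Pi') auto
  finally show ?thesis by simp
qed

definition block_code ::
    "nat \<Rightarrow> ('s list \<Rightarrow> 'x1 list) \<Rightarrow> ('t list \<Rightarrow> 'x2 list) \<Rightarrow>
     ('y1 list \<Rightarrow> 's list) \<Rightarrow> ('y2 list \<Rightarrow> 't list) \<Rightarrow> bool" where
  "block_code n f1 f2 \<phi>1 \<phi>2 \<longleftrightarrow>
     f1 \<in> seqs n \<rightarrow> seqs n \<and> f2 \<in> seqs n \<rightarrow> seqs n \<and>
     \<phi>1 \<in> seqs n \<rightarrow> seqs n \<and> \<phi>2 \<in> seqs n \<rightarrow> seqs n"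

definition code_law ::
    "('s \<times> 't) pmf \<Rightarrow> ('x1, 'x2, 'y1, 'y2) channel \<Rightarrow> nat \<Rightarrow>
     ('s list \<Rightarrow> 'x1 list) \<Rightarrow> ('t list \<Rightarrow> 'x2 list) \<Rightarrow>
     ('s list \<times> 't list \<times> 'y1 list \<times> 'y2 list) pmf" where
  "code_law p W n f1 f2 =
     do {
       st \<leftarrow> replicate_pmf n p;
       y \<leftarrow> channel_power W n (f1 (map fst st)) (f2 (map snd st));
       return_pmf (map fst st, map snd st, map fst y, map snd y)
     }"

text \<open>
  A conditional probability given a null event is 0 here; such terms carry weight 0 anyway.
\<close>

definition P_e1 ::
    "('s \<times> 't) pmf \<Rightarrow> ('x1, 'x2, 'y1, 'y2) channel \<Rightarrow> nat \<Rightarrow>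
     ('s list \<Rightarrow> 'x1 list) \<Rightarrow> ('t list \<Rightarrow> 'x2 list) \<Rightarrow> ('y1 list \<Rightarrow> 's list) \<Rightarrow> real" where
  "P_e1 p W n f1 f2 \<phi>1 =
     (\<Sum>s\<in>seqs n. pmf (map_pmf (map fst) (replicate_pmf n p)) s *
        \<P>((sn, tn, y1, y2) in measure_pmf (code_law p W n f1 f2). s \<noteq> \<phi>1 y1 \<bar> sn = s))"

definition P_e2 ::
    "('s \<times> 't) pmf \<Rightarrow> ('x1, 'x2, 'y1, 'y2) channel \<Rightarrow> nat \<Rightarrow>
     ('s list \<Rightarrow> 'x1 list) \<Rightarrow> ('t list \<Rightarrow> 'x2 list) \<Rightarrow> ('y2 list \<Rightarrow> 't list) \<Rightarrow> real" where
  "P_e2 p W n f1 f2 \<phi>2 =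
     (\<Sum>t\<in>seqs n. pmf (map_pmf (map snd) (replicate_pmf n p)) t *
        \<P>((sn, tn, y1, y2) in measure_pmf (code_law p W n f1 f2). t \<noteq> \<phi>2 y2 \<bar> tn = t))"

definition admissible ::
    "('s::finite \<times> 't::finite) pmf \<Rightarrow>
     ('x1::finite, 'x2::finite, 'y1::finite, 'y2::finite) channel \<Rightarrow> bool" where
  "admissible p W \<longleftrightarrow>
     (\<forall>\<epsilon>\<in>{0<..<1}. \<forall>\<^sub>F n in sequentially. \<exists>f1 f2 \<phi>1 \<phi>2.
        block_code n f1 f2 \<phi>1 \<phi>2 \<and> max (P_e1 p W n f1 f2 \<phi>1) (P_e2 p W n f1 f2 \<phi>2) \<le> \<epsilon>)"

end

theory Submission
  imports Defs
begin

text \<open>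
  Random superposition coding with a likelihood-threshold decoder in place of joint typicality.
  The common part selects a cloud centre \<open>w0\<close>; each user hashes its source word into one of
  \<open>M \<approx> 2 powr (n R)\<close> bins, the pair (common part, bin) selects a satellite word \<open>w1\<close> resp. \<open>w2\<close>, and the
  channel input is generated from source word, satellite and centre.  Receiver 1 looks for the unique
  source word that, together with some bin of user 2, passes five likelihood-ratio tests, one for each
  way in which a wrong candidate can share codewords with the truth: common part right and each of
  the two bins right or wrong, or common part wrong.  By change of measure, the expected number of wrong
  candidates passing a test is exponentially small, while the truth passes all of them by a
  Chernoff bound.  Both receivers succeed if the bin rates satisfy a system of linear
  inequalities; eliminating the rates leaves the stated conditions, since conditioning on
  an additional satellite only lowers the relevant informations.
\<close>

section \<open>Random codebooks\<close>

text \<open>The bin counts pull in opposite directions. A wrong source word with the right common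
  part shares the true satellite with probability \<open>1 / M1\<close>, so many bins protect a
  user's own receiver; the other receiver searches all \<open>M1\<close> bins and pays for each of
  them. This couples the two receivers. Receiver 1 never decodes the source word of user 2: it only
  guesses a bin, and a wrong guess beside the right source word does no harm. All source words
  compete, not only typical ones. This is affordable because each test multiplies a likelihood ratio
  by a prior weight of the candidate: the weights sum to at most 1, and their expected logarithm
  brings in the source entropies. The packing bound behind the tests holds for any law of the wrong
  codewords, so no law of a competitor has to be matched with the true conditional law. The union
  bound is proved for abstract alphabets, whose elements later become whole blocks. Receiver 2 is
  receiver 1 with the users exchanged, yet both must succeed with one codebook; hence the codebook
  is symmetric in the users.\<close>

definition prob_true :: "bool pmf \<Rightarrow> ennreal" where
  "prob_true M = ennreal (pmf M True)"

text \<open>In \<open>ennreal\<close> a sequential experiment becomes an iterated integral free of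
  integrability conditions, which is why error probabilities live there.\<close>

lemma prob_true_bind: "prob_true (bind_pmf M h) = (\<integral>\<^sup>+x. prob_true (h x) \<partial>measure_pmf M)"
  by (simp add: prob_true_def ennreal_pmf_bind)

lemma prob_true_return: "prob_true (return_pmf b) = of_bool b"
  by (cases b) (simp_all add: prob_true_def)

section \<open>Iterated integrals over discrete laws\<close>

lemma nn_integral_pmf_cong:
  "(\<And>x. x \<in> set_pmf M \<Longrightarrow> h x = h' x) \<Longrightarrow> (\<integral>\<^sup>+x. h x \<partial>measure_pmf M) = (\<integral>\<^sup>+x. h' x \<partial>measure_pmf M)"
  by (rule nn_integral_cong_AE) (simp add: AE_measure_pmf_iff)

lemma nn_integral_pmf_mono:
  "(\<And>x. x \<in> set_pmf M \<Longrightarrow> h x \<le> h' x) \<Longrightarrow> (\<integral>\<^sup>+x. h x \<partial>measure_pmf M) \<le> (\<integral>\<^sup>+x. h' x \<partial>measure_pmf M)"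
  by (rule nn_integral_mono_AE) (simp add: AE_measure_pmf_iff)

text \<open>The product of two discrete sigma-algebras need not be discrete, so the swap goes
  through \<open>pair_pmf\<close>, where every function is measurable.\<close>

lemma nn_integral_pmf_commute:
  "(\<integral>\<^sup>+x. (\<integral>\<^sup>+y. h x y \<partial>measure_pmf N) \<partial>measure_pmf M) = (\<integral>\<^sup>+y. (\<integral>\<^sup>+x. h x y \<partial>measure_pmf M) \<partial>measure_pmf N)"
proof -
  have "(\<integral>\<^sup>+x. (\<integral>\<^sup>+y. h x y \<partial>measure_pmf N) \<partial>measure_pmf M) = (\<integral>\<^sup>+z. h (fst z) (snd z) \<partial>measure_pmf (pair_pmf M N))"
    by (simp add: nn_integral_pair_pmf')
  also have "\<dots> = (\<integral>\<^sup>+z. h (snd z) (fst z) \<partial>measure_pmf (pair_pmf N M))"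
    by (subst pair_commute_pmf) (simp add: nn_integral_map_pmf case_prod_beta)
  also have "\<dots> = (\<integral>\<^sup>+y. (\<integral>\<^sup>+x. h x y \<partial>measure_pmf M) \<partial>measure_pmf N)"
    by (simp add: nn_integral_pair_pmf')
  finally show ?thesis .
qed

lemma nn_integral_Pi_pmf_component:
  assumes "finite A" "i \<in> A"
  shows "(\<integral>\<^sup>+x. h (x i) \<partial>measure_pmf (Pi_pmf A d P)) = (\<integral>\<^sup>+a. h a \<partial>measure_pmf (P i))"
proof -
  have "(\<integral>\<^sup>+x. h (x i) \<partial>measure_pmf (Pi_pmf A d P)) = (\<integral>\<^sup>+a. h a \<partial>measure_pmf (map_pmf (\<lambda>x. x i) (Pi_pmf A d P)))"
    by (simp add: nn_integral_map_pmf)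
  also have "map_pmf (\<lambda>x. x i) (Pi_pmf A d P) = P i"
    using assms by (simp add: Pi_pmf_component)
  finally show ?thesis .
qed

lemma nn_integral_Pi_pmf_two_components:
  assumes "finite A" "i \<in> A" "j \<in> A" "i \<noteq> j"
  shows "(\<integral>\<^sup>+x. h (x i) (x j) \<partial>measure_pmf (Pi_pmf A d P)) =
    (\<integral>\<^sup>+a. (\<integral>\<^sup>+b. h a b \<partial>measure_pmf (P j)) \<partial>measure_pmf (P i))"
proof -
  have A: "A = insert i (A - {i})" using assms by auto
  have "Pi_pmf A d P = map_pmf (\<lambda>(y, x). x(i := y)) (pair_pmf (P i) (Pi_pmf (A - {i}) d P))"
    using assms by (subst A, subst Pi_pmf_insert) auto
  then have "(\<integral>\<^sup>+x. h (x i) (x j) \<partial>measure_pmf (Pi_pmf A d P)) =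
     (\<integral>\<^sup>+a. (\<integral>\<^sup>+x. h a (x j) \<partial>measure_pmf (Pi_pmf (A - {i}) d P)) \<partial>measure_pmf (P i))"
    using assms by (simp add: nn_integral_map_pmf nn_integral_pair_pmf' case_prod_beta)
  then show ?thesis
    using assms by (simp add: nn_integral_Pi_pmf_component)
qed

lemma nn_integral_uniform_eq:
  fixes m M :: nat
  assumes "m < M"
  shows "(\<integral>\<^sup>+i. of_bool (i = m) * c \<partial>measure_pmf (pmf_of_set {..<M})) = ennreal (1 / real M) * c"
proof -
  have "(\<integral>\<^sup>+i. of_bool (i = m) * c \<partial>measure_pmf (pmf_of_set {..<M})) =
        (\<integral>\<^sup>+i. indicator {m} i * c \<partial>measure_pmf (pmf_of_set {..<M}))"
    by (intro nn_integral_cong) (auto simp: indicator_def)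
  also have "\<dots> = emeasure (measure_pmf (pmf_of_set {..<M})) {m} * c"
    by (subst nn_integral_multc) auto
  also have "emeasure (measure_pmf (pmf_of_set {..<M})) {m} = ennreal (1 / real M)"
    using assms by (subst emeasure_pmf_single, subst pmf_of_set) (auto simp: indicator_def lessThan_empty_iff)
  finally show ?thesis .
qed

text \<open>
  \<open>b s\<close> is the bin of the source word \<open>s\<close>, \<open>w (k, m)\<close> the satellite word of bin \<open>m\<close> around the
  centre \<open>w0 k\<close>.
\<close>

definition user_codebook ::
  "'s set \<Rightarrow> 'k set \<Rightarrow> nat \<Rightarrow> ('s \<Rightarrow> 'k) \<Rightarrow> ('z \<Rightarrow> 'w pmf) \<Rightarrow> ('s \<Rightarrow> 'w \<Rightarrow> 'z \<Rightarrow> 'x pmf) \<Rightarrow> ('k \<Rightarrow> 'z) \<Rightarrow>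
   (('s \<Rightarrow> nat) \<times> ('k \<times> nat \<Rightarrow> 'w) \<times> ('s \<Rightarrow> 'x)) pmf" where
  "user_codebook SS KK M f pw px w0 = do {
     b \<leftarrow> Pi_pmf SS undefined (\<lambda>_. pmf_of_set {..<M});
     w \<leftarrow> Pi_pmf (KK \<times> {..<M}) undefined (\<lambda>(k, m). pw (w0 k));
     x \<leftarrow> Pi_pmf SS undefined (\<lambda>s. px s (w (f s, b s)) (w0 (f s)));
     return_pmf (b, w, x) }"

section \<open>Averages over the codebook of one user\<close>

lemma nn_integral_user_codebook:
  "(\<integral>\<^sup>+c. h c \<partial>measure_pmf (user_codebook SS KK M f pw px w0)) =
   (\<integral>\<^sup>+b. (\<integral>\<^sup>+w. (\<integral>\<^sup>+x. h (b, w, x)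
      \<partial>measure_pmf (Pi_pmf SS undefined (\<lambda>s. px s (w (f s, b s)) (w0 (f s)))))
      \<partial>measure_pmf (Pi_pmf (KK \<times> {..<M}) undefined (\<lambda>(k, m). pw (w0 k))))
      \<partial>measure_pmf (Pi_pmf SS undefined (\<lambda>_. pmf_of_set {..<M})))"
  by (simp add: user_codebook_def nn_integral_bind_pmf)

lemma set_pmf_of_lessThan: "0 < M \<Longrightarrow> set_pmf (pmf_of_set {..<M::nat}) = {..<M}"
  by (simp add: lessThan_empty_iff set_pmf_of_set)

text \<open>Satellites are indexed by common part and bin together, so two indices name the same
  word only if both coordinates agree; otherwise the words are independent draws.\<close>

lemma nn_integral_codewords:
  fixes i i' M :: nat
  assumes "finite KK" "k \<in> KK" "k' \<in> KK" "i < M" "i' < M"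
  shows "(\<integral>\<^sup>+w. h (w (k, i)) (w (k', i')) \<partial>measure_pmf (Pi_pmf (KK \<times> {..<M}) undefined (\<lambda>(k, m). pw (w0 k)))) =
    (if k = k' \<and> i = i' then \<integral>\<^sup>+u. h u u \<partial>measure_pmf (pw (w0 k))
     else \<integral>\<^sup>+u. \<integral>\<^sup>+u'. h u u' \<partial>measure_pmf (pw (w0 k')) \<partial>measure_pmf (pw (w0 k)))"
proof (cases "k = k' \<and> i = i'")
  case True
  then show ?thesis
    using assms by (simp, intro nn_integral_Pi_pmf_component[of "KK \<times> {..<M}" "(k', i')", where h = "\<lambda>u. h u u", THEN trans]) auto
next
  case False
  then show ?thesis
    using assms nn_integral_Pi_pmf_two_components[of "KK \<times> {..<M}" "(k, i)" "(k', i')", where h = h] by auto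
qed

text \<open>Whatever bin the source word falls into, its satellite has the same law, so the average
  over bins leaves a single draw.\<close>

lemma nn_integral_user_codebook_true:
  assumes fin: "finite SS" "finite KK" and M: "0 < M" and s: "s \<in> SS" "f s \<in> KK"
  shows "(\<integral>\<^sup>+(b, w, x). h (w (f s, b s)) (x s) \<partial>measure_pmf (user_codebook SS KK M f pw px w0)) =
    (\<integral>\<^sup>+u. \<integral>\<^sup>+v. h u v \<partial>measure_pmf (px s u (w0 (f s))) \<partial>measure_pmf (pw (w0 (f s))))"
proof -
  define H where "H u = (\<integral>\<^sup>+v. h u v \<partial>measure_pmf (px s u (w0 (f s))))" for u
  have "(\<integral>\<^sup>+(b, w, x). h (w (f s, b s)) (x s) \<partial>measure_pmf (user_codebook SS KK M f pw px w0)) =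
     (\<integral>\<^sup>+b. \<integral>\<^sup>+w. H (w (f s, b s))
      \<partial>measure_pmf (Pi_pmf (KK \<times> {..<M}) undefined (\<lambda>(k, m). pw (w0 k)))
      \<partial>measure_pmf (Pi_pmf SS undefined (\<lambda>_. pmf_of_set {..<M})))"
    unfolding nn_integral_user_codebook prod.case H_def
    using nn_integral_Pi_pmf_component[OF fin(1) s(1)] by (intro nn_integral_cong) 
  also have "\<dots> = (\<integral>\<^sup>+i. \<integral>\<^sup>+w. H (w (f s, i))
      \<partial>measure_pmf (Pi_pmf (KK \<times> {..<M}) undefined (\<lambda>(k, m). pw (w0 k)))
      \<partial>measure_pmf (pmf_of_set {..<M}))"
    by (rule nn_integral_Pi_pmf_component[OF fin(1) s(1)])
  also have "\<dots> = (\<integral>\<^sup>+i. (\<integral>\<^sup>+u. H u \<partial>measure_pmf (pw (w0 (f s)))) \<partial>measure_pmf (pmf_of_set {..<M}))"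
    using M fin s nn_integral_Pi_pmf_component[of "KK \<times> {..<M}" "(f s, i)" for i, where h = H]
    by (intro nn_integral_pmf_cong) (auto simp: set_pmf_of_lessThan)
  finally show ?thesis by (simp add: H_def)
qed

text \<open>The two bins coincide with probability \<open>1 / M\<close>. If they do and the common
  parts agree, the source words share one satellite, though their inputs remain independent draws;
  in every other case the satellites are independent too. The independent term is charged with
  weight 1 instead of its true probability, hence the inequality.\<close>

lemma nn_integral_user_codebook_two_sources:
  assumes fin: "finite SS" "finite KK" and M: "0 < M"
    and s: "s \<in> SS" "f s \<in> KK" and s': "s' \<in> SS" "f s' \<in> KK" and ne: "s' \<noteq> s"
  shows "(\<integral>\<^sup>+(b, w, x). h (w (f s, b s)) (x s) (w (f s', b s')) (x s') \<partial>measure_pmf (user_codebook SS KK M f pw px w0)) \<le>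
    (\<integral>\<^sup>+u. \<integral>\<^sup>+v. (of_bool (f s' = f s) * ennreal (1 / real M)) * (\<integral>\<^sup>+v'. h u v u v' \<partial>measure_pmf (px s' u (w0 (f s')))) +
        (\<integral>\<^sup>+u'. \<integral>\<^sup>+v'. h u v u' v' \<partial>measure_pmf (px s' u' (w0 (f s'))) \<partial>measure_pmf (pw (w0 (f s'))))
      \<partial>measure_pmf (px s u (w0 (f s))) \<partial>measure_pmf (pw (w0 (f s))))"
proof -
  let ?U = "measure_pmf (pmf_of_set {..<M})"
  define H where "H u u' = (\<integral>\<^sup>+v. \<integral>\<^sup>+v'. h u v u' v' \<partial>measure_pmf (px s' u' (w0 (f s'))) \<partial>measure_pmf (px s u (w0 (f s))))" for u u'
  define D where "D = (\<integral>\<^sup>+u. H u u \<partial>measure_pmf (pw (w0 (f s))))"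
  define E where "E = (\<integral>\<^sup>+u. \<integral>\<^sup>+u'. H u u' \<partial>measure_pmf (pw (w0 (f s'))) \<partial>measure_pmf (pw (w0 (f s))))"
  have "(\<integral>\<^sup>+(b, w, x). h (w (f s, b s)) (x s) (w (f s', b s')) (x s') \<partial>measure_pmf (user_codebook SS KK M f pw px w0)) =
     (\<integral>\<^sup>+b. \<integral>\<^sup>+w. H (w (f s, b s)) (w (f s', b s'))
      \<partial>measure_pmf (Pi_pmf (KK \<times> {..<M}) undefined (\<lambda>(k, m). pw (w0 k)))
      \<partial>measure_pmf (Pi_pmf SS undefined (\<lambda>_. pmf_of_set {..<M})))"
    unfolding nn_integral_user_codebook prod.case H_def
    using ne by (intro nn_integral_cong nn_integral_Pi_pmf_two_components[OF fin(1) s(1) s'(1), where h = "\<lambda>v v'. h u v u' v'" for u u']) auto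
  also have "\<dots> = (\<integral>\<^sup>+i. \<integral>\<^sup>+i'. \<integral>\<^sup>+w. H (w (f s, i)) (w (f s', i'))
      \<partial>measure_pmf (Pi_pmf (KK \<times> {..<M}) undefined (\<lambda>(k, m). pw (w0 k))) \<partial>?U \<partial>?U)"
    using ne by (intro nn_integral_Pi_pmf_two_components[OF fin(1) s(1) s'(1)]) auto
  also have "\<dots> \<le> (\<integral>\<^sup>+i. \<integral>\<^sup>+i'. of_bool (i' = i) * (of_bool (f s' = f s) * D) + E \<partial>?U \<partial>?U)"
    using M by (intro nn_integral_pmf_mono)
      (auto simp: set_pmf_of_lessThan nn_integral_codewords[OF fin(2) s(2) s'(2)] D_def E_def add_increasing2 add_increasing)
  also have "\<dots> = (\<integral>\<^sup>+i. ennreal (1 / real M) * (of_bool (f s' = f s) * D) + E \<partial>?U)"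
    using M by (intro nn_integral_pmf_cong) (simp add: nn_integral_add nn_integral_uniform_eq set_pmf_of_lessThan)
  also have "\<dots> = (of_bool (f s' = f s) * ennreal (1 / real M)) * D + E"
    by (simp add: mult_ac)
  also have "E = (\<integral>\<^sup>+u. \<integral>\<^sup>+v. \<integral>\<^sup>+u'. \<integral>\<^sup>+v'. h u v u' v' \<partial>measure_pmf (px s' u' (w0 (f s'))) \<partial>measure_pmf (pw (w0 (f s')))
      \<partial>measure_pmf (px s u (w0 (f s))) \<partial>measure_pmf (pw (w0 (f s))))"
    unfolding E_def H_def by (intro nn_integral_cong) (subst nn_integral_pmf_commute, rule refl)
  finally show ?thesis
    unfolding D_def H_def by (simp add: nn_integral_add nn_integral_cmult)
qed

text \<open>Summing over the guesses \<open>m\<close> turns a probability into an expected count.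
  Each guess is the true bin with probability \<open>1 / M\<close>, which adds up to weight 1 for
  the true satellite; the other guesses, at most \<open>M\<close> of them, see a fresh word.\<close>

lemma nn_integral_user_codebook_interference:
  assumes fin: "finite TT" "finite KK" and M: "0 < M"
    and t: "t \<in> TT" "g t \<in> KK" and k': "k' \<in> KK"
  shows "(\<Sum>m<M. \<integral>\<^sup>+(b, w, x). h (w (g t, b t)) (x t) (w (k', m)) \<partial>measure_pmf (user_codebook TT KK M g pw px w0)) \<le>
    (\<integral>\<^sup>+u. \<integral>\<^sup>+v. of_bool (k' = g t) * h u v u + of_nat M * (\<integral>\<^sup>+u'. h u v u' \<partial>measure_pmf (pw (w0 k')))
      \<partial>measure_pmf (px t u (w0 (g t))) \<partial>measure_pmf (pw (w0 (g t))))"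
proof -
  let ?U = "measure_pmf (pmf_of_set {..<M})"
  define H where "H u u' = (\<integral>\<^sup>+v. h u v u' \<partial>measure_pmf (px t u (w0 (g t))))" for u u'
  define D where "D = (\<integral>\<^sup>+u. H u u \<partial>measure_pmf (pw (w0 (g t))))"
  define E where "E = (\<integral>\<^sup>+u. \<integral>\<^sup>+u'. H u u' \<partial>measure_pmf (pw (w0 k')) \<partial>measure_pmf (pw (w0 (g t))))"
  have "(\<integral>\<^sup>+(b, w, x). h (w (g t, b t)) (x t) (w (k', m)) \<partial>measure_pmf (user_codebook TT KK M g pw px w0)) \<le>
      ennreal (1 / real M) * (of_bool (k' = g t) * D) + E" if m: "m < M" for m
  proof -
    have "(\<integral>\<^sup>+(b, w, x). h (w (g t, b t)) (x t) (w (k', m)) \<partial>measure_pmf (user_codebook TT KK M g pw px w0)) =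
       (\<integral>\<^sup>+b. \<integral>\<^sup>+w. H (w (g t, b t)) (w (k', m))
        \<partial>measure_pmf (Pi_pmf (KK \<times> {..<M}) undefined (\<lambda>(k, m). pw (w0 k)))
        \<partial>measure_pmf (Pi_pmf TT undefined (\<lambda>_. pmf_of_set {..<M})))"
      unfolding nn_integral_user_codebook prod.case H_def
      using nn_integral_Pi_pmf_component[OF fin(1) t(1)] by (intro nn_integral_cong)
    also have "\<dots> = (\<integral>\<^sup>+i. \<integral>\<^sup>+w. H (w (g t, i)) (w (k', m))
        \<partial>measure_pmf (Pi_pmf (KK \<times> {..<M}) undefined (\<lambda>(k, m). pw (w0 k))) \<partial>?U)"
      by (intro nn_integral_Pi_pmf_component[OF fin(1) t(1)])
    also have "\<dots> \<le> (\<integral>\<^sup>+i. of_bool (i = m) * (of_bool (k' = g t) * D) + E \<partial>?U)"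
      using M m by (intro nn_integral_pmf_mono)
        (auto simp: set_pmf_of_lessThan nn_integral_codewords[OF fin(2) t(2) k'] D_def E_def add_increasing2 add_increasing)
    also have "\<dots> = ennreal (1 / real M) * (of_bool (k' = g t) * D) + E"
      using m by (simp add: nn_integral_add nn_integral_uniform_eq)
    finally show ?thesis .
  qed
  then have "(\<Sum>m<M. \<integral>\<^sup>+(b, w, x). h (w (g t, b t)) (x t) (w (k', m)) \<partial>measure_pmf (user_codebook TT KK M g pw px w0)) \<le>
     (\<Sum>m<M. ennreal (1 / real M) * (of_bool (k' = g t) * D) + E)"
    by (intro sum_mono) auto
  also have "\<dots> = (of_nat M * ennreal (1 / real M)) * (of_bool (k' = g t) * D) + of_nat M * E"
    by (simp add: distrib_left mult.assoc)
  also have "of_nat M * ennreal (1 / real M) = 1"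
    using M by (simp add: ennreal_of_nat_eq_real_of_nat flip: ennreal_mult)
  also have "E = (\<integral>\<^sup>+u. \<integral>\<^sup>+v. \<integral>\<^sup>+u'. h u v u' \<partial>measure_pmf (pw (w0 k'))
      \<partial>measure_pmf (px t u (w0 (g t))) \<partial>measure_pmf (pw (w0 (g t))))"
    unfolding E_def H_def by (intro nn_integral_cong) (subst nn_integral_pmf_commute, rule refl)
  finally show ?thesis
    unfolding D_def H_def by (simp add: nn_integral_add nn_integral_cmult)
qed

section \<open>Superposition codebook and decoder\<close>

definition codebook where
  "codebook SS TT KK M1 M2 f g pw0 pw1 pw2 px1 px2 = do {
     w0 \<leftarrow> Pi_pmf KK undefined (\<lambda>_. pw0);
     c1 \<leftarrow> user_codebook SS KK M1 f pw1 px1 w0;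
     c2 \<leftarrow> user_codebook TT KK M2 g pw2 px2 w0;
     return_pmf (w0, c1, c2) }"

text \<open>Given the centres the codebooks of the users are independent, so the drawing order is
  immaterial. This reduces receiver 2 to receiver 1.\<close>

lemma codebook_swap:
  "codebook TT SS KK M2 M1 g f pw0 pw2 pw1 px2 px1 =
   map_pmf (\<lambda>(w0, c1, c2). (w0, c2, c1)) (codebook SS TT KK M1 M2 f g pw0 pw1 pw2 px1 px2)"
  unfolding codebook_def map_bind_pmf map_return_pmf prod.case
  by (subst bind_commute_pmf) (rule refl)

lemma user_codebook_bins_less:
  assumes "finite SS" "0 < M" "(b, w, x) \<in> set_pmf (user_codebook SS KK M f pw px w0)" "s \<in> SS"
  shows "b s < M"
  using assms by (auto simp: user_codebook_def set_Pi_pmf set_pmf_of_lessThan PiE_dflt_def)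

text \<open>The users agree on the common part, so the candidate \<open>s\<close> itself determines
  around which centre the satellite of user 2 is sought; only its bin \<open>m\<close> is left to
  guess.\<close>

fun candidates where
  "candidates A f SS M2 (w0, (b1, w1, x1), (b2, w2, x2)) y =
     {s \<in> SS. \<exists>m<M2. A s (w0 (f s)) (w1 (f s, b1 s)) (w2 (f s, m)) (x1 s) y}"

text \<open>The fallback keeps the output inside \<open>SS\<close> on every input, as a block code
  demands.\<close>

definition decode where
  "decode A f SS M2 C y =
     (if is_singleton (candidates A f SS M2 C y) then the_elem (candidates A f SS M2 C y)
      else (SOME s. s \<in> SS))"

lemma decode_in:
  assumes "SS \<noteq> {}"
  shows "decode A f SS M2 C y \<in> SS"
proof (cases "is_singleton (candidates A f SS M2 C y)")
  case True
  then obtain s where s: "candidates A f SS M2 C y = {s}" by (auto simp: is_singleton_def)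
  then have "s \<in> SS" by (cases C) (auto split: prod.splits)
  with s True show ?thesis by (simp add: decode_def)
next
  case False
  with assms show ?thesis by (auto simp: decode_def some_in_eq)
qed

fun encoder1 where "encoder1 (w0, (b1, w1, x1), (b2, w2, x2)) = x1"
fun encoder2 where "encoder2 (w0, (b1, w1, x1), (b2, w2, x2)) = x2"

definition error_prob where
  "error_prob p N A f SS M2 C = prob_true (do {
     (s, t) \<leftarrow> p;
     y \<leftarrow> N (encoder1 C s) (encoder2 C t);
     return_pmf (decode A f SS M2 C y \<noteq> s) })"

section \<open>Average error of the random code over abstract alphabets\<close>

locale coding_scheme =
  fixes p :: "('s \<times> 't) pmf" and f :: "'s \<Rightarrow> 'k" and g :: "'t \<Rightarrow> 'k"
    and SS :: "'s set" and TT :: "'t set" and KK :: "'k set" and M1 M2 :: nat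
    and pw0 :: "'z pmf" and pw1 :: "'z \<Rightarrow> 'w1 pmf" and pw2 :: "'z \<Rightarrow> 'w2 pmf"
    and px1 :: "'s \<Rightarrow> 'w1 \<Rightarrow> 'z \<Rightarrow> 'x1 pmf" and px2 :: "'t \<Rightarrow> 'w2 \<Rightarrow> 'z \<Rightarrow> 'x2 pmf"
    and N :: "'x1 \<Rightarrow> 'x2 \<Rightarrow> 'y pmf"
    and A :: "'s \<Rightarrow> 'z \<Rightarrow> 'w1 \<Rightarrow> 'w2 \<Rightarrow> 'x1 \<Rightarrow> 'y \<Rightarrow> bool"
  assumes fin: "finite SS" "finite TT" "finite KK"
    and M_pos: "0 < M1" "0 < M2"
    and fK: "\<And>s. s \<in> SS \<Longrightarrow> f s \<in> KK" and gK: "\<And>t. t \<in> TT \<Longrightarrow> g t \<in> KK"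
    and supp: "\<And>s t. (s, t) \<in> set_pmf p \<Longrightarrow> s \<in> SS \<and> t \<in> TT \<and> f s = g t"
begin

text \<open>The outcome \<open>True\<close> is the failure: the right source word, tested with the
  right bin of user 2, is rejected. Both satellites surround the same \<open>z\<close> because the
  common parts agree.\<close>

definition truth :: "'s \<Rightarrow> 't \<Rightarrow> bool pmf" where
  "truth s t = do {
     z \<leftarrow> pw0; u1 \<leftarrow> pw1 z; v1 \<leftarrow> px1 s u1 z; u2 \<leftarrow> pw2 z; v2 \<leftarrow> px2 t u2 z; y \<leftarrow> N v1 v2;
     return_pmf (\<not> A s z u1 u2 v1 y) }"

text \<open>
  The candidate \<open>s'\<close> competes against the truth \<open>(s, t)\<close>: \<open>\<beta>1\<close> says that \<open>s'\<close> lies in the bin of \<open>s\<close>,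
  and \<open>\<beta>2\<close> that the bin guessed for user 2 is right; a satellite is drawn afresh when its
  bin is wrong.  In \<open>confuse_fresh\<close> the common part of \<open>s'\<close> is wrong.
\<close>

definition confuse :: "bool \<Rightarrow> bool \<Rightarrow> 's \<Rightarrow> 's \<Rightarrow> 't \<Rightarrow> bool pmf" where
  "confuse \<beta>1 \<beta>2 s' s t = do {
     z \<leftarrow> pw0; u1 \<leftarrow> pw1 z; v1 \<leftarrow> px1 s u1 z;
     u1' \<leftarrow> (if \<beta>1 then return_pmf u1 else pw1 z); v1' \<leftarrow> px1 s' u1' z;
     u2 \<leftarrow> pw2 z; v2 \<leftarrow> px2 t u2 z;
     u2' \<leftarrow> (if \<beta>2 then return_pmf u2 else pw2 z);
     y \<leftarrow> N v1 v2;
     return_pmf (f s' = f s \<and> A s' z u1' u2' v1' y) }"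

definition confuse_fresh :: "'s \<Rightarrow> 's \<Rightarrow> 't \<Rightarrow> bool pmf" where
  "confuse_fresh s' s t = do {
     z \<leftarrow> pw0; z' \<leftarrow> pw0; u1 \<leftarrow> pw1 z; v1 \<leftarrow> px1 s u1 z;
     u1' \<leftarrow> pw1 z'; v1' \<leftarrow> px1 s' u1' z';
     u2 \<leftarrow> pw2 z; v2 \<leftarrow> px2 t u2 z; u2' \<leftarrow> pw2 z';
     y \<leftarrow> N v1 v2;
     return_pmf (A s' z' u1' u2' v1' y) }"

abbreviation "book \<equiv> codebook SS TT KK M1 M2 f g pw0 pw1 pw2 px1 px2"
abbreviation "book0 \<equiv> Pi_pmf KK undefined (\<lambda>_. pw0)"
abbreviation "book1 w0 \<equiv> user_codebook SS KK M1 f pw1 px1 w0"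
abbreviation "book2 w0 \<equiv> user_codebook TT KK M2 g pw2 px2 w0"

lemma nn_integral_book:
  "(\<integral>\<^sup>+C. h C \<partial>measure_pmf book) =
   (\<integral>\<^sup>+w0. \<integral>\<^sup>+c1. \<integral>\<^sup>+c2. h (w0, c1, c2) \<partial>measure_pmf (book2 w0) \<partial>measure_pmf (book1 w0) \<partial>measure_pmf book0)"
  by (simp add: codebook_def nn_integral_bind_pmf)

text \<open>The sum over \<open>m\<close> makes this the expected number of accepting bins, so the
  union bound over the guesses is built in and the value may exceed 1.\<close>

definition hit :: "'s \<Rightarrow> 't \<Rightarrow> 's \<Rightarrow> _ \<Rightarrow> ennreal" where
  "hit s t s' = (\<lambda>(w0, (b1, w1, x1), (b2, w2, x2)). \<Sum>m<M2. \<integral>\<^sup>+y.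
     of_bool (A s' (w0 (f s')) (w1 (f s', b1 s')) (w2 (f s', m)) (x1 s') y) \<partial>measure_pmf (N (x1 s) (x2 t)))"

definition miss :: "'s \<Rightarrow> 't \<Rightarrow> _ \<Rightarrow> ennreal" where
  "miss s t = (\<lambda>(w0, (b1, w1, x1), (b2, w2, x2)). \<integral>\<^sup>+y.
     of_bool (\<not> A s (w0 (f s)) (w1 (f s, b1 s)) (w2 (f s, b2 t)) (x1 s) y) \<partial>measure_pmf (N (x1 s) (x2 t)))"

text \<open>If the truth passes with the right bin, it is a candidate, and decoding can fail only
  because some other source word is a candidate as well. The rest is a union bound over words and
  bins.\<close>

lemma error_prob_le:
  assumes C: "C \<in> set_pmf book"
  shows "error_prob p N A f SS M2 C \<le>
    (\<integral>\<^sup>+(s, t). miss s t C + (\<Sum>s'\<in>SS - {s}. hit s t s' C) \<partial>measure_pmf p)"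
proof -
  obtain w0 b1 w1 x1 b2 w2 x2 where C_eq: "C = (w0, (b1, w1, x1), (b2, w2, x2))"
    by (metis prod_cases3)
  \<comment> \<open>The true bin of user 2 must lie in the range searched by the decoder; otherwise
    passing the test would not make \<open>s\<close> a candidate.\<close>
  have b2: "b2 t < M2" if "t \<in> TT" for t
    using C user_codebook_bins_less[OF fin(2) M_pos(2) _ that, of b2 w2 x2] by (auto simp: C_eq codebook_def)
  have "error_prob p N A f SS M2 C = (\<integral>\<^sup>+(s, t). \<integral>\<^sup>+y. of_bool (decode A f SS M2 C y \<noteq> s)
      \<partial>measure_pmf (N (x1 s) (x2 t)) \<partial>measure_pmf p)"
    by (simp add: error_prob_def prob_true_bind prob_true_return C_eq split_def)
  also have "\<dots> \<le> (\<integral>\<^sup>+(s, t). miss s t C + (\<Sum>s'\<in>SS - {s}. hit s t s' C) \<partial>measure_pmf p)"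
  proof (rule nn_integral_pmf_mono, clarify)
    fix s t assume st: "(s, t) \<in> set_pmf p"
    note st = supp[OF st]
    have *: "of_bool (decode A f SS M2 C y \<noteq> s) \<le>
       of_bool (\<not> A s (w0 (f s)) (w1 (f s, b1 s)) (w2 (f s, b2 t)) (x1 s) y) +
       (\<Sum>s'\<in>SS - {s}. \<Sum>m<M2. of_bool (A s' (w0 (f s')) (w1 (f s', b1 s')) (w2 (f s', m)) (x1 s') y) :: ennreal)"
      (is "_ \<le> _ + ?S") for y
    proof (cases "decode A f SS M2 C y \<noteq> s \<and> A s (w0 (f s)) (w1 (f s, b1 s)) (w2 (f s, b2 t)) (x1 s) y")
      case True
      then have mem: "s \<in> candidates A f SS M2 C y" using st b2 by (auto simp: C_eq)
      have "decode A f SS M2 C y = s" if "candidates A f SS M2 C y = {s}"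
        using that by (simp add: decode_def)
      with True have "candidates A f SS M2 C y \<noteq> {s}" by blast
      with mem obtain s' where "s' \<in> candidates A f SS M2 C y" "s' \<noteq> s" by blast
      then obtain m where m: "s' \<in> SS - {s}" "m < M2" "A s' (w0 (f s')) (w1 (f s', b1 s')) (w2 (f s', m)) (x1 s') y"
        by (auto simp: C_eq)
      have "(1 :: ennreal) = of_bool (A s' (w0 (f s')) (w1 (f s', b1 s')) (w2 (f s', m)) (x1 s') y)"
        using m by simp
      also have "\<dots> \<le> (\<Sum>m<M2. of_bool (A s' (w0 (f s')) (w1 (f s', b1 s')) (w2 (f s', m)) (x1 s') y))"
        using m by (intro member_le_sum) auto
      also have "\<dots> \<le> ?S"
        using m fin by (intro member_le_sum[of s' "SS - {s}" "\<lambda>s'. \<Sum>m<M2. of_bool (A s' (w0 (f s')) (w1 (f s', b1 s')) (w2 (f s', m)) (x1 s') y)"]) auto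
      finally show ?thesis using True by simp
    qed auto
    have "(\<integral>\<^sup>+y. of_bool (decode A f SS M2 C y \<noteq> s) \<partial>measure_pmf (N (x1 s) (x2 t))) \<le>
      (\<integral>\<^sup>+y. of_bool (\<not> A s (w0 (f s)) (w1 (f s, b1 s)) (w2 (f s, b2 t)) (x1 s) y) +
       (\<Sum>s'\<in>SS - {s}. \<Sum>m<M2. of_bool (A s' (w0 (f s')) (w1 (f s', b1 s')) (w2 (f s', m)) (x1 s') y) :: ennreal)
       \<partial>measure_pmf (N (x1 s) (x2 t)))"
      by (intro nn_integral_mono *)
    also have "\<dots> = miss s t C + (\<Sum>s'\<in>SS - {s}. hit s t s' C)"
      by (simp add: C_eq miss_def hit_def nn_integral_add nn_integral_sum del: sum_of_bool_eq)
    finally show "(\<integral>\<^sup>+y. of_bool (decode A f SS M2 C y \<noteq> s) \<partial>measure_pmf (N (x1 s) (x2 t))) \<le>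
      miss s t C + (\<Sum>s'\<in>SS - {s}. hit s t s' C)" .
  qed
  finally show ?thesis .
qed

lemma nn_integral_miss:
  assumes "(s, t) \<in> set_pmf p"
  shows "(\<integral>\<^sup>+C. miss s t C \<partial>measure_pmf book) = prob_true (truth s t)"
proof -
  have st: "s \<in> SS" "t \<in> TT" "g t = f s" and K: "f s \<in> KK" "g t \<in> KK"
    using supp[OF assms] fK gK by auto
  define h where "h z u1 v1 u2 v2 = (\<integral>\<^sup>+y. of_bool (\<not> A s z u1 u2 v1 y) \<partial>measure_pmf (N v1 v2))" for z u1 v1 u2 v2
  have "(\<integral>\<^sup>+C. miss s t C \<partial>measure_pmf book) =
    (\<integral>\<^sup>+w0. \<integral>\<^sup>+(b1, w1, x1). \<integral>\<^sup>+(b2, w2, x2). h (w0 (f s)) (w1 (f s, b1 s)) (x1 s) (w2 (g t, b2 t)) (x2 t)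
      \<partial>measure_pmf (book2 w0) \<partial>measure_pmf (book1 w0) \<partial>measure_pmf book0)"
    unfolding nn_integral_book miss_def h_def by (simp add: split_def st)
  also have "\<dots> = (\<integral>\<^sup>+w0. \<integral>\<^sup>+u1. \<integral>\<^sup>+v1. \<integral>\<^sup>+u2. \<integral>\<^sup>+v2. h (w0 (f s)) u1 v1 u2 v2
      \<partial>measure_pmf (px2 t u2 (w0 (g t))) \<partial>measure_pmf (pw2 (w0 (g t)))
      \<partial>measure_pmf (px1 s u1 (w0 (f s))) \<partial>measure_pmf (pw1 (w0 (f s))) \<partial>measure_pmf book0)"
    unfolding nn_integral_user_codebook_true[where f = g, OF fin(2,3) M_pos(2) st(2) K(2)]
    by (subst nn_integral_user_codebook_true[where f = f, OF fin(1,3) M_pos(1) st(1) K(1)]) (rule refl)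
  also have "\<dots> = (\<integral>\<^sup>+z. \<integral>\<^sup>+u1. \<integral>\<^sup>+v1. \<integral>\<^sup>+u2. \<integral>\<^sup>+v2. h z u1 v1 u2 v2
      \<partial>measure_pmf (px2 t u2 z) \<partial>measure_pmf (pw2 z)
      \<partial>measure_pmf (px1 s u1 z) \<partial>measure_pmf (pw1 z) \<partial>measure_pmf pw0)"
    unfolding st(3) by (rule nn_integral_Pi_pmf_component[OF fin(3) K(1)])
  finally show ?thesis
    by (simp add: truth_def prob_true_bind prob_true_return h_def)
qed

text \<open>Given the centres the users' bins are independent, so the weights multiply:
  \<open>1 / M1\<close> or 1 for user 1 (same or fresh satellite), times 1 or \<open>M2\<close> for
  user 2 (right or wrong guess).\<close>

lemma nn_integral_hit_same:
  assumes "(s, t) \<in> set_pmf p" and s': "s' \<in> SS" "s' \<noteq> s" "f s' = f s"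
  shows "(\<integral>\<^sup>+C. hit s t s' C \<partial>measure_pmf book) \<le>
    ennreal (1 / real M1) * (prob_true (confuse True True s' s t) + of_nat M2 * prob_true (confuse True False s' s t)) +
    (prob_true (confuse False True s' s t) + of_nat M2 * prob_true (confuse False False s' s t))"
proof -
  have st: "s \<in> SS" "t \<in> TT" "g t = f s" and K: "f s \<in> KK" "g t \<in> KK" "f s' \<in> KK"
    using supp[OF assms(1)] fK gK s'(1) by auto
  define h where "h z v1 u1' v1' v2 u2' = (\<integral>\<^sup>+y. of_bool (A s' z u1' u2' v1' y) \<partial>measure_pmf (N v1 v2))" for z v1 u1' v1' v2 u2'
  define h2 where "h2 z v1 u1' v1' = (\<integral>\<^sup>+u2. \<integral>\<^sup>+v2. h z v1 u1' v1' v2 u2 + of_nat M2 * (\<integral>\<^sup>+u2'. h z v1 u1' v1' v2 u2' \<partial>measure_pmf (pw2 z))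
      \<partial>measure_pmf (px2 t u2 z) \<partial>measure_pmf (pw2 z))" for z v1 u1' v1'
  have inner: "(\<Sum>m<M2. \<integral>\<^sup>+(b2, w2, x2). h (w0 (f s)) v1 u1' v1' (x2 t) (w2 (f s, m))
      \<partial>measure_pmf (book2 w0)) \<le> h2 (w0 (f s)) v1 u1' v1'" for w0 v1 u1' v1'
    using nn_integral_user_codebook_interference[where g = g, OF fin(2,3) M_pos(2) st(2) K(2) K(1), where ?w0.0 = w0 and pw = pw2 and px = px2
      and h = "\<lambda>u2 v2 u2'. h (w0 (f s)) v1 u1' v1' v2 u2'"]
    by (simp add: h2_def st)
  have "(\<integral>\<^sup>+C. hit s t s' C \<partial>measure_pmf book) =
    (\<integral>\<^sup>+w0. \<integral>\<^sup>+(b1, w1, x1). (\<Sum>m<M2. \<integral>\<^sup>+(b2, w2, x2). h (w0 (f s)) (x1 s) (w1 (f s', b1 s')) (x1 s') (x2 t) (w2 (f s, m))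
      \<partial>measure_pmf (book2 w0)) \<partial>measure_pmf (book1 w0) \<partial>measure_pmf book0)"
    unfolding nn_integral_book hit_def h_def by (simp add: split_def s' nn_integral_sum)
  also have "\<dots> \<le> (\<integral>\<^sup>+w0. \<integral>\<^sup>+(b1, w1, x1). h2 (w0 (f s)) (x1 s) (w1 (f s', b1 s')) (x1 s')
      \<partial>measure_pmf (book1 w0) \<partial>measure_pmf book0)"
    using inner by (intro nn_integral_mono) (auto simp: split_def)
  also have "\<dots> \<le> (\<integral>\<^sup>+w0. \<integral>\<^sup>+u1. \<integral>\<^sup>+v1. ennreal (1 / real M1) * (\<integral>\<^sup>+v1'. h2 (w0 (f s)) v1 u1 v1' \<partial>measure_pmf (px1 s' u1 (w0 (f s)))) +
        (\<integral>\<^sup>+u1'. \<integral>\<^sup>+v1'. h2 (w0 (f s)) v1 u1' v1' \<partial>measure_pmf (px1 s' u1' (w0 (f s))) \<partial>measure_pmf (pw1 (w0 (f s))))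
      \<partial>measure_pmf (px1 s u1 (w0 (f s))) \<partial>measure_pmf (pw1 (w0 (f s))) \<partial>measure_pmf book0)"
  proof (rule nn_integral_mono)
    fix w0
    show "(\<integral>\<^sup>+(b1, w1, x1). h2 (w0 (f s)) (x1 s) (w1 (f s', b1 s')) (x1 s') \<partial>measure_pmf (book1 w0)) \<le>
      (\<integral>\<^sup>+u1. \<integral>\<^sup>+v1. ennreal (1 / real M1) * (\<integral>\<^sup>+v1'. h2 (w0 (f s)) v1 u1 v1' \<partial>measure_pmf (px1 s' u1 (w0 (f s)))) +
        (\<integral>\<^sup>+u1'. \<integral>\<^sup>+v1'. h2 (w0 (f s)) v1 u1' v1' \<partial>measure_pmf (px1 s' u1' (w0 (f s))) \<partial>measure_pmf (pw1 (w0 (f s))))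
      \<partial>measure_pmf (px1 s u1 (w0 (f s))) \<partial>measure_pmf (pw1 (w0 (f s))))"
      using nn_integral_user_codebook_two_sources[where f = f, OF fin(1,3) M_pos(1) st(1) K(1) s'(1) K(3) s'(2), where ?w0.0 = w0 and pw = pw1 and px = px1
        and h = "\<lambda>u1 v1 u1' v1'. h2 (w0 (f s)) v1 u1' v1'"]
      by (simp add: s')
  qed
  also have "\<dots> = (\<integral>\<^sup>+z. \<integral>\<^sup>+u1. \<integral>\<^sup>+v1. ennreal (1 / real M1) * (\<integral>\<^sup>+v1'. h2 z v1 u1 v1' \<partial>measure_pmf (px1 s' u1 z)) +
        (\<integral>\<^sup>+u1'. \<integral>\<^sup>+v1'. h2 z v1 u1' v1' \<partial>measure_pmf (px1 s' u1' z) \<partial>measure_pmf (pw1 z))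
      \<partial>measure_pmf (px1 s u1 z) \<partial>measure_pmf (pw1 z) \<partial>measure_pmf pw0)"
    by (rule nn_integral_Pi_pmf_component[OF fin(3) K(1)])
  also have "\<dots> = ennreal (1 / real M1) * (prob_true (confuse True True s' s t) + of_nat M2 * prob_true (confuse True False s' s t)) +
    (prob_true (confuse False True s' s t) + of_nat M2 * prob_true (confuse False False s' s t))"
    by (simp add: confuse_def prob_true_bind prob_true_return h2_def h_def s' nn_integral_add nn_integral_cmult distrib_left bind_return_pmf)
  finally show ?thesis .
qed

text \<open>A different common part selects a different centre, so all satellites of the candidate
  are fresh whatever the bins are; neither the collision term of user 1 nor the right-guess term of
  user 2 survives.\<close>

lemma nn_integral_hit_other:
  assumes "(s, t) \<in> set_pmf p" and s': "s' \<in> SS" "f s' \<noteq> f s"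
  shows "(\<integral>\<^sup>+C. hit s t s' C \<partial>measure_pmf book) \<le> of_nat M2 * prob_true (confuse_fresh s' s t)"
proof -
  have st: "s \<in> SS" "t \<in> TT" "g t = f s" and K: "f s \<in> KK" "g t \<in> KK" "f s' \<in> KK" and ne: "s' \<noteq> s"
    using supp[OF assms(1)] fK gK s' by auto
  define h where "h z v1 u1' v1' v2 u2' = (\<integral>\<^sup>+y. of_bool (A s' z u1' u2' v1' y) \<partial>measure_pmf (N v1 v2))" for z v1 u1' v1' v2 u2'
  define h2 where "h2 z z' v1 u1' v1' = (\<integral>\<^sup>+u2. \<integral>\<^sup>+v2. of_nat M2 * (\<integral>\<^sup>+u2'. h z' v1 u1' v1' v2 u2' \<partial>measure_pmf (pw2 z'))
      \<partial>measure_pmf (px2 t u2 z) \<partial>measure_pmf (pw2 z))" for z z' v1 u1' v1'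
  have "(\<integral>\<^sup>+C. hit s t s' C \<partial>measure_pmf book) =
    (\<integral>\<^sup>+w0. \<integral>\<^sup>+(b1, w1, x1). (\<Sum>m<M2. \<integral>\<^sup>+(b2, w2, x2). h (w0 (f s')) (x1 s) (w1 (f s', b1 s')) (x1 s') (x2 t) (w2 (f s', m))
      \<partial>measure_pmf (book2 w0)) \<partial>measure_pmf (book1 w0) \<partial>measure_pmf book0)"
    unfolding nn_integral_book hit_def h_def by (simp add: split_def s' nn_integral_sum)
  also have "\<dots> \<le> (\<integral>\<^sup>+w0. \<integral>\<^sup>+(b1, w1, x1). h2 (w0 (f s)) (w0 (f s')) (x1 s) (w1 (f s', b1 s')) (x1 s')
      \<partial>measure_pmf (book1 w0) \<partial>measure_pmf book0)"
  proof (intro nn_integral_mono, clarify)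
    fix w0 b1 w1 x1
    show "(\<Sum>m<M2. \<integral>\<^sup>+(b2, w2, x2). h (w0 (f s')) (x1 s) (w1 (f s', b1 s')) (x1 s') (x2 t) (w2 (f s', m))
        \<partial>measure_pmf (book2 w0)) \<le> h2 (w0 (f s)) (w0 (f s')) (x1 s) (w1 (f s', b1 s')) (x1 s')"
      using nn_integral_user_codebook_interference[where g = g, OF fin(2,3) M_pos(2) st(2) K(2) K(3), where ?w0.0 = w0 and pw = pw2 and px = px2
        and h = "\<lambda>u2 v2 u2'. h (w0 (f s')) (x1 s) (w1 (f s', b1 s')) (x1 s') v2 u2'"] s'
      by (simp add: h2_def st)
  qed
  also have "\<dots> \<le> (\<integral>\<^sup>+w0. \<integral>\<^sup>+u1. \<integral>\<^sup>+v1. \<integral>\<^sup>+u1'. \<integral>\<^sup>+v1'. h2 (w0 (f s)) (w0 (f s')) v1 u1' v1'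
      \<partial>measure_pmf (px1 s' u1' (w0 (f s'))) \<partial>measure_pmf (pw1 (w0 (f s')))
      \<partial>measure_pmf (px1 s u1 (w0 (f s))) \<partial>measure_pmf (pw1 (w0 (f s))) \<partial>measure_pmf book0)"
  proof (rule nn_integral_mono)
    fix w0
    show "(\<integral>\<^sup>+(b1, w1, x1). h2 (w0 (f s)) (w0 (f s')) (x1 s) (w1 (f s', b1 s')) (x1 s') \<partial>measure_pmf (book1 w0)) \<le>
      (\<integral>\<^sup>+u1. \<integral>\<^sup>+v1. \<integral>\<^sup>+u1'. \<integral>\<^sup>+v1'. h2 (w0 (f s)) (w0 (f s')) v1 u1' v1'
      \<partial>measure_pmf (px1 s' u1' (w0 (f s'))) \<partial>measure_pmf (pw1 (w0 (f s')))
      \<partial>measure_pmf (px1 s u1 (w0 (f s))) \<partial>measure_pmf (pw1 (w0 (f s))))"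
      using nn_integral_user_codebook_two_sources[where f = f, OF fin(1,3) M_pos(1) st(1) K(1) s'(1) K(3) ne, where ?w0.0 = w0 and pw = pw1 and px = px1
        and h = "\<lambda>u1 v1 u1' v1'. h2 (w0 (f s)) (w0 (f s')) v1 u1' v1'"] s'
      by simp
  qed
  also have "\<dots> = (\<integral>\<^sup>+z. \<integral>\<^sup>+z'. \<integral>\<^sup>+u1. \<integral>\<^sup>+v1. \<integral>\<^sup>+u1'. \<integral>\<^sup>+v1'. h2 z z' v1 u1' v1'
      \<partial>measure_pmf (px1 s' u1' z') \<partial>measure_pmf (pw1 z')
      \<partial>measure_pmf (px1 s u1 z) \<partial>measure_pmf (pw1 z) \<partial>measure_pmf pw0 \<partial>measure_pmf pw0)"
    using s' by (intro nn_integral_Pi_pmf_two_components[OF fin(3) K(1,3)]) auto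
  also have "\<dots> = of_nat M2 * prob_true (confuse_fresh s' s t)"
    by (simp add: confuse_fresh_def prob_true_bind prob_true_return h2_def h_def nn_integral_cmult)
  finally show ?thesis .
qed

lemma nn_integral_hit:
  assumes "(s, t) \<in> set_pmf p" and s': "s' \<in> SS" "s' \<noteq> s"
  shows "(\<integral>\<^sup>+C. hit s t s' C \<partial>measure_pmf book) \<le>
    ennreal (1 / real M1) * (prob_true (confuse True True s' s t) + of_nat M2 * prob_true (confuse True False s' s t)) +
    (prob_true (confuse False True s' s t) + of_nat M2 * prob_true (confuse False False s' s t)) +
    of_nat M2 * prob_true (confuse_fresh s' s t)"
  using nn_integral_hit_same[OF assms] nn_integral_hit_other[OF assms(1,2)]
  by (cases "f s' = f s") (auto intro: order_trans add_increasing add_increasing2)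

theorem average_error_le:
  "(\<integral>\<^sup>+C. error_prob p N A f SS M2 C \<partial>measure_pmf book) \<le>
    prob_true (do {(s, t) \<leftarrow> p; truth s t}) + (
    ennreal (1 / real M1) * (\<Sum>s'\<in>SS. prob_true (do {(s, t) \<leftarrow> p; confuse True True s' s t})) +
    ennreal (1 / real M1) * (of_nat M2 * (\<Sum>s'\<in>SS. prob_true (do {(s, t) \<leftarrow> p; confuse True False s' s t}))) +
    (\<Sum>s'\<in>SS. prob_true (do {(s, t) \<leftarrow> p; confuse False True s' s t})) +
    of_nat M2 * (\<Sum>s'\<in>SS. prob_true (do {(s, t) \<leftarrow> p; confuse False False s' s t})) +
    of_nat M2 * (\<Sum>s'\<in>SS. prob_true (do {(s, t) \<leftarrow> p; confuse_fresh s' s t})))"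
proof -
  let ?B = "\<lambda>s' s t. ennreal (1 / real M1) * (prob_true (confuse True True s' s t) + of_nat M2 * prob_true (confuse True False s' s t)) +
    (prob_true (confuse False True s' s t) + of_nat M2 * prob_true (confuse False False s' s t)) +
    of_nat M2 * prob_true (confuse_fresh s' s t)"
  have "(\<integral>\<^sup>+C. error_prob p N A f SS M2 C \<partial>measure_pmf book) \<le>
     (\<integral>\<^sup>+C. \<integral>\<^sup>+(s, t). miss s t C + (\<Sum>s'\<in>SS - {s}. hit s t s' C) \<partial>measure_pmf p \<partial>measure_pmf book)"
    by (intro nn_integral_pmf_mono error_prob_le)
  also have "\<dots> = (\<integral>\<^sup>+st. \<integral>\<^sup>+C. miss (fst st) (snd st) C + (\<Sum>s'\<in>SS - {fst st}. hit (fst st) (snd st) s' C) \<partial>measure_pmf book \<partial>measure_pmf p)"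
    unfolding case_prod_beta by (rule nn_integral_pmf_commute)
  also have "\<dots> = (\<integral>\<^sup>+(s, t). (\<integral>\<^sup>+C. miss s t C \<partial>measure_pmf book) +
      (\<Sum>s'\<in>SS - {s}. \<integral>\<^sup>+C. hit s t s' C \<partial>measure_pmf book) \<partial>measure_pmf p)"
    unfolding split_def by (simp add: nn_integral_add nn_integral_sum)
  also have "\<dots> \<le> (\<integral>\<^sup>+(s, t). prob_true (truth s t) + (\<Sum>s'\<in>SS. ?B s' s t) \<partial>measure_pmf p)"
  proof (rule nn_integral_pmf_mono, clarify)
    fix s t assume st: "(s, t) \<in> set_pmf p"
    have "(\<Sum>s'\<in>SS - {s}. \<integral>\<^sup>+C. hit s t s' C \<partial>measure_pmf book) \<le> (\<Sum>s'\<in>SS - {s}. ?B s' s t)"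
      by (intro sum_mono nn_integral_hit[OF st]) auto
    \<comment> \<open>Readmitting \<open>s' = s\<close> makes the index set independent of the
      truth, so that the sum can leave the integral over the source.\<close>
    also have "\<dots> \<le> (\<Sum>s'\<in>SS. ?B s' s t)"
      using fin by (intro sum_mono2) auto
    finally show "(\<integral>\<^sup>+C. miss s t C \<partial>measure_pmf book) + (\<Sum>s'\<in>SS - {s}. \<integral>\<^sup>+C. hit s t s' C \<partial>measure_pmf book) \<le>
      prob_true (truth s t) + (\<Sum>s'\<in>SS. ?B s' s t)"
      unfolding nn_integral_miss[OF st] by (rule add_left_mono)
  qed
  also have "\<dots> = prob_true (do {(s, t) \<leftarrow> p; truth s t}) + (
    ennreal (1 / real M1) * (\<Sum>s'\<in>SS. prob_true (do {(s, t) \<leftarrow> p; confuse True True s' s t})) +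
    ennreal (1 / real M1) * (of_nat M2 * (\<Sum>s'\<in>SS. prob_true (do {(s, t) \<leftarrow> p; confuse True False s' s t}))) +
    (\<Sum>s'\<in>SS. prob_true (do {(s, t) \<leftarrow> p; confuse False True s' s t})) +
    of_nat M2 * (\<Sum>s'\<in>SS. prob_true (do {(s, t) \<leftarrow> p; confuse False False s' s t})) +
    of_nat M2 * (\<Sum>s'\<in>SS. prob_true (do {(s, t) \<leftarrow> p; confuse_fresh s' s t})))"
    unfolding split_def prob_true_bind
    by (simp add: nn_integral_add nn_integral_sum nn_integral_cmult
        sum.distrib distrib_left sum_distrib_left)
  finally show ?thesis .
qed

end

section \<open>Blocks of independent letters\<close>

abbreviation block_pmf :: "nat \<Rightarrow> (nat \<Rightarrow> 'a pmf) \<Rightarrow> (nat \<Rightarrow> 'a) pmf" where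
  "block_pmf n \<equiv> Pi_pmf {..<n} undefined"

lemma block_pmf_bind:
  "block_pmf n (\<lambda>i. bind_pmf (K i) (L i)) = bind_pmf (block_pmf n K) (\<lambda>x. block_pmf n (\<lambda>i. L i (x i)))"
  by (rule Pi_pmf_bind) simp

lemma block_pmf_return:
  "block_pmf n (\<lambda>i. return_pmf (h i)) = return_pmf (\<lambda>i. if i < n then h i else undefined)"
  by (subst Pi_pmf_return_pmf) auto

section \<open>Markov and Chernoff bounds for products of independent letters\<close>

lemma nn_integral_of_bool_prod_ge_le:
  fixes G :: "nat \<Rightarrow> 'a \<Rightarrow> ennreal"
  assumes "0 < c"
  shows "(\<integral>\<^sup>+x. of_bool (ennreal c \<le> (\<Prod>i<n. G i (x i))) \<partial>measure_pmf (Pi_pmf {..<n} d K)) \<le>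
    ennreal (1 / c) * (\<Prod>i<n. \<integral>\<^sup>+a. G i a \<partial>measure_pmf (K i))"
proof -
  have "(\<integral>\<^sup>+x. of_bool (ennreal c \<le> (\<Prod>i<n. G i (x i))) \<partial>measure_pmf (Pi_pmf {..<n} d K)) \<le>
    (\<integral>\<^sup>+x. ennreal (1 / c) * (\<Prod>i<n. G i (x i)) \<partial>measure_pmf (Pi_pmf {..<n} d K))"
  proof (rule nn_integral_mono)
    fix x
    show "of_bool (ennreal c \<le> (\<Prod>i<n. G i (x i))) \<le> ennreal (1 / c) * (\<Prod>i<n. G i (x i))"
    proof (cases "ennreal c \<le> (\<Prod>i<n. G i (x i))")
      case True
      have "1 = ennreal (1 / c) * ennreal c" using assms by (simp flip: ennreal_mult)
      also have "\<dots> \<le> ennreal (1 / c) * (\<Prod>i<n. G i (x i))" using True by (intro mult_left_mono) auto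
      finally show ?thesis using True by simp
    qed auto
  qed
  also have "\<dots> = ennreal (1 / c) * (\<Prod>i<n. \<integral>\<^sup>+a. G i a \<partial>measure_pmf (K i))"
    by (simp add: nn_integral_cmult nn_integral_prod_Pi_pmf)
  finally show ?thesis .
qed

text \<open>The moment generating function \<phi> of \<open>a\<close> equals 1 at 0, and its
  derivative there is \<open>ln 2\<close> times the difference of \<theta> and the expected
  logarithm of \<open>G\<close>. This is negative, so \<phi> dips below 1 for small positive
  arguments.\<close>

lemma ex_tilt_less_1:
  fixes G :: "'r \<Rightarrow> real"
  assumes fin: "finite (set_pmf R)" and pos: "\<And>r. r \<in> set_pmf R \<Longrightarrow> 0 < G r"
    and E: "\<theta> < measure_pmf.expectation R (\<lambda>r. log 2 (G r))"
  shows "\<exists>l>0. \<exists>\<rho><1. 0 \<le> \<rho> \<and> (\<integral>\<^sup>+r. ennreal ((2 powr \<theta> / G r) powr l) \<partial>measure_pmf R) = ennreal \<rho>"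
proof -
  define a where "a r = ln 2 * (\<theta> - log 2 (G r))" for r
  define \<phi> where "\<phi> l = (\<Sum>r\<in>set_pmf R. exp (l * a r) * pmf R r)" for l
  have "(\<phi> has_real_derivative (\<Sum>r\<in>set_pmf R. a r * pmf R r)) (at 0)"
    unfolding \<phi>_def by (auto intro!: derivative_eq_intros sum.cong)
  moreover have "(\<Sum>r\<in>set_pmf R. a r * pmf R r) = ln 2 * (\<theta> - measure_pmf.expectation R (\<lambda>r. log 2 (G r)))"
  proof -
    have "(\<Sum>r\<in>set_pmf R. a r * pmf R r) = ln 2 * (\<theta> * (\<Sum>r\<in>set_pmf R. pmf R r) - (\<Sum>r\<in>set_pmf R. log 2 (G r) * pmf R r))"
      by (simp add: a_def sum_distrib_left sum_subtractf algebra_simps)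
    then show ?thesis
      using sum_pmf_eq_1[OF fin, of R] by (simp add: integral_measure_pmf_real[OF fin])
  qed
  moreover have "ln 2 * (\<theta> - measure_pmf.expectation R (\<lambda>r. log 2 (G r))) < 0"
    using E by (intro mult_pos_neg) auto
  ultimately obtain d where d: "d > 0" "\<And>h. 0 < h \<Longrightarrow> h < d \<Longrightarrow> \<phi> (0 + h) < \<phi> 0"
    using DERIV_neg_dec_right[of \<phi> _ 0] by metis
  define l where "l = d / 2"
  have l: "0 < l" "l < d" using d by (auto simp: l_def)
  have "\<phi> 0 = 1" using sum_pmf_eq_1[OF fin, of R] by (simp add: \<phi>_def)
  with d(2)[OF l] have less: "\<phi> l < 1" by simp
  have "(\<integral>\<^sup>+r. ennreal ((2 powr \<theta> / G r) powr l) \<partial>measure_pmf R) = (\<integral>\<^sup>+r. ennreal (exp (l * a r)) \<partial>measure_pmf R)"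
    by (intro nn_integral_pmf_cong, frule pos) (auto simp: powr_def a_def log_def ln_div algebra_simps)
  also have "\<dots> = ennreal (\<phi> l)"
    by (simp add: nn_integral_measure_pmf_finite[OF fin] \<phi>_def sum_ennreal flip: ennreal_mult)
  finally show ?thesis
    using l less by (intro exI[of _ l] conjI exI[of _ "\<phi> l"]) (auto simp: \<phi>_def intro!: sum_nonneg)
qed

text \<open>Raising \<open>2 powr \<theta> / G\<close> to the tilting exponent turns a too small
  product into a Markov event at level 1 for factors of mean \<open>\<rho> < 1\<close>.\<close>

lemma chernoff_block:
  fixes G :: "'r \<Rightarrow> real"
  assumes fin: "finite (set_pmf R)" and pos: "\<And>r. r \<in> set_pmf R \<Longrightarrow> 0 < G r"
    and E: "\<theta> < measure_pmf.expectation R (\<lambda>r. log 2 (G r))"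
  shows "\<exists>\<rho><1. 0 \<le> \<rho> \<and> (\<forall>n. (\<integral>\<^sup>+x. of_bool (\<not> 2 powr (real n * \<theta>) \<le> (\<Prod>i<n. G (x i)))
    \<partial>measure_pmf (block_pmf n (\<lambda>_. R))) \<le> ennreal (\<rho> ^ n))"
proof -
  obtain l \<rho> where l: "0 < l" "\<rho> < 1" "0 \<le> \<rho>"
    and \<rho>: "(\<integral>\<^sup>+r. ennreal ((2 powr \<theta> / G r) powr l) \<partial>measure_pmf R) = ennreal \<rho>"
    using ex_tilt_less_1[OF assms] by blast
  have "(\<integral>\<^sup>+x. of_bool (\<not> 2 powr (real n * \<theta>) \<le> (\<Prod>i<n. G (x i))) \<partial>measure_pmf (block_pmf n (\<lambda>_. R))) \<le> ennreal (\<rho> ^ n)" for n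
  proof -
    have "(\<integral>\<^sup>+x. of_bool (\<not> 2 powr (real n * \<theta>) \<le> (\<Prod>i<n. G (x i))) \<partial>measure_pmf (block_pmf n (\<lambda>_. R))) \<le>
      (\<integral>\<^sup>+x. of_bool (ennreal 1 \<le> (\<Prod>i<n. ennreal ((2 powr \<theta> / G (x i)) powr l))) \<partial>measure_pmf (block_pmf n (\<lambda>_. R)))"
    proof (rule nn_integral_pmf_mono)
      fix x assume "x \<in> set_pmf (block_pmf n (\<lambda>_. R))"
      then have x: "0 < G (x i)" if "i < n" for i
        using that pos by (auto simp: set_Pi_pmf PiE_dflt_def)
      show "of_bool (\<not> 2 powr (real n * \<theta>) \<le> (\<Prod>i<n. G (x i))) \<le>
        (of_bool (ennreal 1 \<le> (\<Prod>i<n. ennreal ((2 powr \<theta> / G (x i)) powr l))) :: ennreal)"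
      proof (cases "2 powr (real n * \<theta>) \<le> (\<Prod>i<n. G (x i))")
        case False
        have pp: "0 < (\<Prod>i<n. G (x i))" using x by (intro prod_pos) auto
        have "1 \<le> ((\<Prod>i<n. 2 powr \<theta> / G (x i)) powr l)"
          using False pp l by (intro ge_one_powr_ge_zero) (auto simp: prod_dividef powr_realpow powr_power mult.commute)
        also have "\<dots> = (\<Prod>i<n. (2 powr \<theta> / G (x i)) powr l)"
          by (rule prod_powr_distrib)
        finally show ?thesis by (subst prod_ennreal) auto
      qed auto
    qed
    also have "\<dots> \<le> ennreal (1 / 1) * (\<Prod>i<n. \<integral>\<^sup>+r. ennreal ((2 powr \<theta> / G r) powr l) \<partial>measure_pmf R)"
      by (rule nn_integral_of_bool_prod_ge_le) simp
    also have "\<dots> = ennreal (\<rho> ^ n)"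
      by (simp add: \<rho> ennreal_power l)
    finally show ?thesis .
  qed
  with l show ?thesis by blast
qed

text \<open>A sum over all words of a product over positions is a product of single-letter sums,
  each at most 1. Thus exponentially many competing words cost nothing once the single-letter sum is
  controlled.\<close>

lemma sum_nn_integral_of_bool_prod_ge_le:
  fixes G :: "'s::finite \<Rightarrow> 'r \<Rightarrow> ennreal" and n :: nat
  assumes "0 < c" and sum: "(\<Sum>s\<in>UNIV. \<integral>\<^sup>+r. G s r \<partial>measure_pmf (K s)) \<le> 1"
  shows "(\<Sum>s\<in>{..<n} \<rightarrow>\<^sub>E UNIV. \<integral>\<^sup>+x. of_bool (ennreal c \<le> (\<Prod>i<n. G (s i) (x i)))
     \<partial>measure_pmf (Pi_pmf {..<n} d (\<lambda>i. K (s i)))) \<le> ennreal (1 / c)"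
proof -
  have "(\<Sum>s\<in>{..<n} \<rightarrow>\<^sub>E UNIV. \<integral>\<^sup>+x. of_bool (ennreal c \<le> (\<Prod>i<n. G (s i) (x i)))
     \<partial>measure_pmf (Pi_pmf {..<n} d (\<lambda>i. K (s i)))) \<le>
    (\<Sum>s\<in>{..<n} \<rightarrow>\<^sub>E UNIV. ennreal (1 / c) * (\<Prod>i<n. \<integral>\<^sup>+r. G (s i) r \<partial>measure_pmf (K (s i))))"
  proof (rule sum_mono)
    fix s :: "nat \<Rightarrow> 's"
    show "(\<integral>\<^sup>+x. of_bool (ennreal c \<le> (\<Prod>i<n. G (s i) (x i))) \<partial>measure_pmf (Pi_pmf {..<n} d (\<lambda>i. K (s i)))) \<le>
      ennreal (1 / c) * (\<Prod>i<n. \<integral>\<^sup>+r. G (s i) r \<partial>measure_pmf (K (s i)))"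
      by (rule nn_integral_of_bool_prod_ge_le[where G = "\<lambda>i. G (s i)" and K = "\<lambda>i. K (s i)", OF assms(1)])
  qed
  also have "\<dots> = ennreal (1 / c) * (\<Prod>i<n. \<Sum>s\<in>UNIV. \<integral>\<^sup>+r. G s r \<partial>measure_pmf (K s))"
    by (subst prod_sum_PiE) (auto simp: sum_distrib_left)
  also have "\<dots> \<le> ennreal (1 / c) * 1"
    using power_mono[OF sum, of n] by (intro mult_left_mono) simp_all
  finally show ?thesis by simp
qed

section \<open>Block codebooks assembled from single-letter laws\<close>

definition block_source :: "nat \<Rightarrow> ('s \<times> 't) pmf \<Rightarrow> ((nat \<Rightarrow> 's) \<times> (nat \<Rightarrow> 't)) pmf" where
  "block_source n p =
     map_pmf (\<lambda>st. (fst \<circ> st, snd \<circ> st)) (Pi_pmf {..<n} (undefined, undefined) (\<lambda>_. p))"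

definition block_map :: "nat \<Rightarrow> ('a \<Rightarrow> 'b) \<Rightarrow> (nat \<Rightarrow> 'a) \<Rightarrow> nat \<Rightarrow> 'b" where
  "block_map n f x = (\<lambda>i. if i < n then f (x i) else undefined)"

lemma block_map_eq_iff: "block_map n f x = block_map n g y \<longleftrightarrow> (\<forall>i<n. f (x i) = g (y i))"
  by (auto simp: block_map_def fun_eq_iff)

text \<open>The centres are indexed by words over \<open>range f \<union> range g\<close>, which
  stays the same set when the users are exchanged.\<close>

definition block_codebook where
  "block_codebook n M1 M2 f g pw0 pw1 pw2 px1 px2 =
     codebook ({..<n} \<rightarrow>\<^sub>E UNIV) ({..<n} \<rightarrow>\<^sub>E UNIV) ({..<n} \<rightarrow>\<^sub>E range f \<union> range g) M1 M2 (block_map n f) (block_map n g)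
       (block_pmf n (\<lambda>_. pw0)) (\<lambda>z. block_pmf n (\<lambda>i. pw1 (z i))) (\<lambda>z. block_pmf n (\<lambda>i. pw2 (z i)))
       (\<lambda>s u z. block_pmf n (\<lambda>i. px1 (s i) (u i) (z i))) (\<lambda>t u z. block_pmf n (\<lambda>i. px2 (t i) (u i) (z i)))"

definition block_channel where
  "block_channel n N = (\<lambda>v1 v2. block_pmf n (\<lambda>i. N (v1 i) (v2 i)))"

definition accept where
  "accept n L s z u1 u2 v y \<longleftrightarrow>
     (\<forall>(G, \<theta>)\<in>set L. 2 powr (real n * \<theta>) \<le> (\<Prod>i<n. G (s i, z i, u1 i, u2 i, v i, y i) :: real))"

locale letters =
  fixes p :: "('s::finite \<times> 't::finite) pmf" and f :: "'s \<Rightarrow> 'k" and g :: "'t \<Rightarrow> 'k"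
    and pw0 :: "'z pmf" and pw1 :: "'z \<Rightarrow> 'w1 pmf" and pw2 :: "'z \<Rightarrow> 'w2 pmf"
    and px1 :: "'s \<Rightarrow> 'w1 \<Rightarrow> 'z \<Rightarrow> 'x1 pmf" and px2 :: "'t \<Rightarrow> 'w2 \<Rightarrow> 'z \<Rightarrow> 'x2 pmf"
    and N :: "'x1 \<Rightarrow> 'x2 \<Rightarrow> 'y pmf"
  assumes agree: "\<And>s t. (s, t) \<in> set_pmf p \<Longrightarrow> f s = g t"
begin

definition letter_truth :: "('s \<times> 'z \<times> 'w1 \<times> 'w2 \<times> 'x1 \<times> 'y) pmf" where
  "letter_truth = do {
     st \<leftarrow> p; z \<leftarrow> pw0; u1 \<leftarrow> pw1 z; v1 \<leftarrow> px1 (fst st) u1 z; u2 \<leftarrow> pw2 z; v2 \<leftarrow> px2 (snd st) u2 z;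
     y \<leftarrow> N v1 v2; return_pmf (fst st, z, u1, u2, v1, y) }"

text \<open>The leading flag records agreement of the common parts in one letter; the block words
  have equal common parts exactly if all flags are set. Keeping it as part of the outcome keeps the
  letters independent.\<close>

definition letter_confuse :: "bool \<Rightarrow> bool \<Rightarrow> 's \<Rightarrow> (bool \<times> 's \<times> 'z \<times> 'w1 \<times> 'w2 \<times> 'x1 \<times> 'y) pmf" where
  "letter_confuse \<beta>1 \<beta>2 s' = do {
     st \<leftarrow> p; z \<leftarrow> pw0; u1 \<leftarrow> pw1 z; v1 \<leftarrow> px1 (fst st) u1 z;
     u1' \<leftarrow> (if \<beta>1 then return_pmf u1 else pw1 z); v1' \<leftarrow> px1 s' u1' z;
     u2 \<leftarrow> pw2 z; v2 \<leftarrow> px2 (snd st) u2 z;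
     u2' \<leftarrow> (if \<beta>2 then return_pmf u2 else pw2 z);
     y \<leftarrow> N v1 v2;
     return_pmf (f s' = f (fst st), s', z, u1', u2', v1', y) }"

definition letter_fresh :: "'s \<Rightarrow> ('s \<times> 'z \<times> 'w1 \<times> 'w2 \<times> 'x1 \<times> 'y) pmf" where
  "letter_fresh s' = do {
     st \<leftarrow> p; z \<leftarrow> pw0; z' \<leftarrow> pw0; u1 \<leftarrow> pw1 z; v1 \<leftarrow> px1 (fst st) u1 z;
     u1' \<leftarrow> pw1 z'; v1' \<leftarrow> px1 s' u1' z';
     u2 \<leftarrow> pw2 z; v2 \<leftarrow> px2 (snd st) u2 z; u2' \<leftarrow> pw2 z';
     y \<leftarrow> N v1 v2;
     return_pmf (s', z', u1', u2', v1', y) }"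

lemma block_coding_scheme:
  assumes "0 < M1" "0 < M2"
  shows "coding_scheme (block_source n p) (block_map n f) (block_map n g)
    ({..<n} \<rightarrow>\<^sub>E UNIV) ({..<n} \<rightarrow>\<^sub>E UNIV) ({..<n} \<rightarrow>\<^sub>E range f \<union> range g) M1 M2"
proof
  show "finite ({..<n} \<rightarrow>\<^sub>E (UNIV :: 's set))" "finite ({..<n} \<rightarrow>\<^sub>E (UNIV :: 't set))" "finite ({..<n} \<rightarrow>\<^sub>E range f \<union> range g)"
    by (auto intro!: finite_PiE)
  fix s t assume "(s, t) \<in> set_pmf (block_source n p)"
  then obtain st where st: "st \<in> PiE_dflt {..<n} (undefined, undefined) (\<lambda>_. set_pmf p)" "s = fst \<circ> st" "t = snd \<circ> st"
    by (auto simp: block_source_def set_Pi_pmf)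
  have "f (s i) = g (t i)" if "i < n" for i
    using agree[of "s i" "t i"] that st by (auto simp: PiE_dflt_def)
  moreover have "st i = (undefined, undefined)" if "\<not> i < n" for i
    using that st by (auto simp: PiE_dflt_def)
  ultimately show "s \<in> {..<n} \<rightarrow>\<^sub>E UNIV \<and> t \<in> {..<n} \<rightarrow>\<^sub>E UNIV \<and> block_map n f s = block_map n g t"
    using st by (auto simp: PiE_iff extensional_def block_map_eq_iff)
qed (use assms in \<open>auto simp: block_map_def\<close>)

text \<open>Every kernel acts letter by letter, so drawing one block after the other is the same as
  running the whole single-letter experiment independently at each position. The two confusion
  experiments below are treated alike.\<close>

lemma block_truth:
  "do {(s, t) \<leftarrow> block_source n p;
       coding_scheme.truth (block_pmf n (\<lambda>_. pw0)) (\<lambda>z. block_pmf n (\<lambda>i. pw1 (z i))) (\<lambda>z. block_pmf n (\<lambda>i. pw2 (z i)))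
       (\<lambda>s u z. block_pmf n (\<lambda>i. px1 (s i) (u i) (z i))) (\<lambda>t u z. block_pmf n (\<lambda>i. px2 (t i) (u i) (z i)))
       (block_channel n N) (accept n L) s t} =
   do {r \<leftarrow> block_pmf n (\<lambda>_. letter_truth);
       return_pmf (\<not> (\<forall>(G, \<theta>)\<in>set L. 2 powr (real n * \<theta>) \<le> (\<Prod>i<n. G (r i))))}"
  \<comment> \<open>The experiment does not mention the bin counts, so the locale is instantiated
    with both equal to 1.\<close>
  unfolding coding_scheme.truth_def[OF block_coding_scheme[OF zero_less_one zero_less_one]]
    block_source_def block_channel_def letter_truth_def
  \<comment> \<open>Source blocks have a pair of \<open>undefined\<close> values as their default,
    unlike all other blocks, so this default has to be supplied.\<close>
  apply (subst Pi_pmf_bind[where d' = "(undefined, undefined)"], simp)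
  apply (simp only: block_pmf_bind block_pmf_return map_pmf_def bind_assoc_pmf bind_return_pmf prod.case comp_apply)
  apply (intro bind_pmf_cong refl)
  apply (simp add: accept_def cong: prod.cong_simp)
  done

lemma block_confuse:
  "do {(s, t) \<leftarrow> block_source n p;
       coding_scheme.confuse (block_map n f) (block_pmf n (\<lambda>_. pw0)) (\<lambda>z. block_pmf n (\<lambda>i. pw1 (z i))) (\<lambda>z. block_pmf n (\<lambda>i. pw2 (z i)))
       (\<lambda>s u z. block_pmf n (\<lambda>i. px1 (s i) (u i) (z i))) (\<lambda>t u z. block_pmf n (\<lambda>i. px2 (t i) (u i) (z i)))
       (block_channel n N) (accept n L) \<beta>1 \<beta>2 s' s t} =
   do {r \<leftarrow> block_pmf n (\<lambda>i. letter_confuse \<beta>1 \<beta>2 (s' i));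
       return_pmf ((\<forall>i<n. fst (r i)) \<and> (\<forall>(G, \<theta>)\<in>set L. 2 powr (real n * \<theta>) \<le> (\<Prod>i<n. G (snd (r i)))))}"
  unfolding coding_scheme.confuse_def[OF block_coding_scheme[OF zero_less_one zero_less_one]]
    block_source_def block_channel_def letter_confuse_def
  apply (subst Pi_pmf_bind[where d' = "(undefined, undefined)"], simp)
  \<comment> \<open>With the flags fixed, each redrawn or copied satellite is a plain kernel to
    which the distribution over letters applies.\<close>
  apply (cases \<beta>1; cases \<beta>2; simp only: if_True if_False block_pmf_bind block_pmf_return map_pmf_def bind_assoc_pmf bind_return_pmf prod.case comp_apply)
  apply (intro bind_pmf_cong refl; simp add: accept_def block_map_eq_iff cong: prod.cong_simp)+
  done

lemma block_confuse_fresh: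
  "do {(s, t) \<leftarrow> block_source n p;
       coding_scheme.confuse_fresh (block_pmf n (\<lambda>_. pw0)) (\<lambda>z. block_pmf n (\<lambda>i. pw1 (z i))) (\<lambda>z. block_pmf n (\<lambda>i. pw2 (z i)))
       (\<lambda>s u z. block_pmf n (\<lambda>i. px1 (s i) (u i) (z i))) (\<lambda>t u z. block_pmf n (\<lambda>i. px2 (t i) (u i) (z i)))
       (block_channel n N) (accept n L) s' s t} =
   do {r \<leftarrow> block_pmf n (\<lambda>i. letter_fresh (s' i));
       return_pmf (\<forall>(G, \<theta>)\<in>set L. 2 powr (real n * \<theta>) \<le> (\<Prod>i<n. G (r i)))}"
  unfolding coding_scheme.confuse_fresh_def[OF block_coding_scheme[OF zero_less_one zero_less_one]]
    block_source_def block_channel_def letter_fresh_def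
  apply (subst Pi_pmf_bind[where d' = "(undefined, undefined)"], simp)
  apply (simp only: block_pmf_bind block_pmf_return map_pmf_def bind_assoc_pmf bind_return_pmf prod.case comp_apply)
  apply (intro bind_pmf_cong refl)
  apply (simp add: accept_def cong: prod.cong_simp)
  done

end

context letters begin

text \<open>A wrong candidate has to pass every test, so for each kind of confusion it suffices to
  exploit the one test made for it.\<close>

lemma block_average_error_le:
  assumes M: "0 < M1" "0 < M2"
    and nonneg: "\<And>G \<theta> r. (G, \<theta>) \<in> set L \<Longrightarrow> 0 \<le> G r"
    and confuse: "\<And>\<beta>1 \<beta>2. \<exists>G. (G, \<theta> \<beta>1 \<beta>2) \<in> set L \<and>
       (\<Sum>s\<in>UNIV. \<integral>\<^sup>+r. of_bool (fst r) * ennreal (G (snd r)) \<partial>measure_pmf (letter_confuse \<beta>1 \<beta>2 s)) \<le> 1"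
    and fresh: "(Ge, \<theta>e) \<in> set L"
       "(\<Sum>s\<in>UNIV. \<integral>\<^sup>+r. ennreal (Ge r) \<partial>measure_pmf (letter_fresh s)) \<le> 1"
  shows "(\<integral>\<^sup>+C. error_prob (block_source n p) (block_channel n N) (accept n L) (block_map n f) ({..<n} \<rightarrow>\<^sub>E UNIV) M2 C
      \<partial>measure_pmf (block_codebook n M1 M2 f g pw0 pw1 pw2 px1 px2)) \<le>
    (\<integral>\<^sup>+r. of_bool (\<not> (\<forall>(G, \<theta>)\<in>set L. 2 powr (real n * \<theta>) \<le> (\<Prod>i<n. G (r i)))) \<partial>measure_pmf (block_pmf n (\<lambda>_. letter_truth))) + (
    ennreal (1 / real M1) * ennreal (1 / 2 powr (real n * \<theta> True True)) +
    ennreal (1 / real M1) * (of_nat M2 * ennreal (1 / 2 powr (real n * \<theta> True False))) +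
    ennreal (1 / 2 powr (real n * \<theta> False True)) +
    of_nat M2 * ennreal (1 / 2 powr (real n * \<theta> False False)) +
    of_nat M2 * ennreal (1 / 2 powr (real n * \<theta>e)))"
proof -
  let ?prob_true = "\<lambda>\<beta>1 \<beta>2 s'. prob_true (do {(s, t) \<leftarrow> block_source n p;
       coding_scheme.confuse (block_map n f) (block_pmf n (\<lambda>_. pw0)) (\<lambda>z. block_pmf n (\<lambda>i. pw1 (z i))) (\<lambda>z. block_pmf n (\<lambda>i. pw2 (z i)))
       (\<lambda>s u z. block_pmf n (\<lambda>i. px1 (s i) (u i) (z i))) (\<lambda>t u z. block_pmf n (\<lambda>i. px2 (t i) (u i) (z i)))
       (block_channel n N) (accept n L) \<beta>1 \<beta>2 s' s t})"
  let ?prf = "\<lambda>s'. prob_true (do {(s, t) \<leftarrow> block_source n p;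
       coding_scheme.confuse_fresh (block_pmf n (\<lambda>_. pw0)) (\<lambda>z. block_pmf n (\<lambda>i. pw1 (z i))) (\<lambda>z. block_pmf n (\<lambda>i. pw2 (z i)))
       (\<lambda>s u z. block_pmf n (\<lambda>i. px1 (s i) (u i) (z i))) (\<lambda>t u z. block_pmf n (\<lambda>i. px2 (t i) (u i) (z i)))
       (block_channel n N) (accept n L) s' s t})"
  have 1: "(\<Sum>s'\<in>{..<n} \<rightarrow>\<^sub>E UNIV. ?prob_true \<beta>1 \<beta>2 s') \<le> ennreal (1 / 2 powr (real n * \<theta> \<beta>1 \<beta>2))" for \<beta>1 \<beta>2
  proof -
    obtain G where G: "(G, \<theta> \<beta>1 \<beta>2) \<in> set L"
      "(\<Sum>s\<in>UNIV. \<integral>\<^sup>+r. of_bool (fst r) * ennreal (G (snd r)) \<partial>measure_pmf (letter_confuse \<beta>1 \<beta>2 s)) \<le> 1"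
      using confuse by blast
    have "(\<Sum>s'\<in>{..<n} \<rightarrow>\<^sub>E UNIV. ?prob_true \<beta>1 \<beta>2 s') \<le> (\<Sum>s'\<in>{..<n} \<rightarrow>\<^sub>E UNIV. \<integral>\<^sup>+r.
        of_bool (ennreal (2 powr (real n * \<theta> \<beta>1 \<beta>2)) \<le> (\<Prod>i<n. of_bool (fst (r i)) * ennreal (G (snd (r i)))))
        \<partial>measure_pmf (block_pmf n (\<lambda>i. letter_confuse \<beta>1 \<beta>2 (s' i))))"
      unfolding block_confuse prob_true_bind prob_true_return
    proof (intro sum_mono nn_integral_mono)
      fix r :: "nat \<Rightarrow> bool \<times> 's \<times> 'z \<times> 'w1 \<times> 'w2 \<times> 'x1 \<times> 'y"
      show "of_bool ((\<forall>i<n. fst (r i)) \<and> (\<forall>(G, \<theta>)\<in>set L. 2 powr (real n * \<theta>) \<le> (\<Prod>i<n. G (snd (r i))))) \<le>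
        (of_bool (ennreal (2 powr (real n * \<theta> \<beta>1 \<beta>2)) \<le> (\<Prod>i<n. of_bool (fst (r i)) * ennreal (G (snd (r i))))) :: ennreal)"
      proof (cases "(\<forall>i<n. fst (r i)) \<and> (\<forall>(G, \<theta>)\<in>set L. 2 powr (real n * \<theta>) \<le> (\<Prod>i<n. G (snd (r i))))")
        case True
        then have "(\<Prod>i<n. of_bool (fst (r i)) * ennreal (G (snd (r i)))) = ennreal (\<Prod>i<n. G (snd (r i)))"
          using nonneg[OF G(1)] by (subst prod_ennreal[symmetric]) (auto intro!: prod.cong)
        moreover have "2 powr (real n * \<theta> \<beta>1 \<beta>2) \<le> (\<Prod>i<n. G (snd (r i)))"
          using True G(1) by auto
        ultimately show ?thesis by (simp add: ennreal_leI)
      qed auto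
    qed
    also have "\<dots> \<le> ennreal (1 / 2 powr (real n * \<theta> \<beta>1 \<beta>2))"
      by (rule sum_nn_integral_of_bool_prod_ge_le[OF _ G(2)]) simp
    finally show ?thesis .
  qed
  have 2: "(\<Sum>s'\<in>{..<n} \<rightarrow>\<^sub>E UNIV. ?prf s') \<le> ennreal (1 / 2 powr (real n * \<theta>e))"
  proof -
    have "(\<Sum>s'\<in>{..<n} \<rightarrow>\<^sub>E UNIV. ?prf s') \<le> (\<Sum>s'\<in>{..<n} \<rightarrow>\<^sub>E UNIV. \<integral>\<^sup>+r.
        of_bool (ennreal (2 powr (real n * \<theta>e)) \<le> (\<Prod>i<n. ennreal (Ge (r i))))
        \<partial>measure_pmf (block_pmf n (\<lambda>i. letter_fresh (s' i))))"
      unfolding block_confuse_fresh prob_true_bind prob_true_return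
    proof (intro sum_mono nn_integral_mono)
      fix r :: "nat \<Rightarrow> 's \<times> 'z \<times> 'w1 \<times> 'w2 \<times> 'x1 \<times> 'y"
      have "(\<Prod>i<n. ennreal (Ge (r i))) = ennreal (\<Prod>i<n. Ge (r i))"
        using nonneg[OF fresh(1)] by (subst prod_ennreal[symmetric]) auto
      then show "of_bool (\<forall>(G, \<theta>)\<in>set L. 2 powr (real n * \<theta>) \<le> (\<Prod>i<n. G (r i))) \<le>
        (of_bool (ennreal (2 powr (real n * \<theta>e)) \<le> (\<Prod>i<n. ennreal (Ge (r i)))) :: ennreal)"
        using fresh(1) by (auto intro!: ennreal_leI)
    qed
    also have "\<dots> \<le> ennreal (1 / 2 powr (real n * \<theta>e))"
      by (rule sum_nn_integral_of_bool_prod_ge_le[where G = "\<lambda>_ r. ennreal (Ge r)", OF _ fresh(2)]) simp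
    finally show ?thesis .
  qed
  show ?thesis
    unfolding block_codebook_def
    by (rule order_trans[OF coding_scheme.average_error_le[OF block_coding_scheme[OF M]]])
      (unfold block_truth, intro add_mono mult_left_mono 1 2, auto simp: prob_true_bind prob_true_return)
qed

text \<open>Union bound over the finitely many tests: by the Chernoff bound the truth fails each of
  them with exponentially small probability, because every threshold lies below the expected log
  score.\<close>

lemma rejection_prob_vanishes:
  fixes L :: "(_ \<times> real) list"
  assumes fin: "finite (set_pmf letter_truth)"
    and pos: "\<And>G \<theta> r. (G, \<theta>) \<in> set L \<Longrightarrow> r \<in> set_pmf letter_truth \<Longrightarrow> 0 < G r"
    and E: "\<And>G \<theta>. (G, \<theta>) \<in> set L \<Longrightarrow> \<theta> < measure_pmf.expectation letter_truth (\<lambda>r. log 2 (G r))"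
  shows "\<exists>\<delta>. \<delta> \<longlonglongrightarrow> (0::real) \<and> (\<forall>n. 0 \<le> \<delta> n) \<and> (\<forall>n. (\<integral>\<^sup>+r. of_bool (\<not> (\<forall>(G, \<theta>)\<in>set L. 2 powr (real n * \<theta>) \<le> (\<Prod>i<n. G (r i))))
    \<partial>measure_pmf (block_pmf n (\<lambda>_. letter_truth))) \<le> ennreal (\<delta> n))"
  using pos E
proof (induction L)
  case Nil
  then show ?case by (intro exI[of _ "\<lambda>_. 0"]) auto
next
  case (Cons a L)
  obtain G \<theta> where a: "a = (G, \<theta>)" by (cases a)
  obtain \<delta> where \<delta>: "\<delta> \<longlonglongrightarrow> (0::real)" "\<And>n. 0 \<le> \<delta> n"
    "\<And>n. (\<integral>\<^sup>+r. of_bool (\<not> (\<forall>(G, \<theta>)\<in>set L. 2 powr (real n * \<theta>) \<le> (\<Prod>i<n. G (r i))))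
    \<partial>measure_pmf (block_pmf n (\<lambda>_. letter_truth))) \<le> ennreal (\<delta> n)"
    using Cons.IH Cons.prems by fastforce
  obtain \<rho> where \<rho>: "\<rho> < 1" "0 \<le> \<rho>" "\<And>n. (\<integral>\<^sup>+x. of_bool (\<not> 2 powr (real n * \<theta>) \<le> (\<Prod>i<n. G (x i)))
    \<partial>measure_pmf (block_pmf n (\<lambda>_. letter_truth))) \<le> ennreal (\<rho> ^ n)"
    using chernoff_block[OF fin Cons.prems(1)[of G \<theta>] Cons.prems(2)[of G \<theta>]] by (auto simp only: a list.set_intros)
  have "(\<integral>\<^sup>+r. of_bool (\<not> (\<forall>(G, \<theta>)\<in>set (a # L). 2 powr (real n * \<theta>) \<le> (\<Prod>i<n. G (r i))))
    \<partial>measure_pmf (block_pmf n (\<lambda>_. letter_truth))) \<le> ennreal (\<rho> ^ n + \<delta> n)" for n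
  proof -
    have "(\<integral>\<^sup>+r. of_bool (\<not> (\<forall>(G, \<theta>)\<in>set (a # L). 2 powr (real n * \<theta>) \<le> (\<Prod>i<n. G (r i))))
      \<partial>measure_pmf (block_pmf n (\<lambda>_. letter_truth))) \<le>
      (\<integral>\<^sup>+r. of_bool (\<not> 2 powr (real n * \<theta>) \<le> (\<Prod>i<n. G (r i))) +
        of_bool (\<not> (\<forall>(G, \<theta>)\<in>set L. 2 powr (real n * \<theta>) \<le> (\<Prod>i<n. G (r i))))
      \<partial>measure_pmf (block_pmf n (\<lambda>_. letter_truth)))"
      by (intro nn_integral_mono) (auto simp: a)
    also have "\<dots> = (\<integral>\<^sup>+r. of_bool (\<not> 2 powr (real n * \<theta>) \<le> (\<Prod>i<n. G (r i))) \<partial>measure_pmf (block_pmf n (\<lambda>_. letter_truth))) +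
      (\<integral>\<^sup>+r. of_bool (\<not> (\<forall>(G, \<theta>)\<in>set L. 2 powr (real n * \<theta>) \<le> (\<Prod>i<n. G (r i)))) \<partial>measure_pmf (block_pmf n (\<lambda>_. letter_truth)))"
      by (rule nn_integral_add) auto
    also have "\<dots> \<le> ennreal (\<rho> ^ n) + ennreal (\<delta> n)"
      by (intro add_mono \<rho>(3) \<delta>(3))
    finally show ?thesis using \<rho> \<delta> by (simp add: ennreal_plus)
  qed
  moreover have "(\<lambda>n. \<rho> ^ n + \<delta> n) \<longlonglongrightarrow> 0"
    using tendsto_add[OF LIMSEQ_realpow_zero[OF \<rho>(2,1)] \<delta>(1)] by simp
  ultimately show ?case
    using \<rho>(2) \<delta>(2) by (intro exI[of _ "\<lambda>n. \<rho> ^ n + \<delta> n"]) auto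
qed

end

section \<open>Bin counts of a given rate and choice of thresholds\<close>

definition code_size :: "real \<Rightarrow> nat \<Rightarrow> nat" where
  "code_size R n = nat \<lceil>2 powr (real n * R)\<rceil>"

lemma code_size_bounds:
  assumes "0 \<le> R"
  shows "2 powr (real n * R) \<le> real (code_size R n)" "real (code_size R n) \<le> 2 * 2 powr (real n * R)" "0 < code_size R n"
proof -
  have "1 \<le> (2::real) powr (real n * R)" using assms by (intro ge_one_powr_ge_zero) auto
  then show "2 powr (real n * R) \<le> real (code_size R n)" "real (code_size R n) \<le> 2 * 2 powr (real n * R)" "0 < code_size R n"
    unfolding code_size_def by linarith+
qed

lemma exp_rate_tendsto_0: "0 < \<kappa> \<Longrightarrow> (\<lambda>n. 2 powr (- (real n * \<kappa>))) \<longlonglongrightarrow> (0::real)"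
  using LIMSEQ_realpow_zero[of "2 powr - \<kappa>"] by (simp add: powr_realpow[symmetric] powr_powr mult.commute powr_less_one)

context letters begin

theorem average_error_vanishes:
  assumes fin: "finite (set_pmf letter_truth)"
    and nonneg: "\<And>\<beta>1 \<beta>2 r. 0 \<le> G \<beta>1 \<beta>2 r" "\<And>r. 0 \<le> Ge r"
    and pos: "\<And>\<beta>1 \<beta>2 r. r \<in> set_pmf letter_truth \<Longrightarrow> 0 < G \<beta>1 \<beta>2 r" "\<And>r. r \<in> set_pmf letter_truth \<Longrightarrow> 0 < Ge r"
    and packing: "\<And>\<beta>1 \<beta>2. (\<Sum>s\<in>UNIV. \<integral>\<^sup>+r. of_bool (fst r) * ennreal (G \<beta>1 \<beta>2 (snd r)) \<partial>measure_pmf (letter_confuse \<beta>1 \<beta>2 s)) \<le> 1"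
       "(\<Sum>s\<in>UNIV. \<integral>\<^sup>+r. ennreal (Ge r) \<partial>measure_pmf (letter_fresh s)) \<le> 1"
    and R: "0 < R1" "0 < R2"
    and rates: "- R1 < measure_pmf.expectation letter_truth (\<lambda>r. log 2 (G True True r))"
      "R2 - R1 < measure_pmf.expectation letter_truth (\<lambda>r. log 2 (G True False r))"
      "0 < measure_pmf.expectation letter_truth (\<lambda>r. log 2 (G False True r))"
      "R2 < measure_pmf.expectation letter_truth (\<lambda>r. log 2 (G False False r))"
      "R2 < measure_pmf.expectation letter_truth (\<lambda>r. log 2 (Ge r))"
  shows "\<exists>\<delta>. \<delta> \<longlonglongrightarrow> (0::real) \<and> (\<forall>n. \<exists>A. (\<integral>\<^sup>+C. error_prob (block_source n p) (block_channel n N) A (block_map n f)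
      ({..<n} \<rightarrow>\<^sub>E UNIV) (code_size R2 n) C
      \<partial>measure_pmf (block_codebook n (code_size R1 n) (code_size R2 n) f g pw0 pw1 pw2 px1 px2)) \<le> ennreal (\<delta> n))"
proof -
  define E where "E \<beta>1 \<beta>2 = measure_pmf.expectation letter_truth (\<lambda>r. log 2 (G \<beta>1 \<beta>2 r))" for \<beta>1 \<beta>2
  define Ee where "Ee = measure_pmf.expectation letter_truth (\<lambda>r. log 2 (Ge r))"
  \<comment> \<open>\<open>C\<close> is the exponent of the weight in front of each confusion term:
    a wrong guess contributes the factor \<open>M2\<close>, a bin collision the factor
    \<open>1 / M1\<close>. A threshold midway between \<open>C\<close> and the expected log score
    lies low enough for the truth to pass and high enough to leave the competitors a negative
    exponent.\<close>
  define C where "C \<beta>1 \<beta>2 = (if \<beta>2 then 0 else R2) - (if \<beta>1 then R1 else 0)" for \<beta>1 \<beta>2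
  define \<theta> where "\<theta> \<beta>1 \<beta>2 = (E \<beta>1 \<beta>2 + C \<beta>1 \<beta>2) / 2" for \<beta>1 \<beta>2
  define \<theta>e where "\<theta>e = (Ee + R2) / 2"
  have CE: "C \<beta>1 \<beta>2 < E \<beta>1 \<beta>2" for \<beta>1 \<beta>2
    using rates by (cases \<beta>1; cases \<beta>2) (auto simp: C_def E_def)
  have Ee: "R2 < Ee" using rates by (simp add: Ee_def)
  define L where "L = [(G True True, \<theta> True True), (G True False, \<theta> True False),
     (G False True, \<theta> False True), (G False False, \<theta> False False), (Ge, \<theta>e)]"
  have L: "(G \<beta>1 \<beta>2, \<theta> \<beta>1 \<beta>2) \<in> set L" for \<beta>1 \<beta>2
    by (cases \<beta>1; cases \<beta>2) (auto simp: L_def)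
  have "\<theta> \<beta>1 \<beta>2 < measure_pmf.expectation letter_truth (\<lambda>r. log 2 (G \<beta>1 \<beta>2 r))" for \<beta>1 \<beta>2
    using CE[of \<beta>1 \<beta>2] by (simp add: \<theta>_def E_def)
  moreover have "\<theta>e < measure_pmf.expectation letter_truth (\<lambda>r. log 2 (Ge r))"
    using Ee by (simp add: \<theta>e_def Ee_def)
  ultimately have EL: "\<theta>' < measure_pmf.expectation letter_truth (\<lambda>r. log 2 (G' r))" if "(G', \<theta>') \<in> set L" for G' \<theta>'
    using that by (auto simp: L_def)
  have posL: "0 < G' r" if "(G', \<theta>') \<in> set L" "r \<in> set_pmf letter_truth" for G' \<theta>' r
    using that(1) pos[OF that(2)] by (auto simp: L_def)
  obtain \<delta> where \<delta>: "\<delta> \<longlonglongrightarrow> (0::real)" "\<And>n. 0 \<le> \<delta> n"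
    "\<And>n. (\<integral>\<^sup>+r. of_bool (\<not> (\<forall>(G, \<theta>)\<in>set L. 2 powr (real n * \<theta>) \<le> (\<Prod>i<n. G (r i))))
    \<partial>measure_pmf (block_pmf n (\<lambda>_. letter_truth))) \<le> ennreal (\<delta> n)"
    using rejection_prob_vanishes[of L] fin posL EL by blast
  define \<kappa> where "\<kappa> \<beta>1 \<beta>2 = \<theta> \<beta>1 \<beta>2 - C \<beta>1 \<beta>2" for \<beta>1 \<beta>2
  have \<kappa>: "0 < \<kappa> \<beta>1 \<beta>2" for \<beta>1 \<beta>2 using CE[of \<beta>1 \<beta>2] by (simp add: \<kappa>_def \<theta>_def field_simps)
  define \<kappa>e where "\<kappa>e = \<theta>e - R2"
  have \<kappa>e: "0 < \<kappa>e" using Ee by (simp add: \<kappa>e_def \<theta>e_def)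
  \<comment> \<open>The factor 2 absorbs the rounding of \<open>code_size\<close>.\<close>
  define \<epsilon> where "\<epsilon> k n = 2 * 2 powr (- (real n * k))" for k :: real and n :: nat
  have \<epsilon>0: "\<epsilon> k \<longlonglongrightarrow> 0" if "0 < k" for k
    unfolding \<epsilon>_def using tendsto_mult_right_zero[OF exp_rate_tendsto_0[OF that], of 2] by simp
  define \<delta>' where "\<delta>' n = \<delta> n + (\<epsilon> (\<kappa> True True) n + \<epsilon> (\<kappa> True False) n + \<epsilon> (\<kappa> False True) n + \<epsilon> (\<kappa> False False) n + \<epsilon> \<kappa>e n)" for n
  have "\<delta>' \<longlonglongrightarrow> 0 + (0 + 0 + 0 + 0 + 0)"
    unfolding \<delta>'_def by (intro tendsto_add \<delta> \<epsilon>0 \<kappa> \<kappa>e)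
  moreover have "(\<integral>\<^sup>+C. error_prob (block_source n p) (block_channel n N) (accept n L) (block_map n f)
      ({..<n} \<rightarrow>\<^sub>E UNIV) (code_size R2 n) C
      \<partial>measure_pmf (block_codebook n (code_size R1 n) (code_size R2 n) f g pw0 pw1 pw2 px1 px2)) \<le> ennreal (\<delta>' n)" for n
  proof -
    note b1 = code_size_bounds[OF less_imp_le[OF R(1)], of n] and b2 = code_size_bounds[OF less_imp_le[OF R(2)], of n]
    have inv: "1 / real (code_size R1 n) \<le> 2 powr (- (real n * R1))"
      using b1 by (simp add: powr_minus field_simps)
    have "1 / real (code_size R1 n) * (1 / 2 powr (real n * \<theta> True True)) \<le> 2 powr (- (real n * R1)) * (1 / 2 powr (real n * \<theta> True True))"
      using inv by (intro mult_right_mono) auto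
    also have "\<dots> = 2 powr (- (real n * \<kappa> True True))"
      by (simp add: \<kappa>_def C_def powr_minus_divide[symmetric] powr_add[symmetric] algebra_simps)
    also have "\<dots> \<le> \<epsilon> (\<kappa> True True) n" by (simp add: \<epsilon>_def)
    finally have 1: "1 / real (code_size R1 n) * (1 / 2 powr (real n * \<theta> True True)) \<le> \<epsilon> (\<kappa> True True) n" .
    have "1 / real (code_size R1 n) * (real (code_size R2 n) * (1 / 2 powr (real n * \<theta> True False))) \<le>
       2 powr (- (real n * R1)) * ((2 * 2 powr (real n * R2)) * (1 / 2 powr (real n * \<theta> True False)))"
      using inv b2 by (intro mult_mono mult_right_mono) auto
    also have "\<dots> = \<epsilon> (\<kappa> True False) n"
      by (simp add: \<epsilon>_def \<kappa>_def C_def powr_minus_divide[symmetric] powr_add[symmetric] algebra_simps)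
    finally have 2: "1 / real (code_size R1 n) * (real (code_size R2 n) * (1 / 2 powr (real n * \<theta> True False))) \<le> \<epsilon> (\<kappa> True False) n" .
    have 3: "1 / 2 powr (real n * \<theta> False True) \<le> \<epsilon> (\<kappa> False True) n"
      by (simp add: \<epsilon>_def \<kappa>_def C_def powr_minus_divide divide_right_mono)
    have 4: "real (code_size R2 n) * (1 / 2 powr (real n * \<theta> False False)) \<le> \<epsilon> (\<kappa> False False) n"
    proof -
      have "real (code_size R2 n) * (1 / 2 powr (real n * \<theta> False False)) \<le> (2 * 2 powr (real n * R2)) * (1 / 2 powr (real n * \<theta> False False))"
        using b2 by (intro mult_right_mono) auto
      also have "\<dots> = \<epsilon> (\<kappa> False False) n"
        by (simp add: \<epsilon>_def \<kappa>_def C_def powr_minus_divide[symmetric] powr_add[symmetric] algebra_simps)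
      finally show ?thesis .
    qed
    have 5: "real (code_size R2 n) * (1 / 2 powr (real n * \<theta>e)) \<le> \<epsilon> \<kappa>e n"
    proof -
      have "real (code_size R2 n) * (1 / 2 powr (real n * \<theta>e)) \<le> (2 * 2 powr (real n * R2)) * (1 / 2 powr (real n * \<theta>e))"
        using b2 by (intro mult_right_mono) auto
      also have "\<dots> = \<epsilon> \<kappa>e n"
        by (simp add: \<epsilon>_def \<kappa>e_def powr_minus_divide[symmetric] powr_add[symmetric] algebra_simps)
      finally show ?thesis .
    qed
    have "(\<integral>\<^sup>+C. error_prob (block_source n p) (block_channel n N) (accept n L) (block_map n f)
      ({..<n} \<rightarrow>\<^sub>E UNIV) (code_size R2 n) C
      \<partial>measure_pmf (block_codebook n (code_size R1 n) (code_size R2 n) f g pw0 pw1 pw2 px1 px2)) \<le>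
      (\<integral>\<^sup>+r. of_bool (\<not> (\<forall>(G, \<theta>)\<in>set L. 2 powr (real n * \<theta>) \<le> (\<Prod>i<n. G (r i)))) \<partial>measure_pmf (block_pmf n (\<lambda>_. letter_truth))) + (
      ennreal (1 / real (code_size R1 n)) * ennreal (1 / 2 powr (real n * \<theta> True True)) +
      ennreal (1 / real (code_size R1 n)) * (of_nat (code_size R2 n) * ennreal (1 / 2 powr (real n * \<theta> True False))) +
      ennreal (1 / 2 powr (real n * \<theta> False True)) +
      of_nat (code_size R2 n) * ennreal (1 / 2 powr (real n * \<theta> False False)) +
      of_nat (code_size R2 n) * ennreal (1 / 2 powr (real n * \<theta>e)))"
    proof (rule block_average_error_le[OF b1(3) b2(3)])
      show "\<exists>G'. (G', \<theta> \<beta>1 \<beta>2) \<in> set L \<and>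
       (\<Sum>s\<in>UNIV. \<integral>\<^sup>+r. of_bool (fst r) * ennreal (G' (snd r)) \<partial>measure_pmf (letter_confuse \<beta>1 \<beta>2 s)) \<le> 1" for \<beta>1 \<beta>2
        using L packing(1) by blast
      show "(Ge, \<theta>e) \<in> set L" by (simp add: L_def)
    qed (use nonneg packing(2) in \<open>auto simp: L_def\<close>)
    also have "\<dots> \<le> ennreal (\<delta> n) + (ennreal (\<epsilon> (\<kappa> True True) n) + ennreal (\<epsilon> (\<kappa> True False) n) +
       ennreal (\<epsilon> (\<kappa> False True) n) + ennreal (\<epsilon> (\<kappa> False False) n) + ennreal (\<epsilon> \<kappa>e n))"
      unfolding ennreal_of_nat_eq_real_of_nat
      by (intro add_mono \<delta>(3)) (use 1 2 3 4 5 in \<open>auto intro!: ennreal_leI simp flip: ennreal_mult\<close>)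
    also have "\<dots> = ennreal (\<delta>' n)"
      by (simp add: \<delta>'_def \<delta>(2) \<epsilon>_def flip: ennreal_plus)
    finally show ?thesis .
  qed
  ultimately show ?thesis
    by (intro exI[of _ \<delta>']) auto
qed

end

section \<open>Information quantities of discrete variables\<close>

abbreviation (input) mass :: "'a pmf \<Rightarrow> ('a \<Rightarrow> bool) \<Rightarrow> real" where
  "mass P E \<equiv> measure_pmf.prob P {\<omega>. E \<omega>}"

text \<open>
  The ratio p(y|x,z)/p(y|z), whose expected logarithm is the conditional mutual information.
\<close>

definition density_ratio :: "'a pmf \<Rightarrow> ('a \<Rightarrow> 'x) \<Rightarrow> ('a \<Rightarrow> 'y) \<Rightarrow> ('a \<Rightarrow> 'z) \<Rightarrow> 'x \<Rightarrow> 'y \<Rightarrow> 'z \<Rightarrow> real" where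
  "density_ratio P X Y Z x y z =
     mass P (\<lambda>\<omega>. X \<omega> = x \<and> Y \<omega> = y \<and> Z \<omega> = z) * mass P (\<lambda>\<omega>. Z \<omega> = z) /
     (mass P (\<lambda>\<omega>. X \<omega> = x \<and> Z \<omega> = z) * mass P (\<lambda>\<omega>. Y \<omega> = y \<and> Z \<omega> = z))"

lemma density_ratio_nonneg: "0 \<le> density_ratio P X Y Z x y z"
  by (simp add: density_ratio_def)

lemma mass_pos:
  assumes "\<omega> \<in> set_pmf P" "E \<omega>"
  shows "0 < mass P E"
proof -
  have "0 < pmf P \<omega>" using assms(1) by (simp add: pmf_positive_iff)
  also have "\<dots> \<le> mass P E"
    unfolding measure_pmf_single[symmetric] using assms(2) by (intro measure_pmf.finite_measure_mono) auto
  finally show ?thesis .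
qed

lemma density_ratio_pos:
  "\<omega> \<in> set_pmf P \<Longrightarrow> 0 < density_ratio P X Y Z (X \<omega>) (Y \<omega>) (Z \<omega>)"
  unfolding density_ratio_def by (intro divide_pos_pos mult_pos_pos mass_pos) auto

lemma pmf_map_eq_mass: "pmf (map_pmf V P) v = mass P (\<lambda>\<omega>. V \<omega> = v)"
  by (simp add: pmf_map vimage_def)

section \<open>Information quantities as expectations over the sample space\<close>

lemma expectation_finite_range:
  fixes h :: "'b \<Rightarrow> real"
  assumes "finite (range V)"
  shows "measure_pmf.expectation P (\<lambda>\<omega>. h (V \<omega>)) = (\<Sum>v\<in>range V. mass P (\<lambda>\<omega>. V \<omega> = v) * h v)"
proof -
  have "measure_pmf.expectation P (\<lambda>\<omega>. h (V \<omega>)) = measure_pmf.expectation (map_pmf V P) h"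
    by simp
  also have "\<dots> = (\<Sum>v\<in>range V. h v * pmf (map_pmf V P) v)"
    using assms by (intro integral_measure_pmf_real) auto
  finally show ?thesis by (simp add: pmf_map_eq_mass mult.commute)
qed

lemma simple_function_pmf: "finite (range V) \<Longrightarrow> simple_function (measure_pmf P) V"
  by (simp add: simple_function_def)

lemma information_space_pmf: "information_space (measure_pmf P) 2"
  by (simp add: information_space_def information_space_axioms_def measure_pmf.prob_space_axioms)

lemma simple_distributed_pmf:
  assumes "finite (range V)"
  shows "simple_distributed (measure_pmf P) V (\<lambda>v. mass P (\<lambda>\<omega>. V \<omega> = v))"
  using measure_pmf.simple_distributedI[OF simple_function_pmf[OF assms, of P], of "\<lambda>v. mass P (\<lambda>\<omega>. V \<omega> = v)"]
  by (simp add: vimage_def)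

lemma finite_range_Pair: "finite (range X) \<Longrightarrow> finite (range Y) \<Longrightarrow> finite (range (X \<diamondop> Y))"
  by (rule finite_subset[of _ "range X \<times> range Y"]) auto

lemma cond_mutual_information_eq:
  assumes "finite (range X)" "finite (range Y)" "finite (range Z)"
  shows "\<I>[P](X ; Y | Z) = measure_pmf.expectation P (\<lambda>\<omega>. log 2 (density_ratio P X Y Z (X \<omega>) (Y \<omega>) (Z \<omega>)))"
proof -
  interpret information_space "measure_pmf P" 2 by (rule information_space_pmf)
  note fr = finite_range_Pair assms
  have "\<I>[P](X ; Y | Z) = (\<Sum>(x, y, z)\<in>range (X \<diamondop> Y \<diamondop> Z). mass P (\<lambda>\<omega>. (X \<omega>, Y \<omega>, Z \<omega>) = (x, y, z)) *
     log 2 (mass P (\<lambda>\<omega>. (X \<omega>, Y \<omega>, Z \<omega>) = (x, y, z)) / (mass P (\<lambda>\<omega>. (X \<omega>, Z \<omega>) = (x, z)) *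
       (mass P (\<lambda>\<omega>. (Y \<omega>, Z \<omega>) = (y, z)) / mass P (\<lambda>\<omega>. Z \<omega> = z)))))"
    unfolding pmf_conditional_mutual_information_def
    using conditional_mutual_information_eq[OF simple_distributed_pmf[OF fr(4)] simple_distributed_pmf[OF fr(1)[OF fr(3,4)]]
      simple_distributed_pmf[OF fr(1)[OF fr(2,4)]] simple_distributed_pmf[OF fr(1)[OF fr(2) fr(1)[OF fr(3,4)]]]]
    by simp
  also have "\<dots> = (\<Sum>v\<in>range (X \<diamondop> Y \<diamondop> Z). mass P (\<lambda>\<omega>. (X \<omega>, Y \<omega>, Z \<omega>) = v) *
     (\<lambda>(x, y, z). log 2 (density_ratio P X Y Z x y z)) v)"
    by (intro sum.cong) (auto simp: density_ratio_def)
  also have "\<dots> = measure_pmf.expectation P (\<lambda>\<omega>. log 2 (density_ratio P X Y Z (X \<omega>) (Y \<omega>) (Z \<omega>)))"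
    using fr(1)[OF fr(2) fr(1)[OF fr(3,4)]] by (subst expectation_finite_range[symmetric]) auto
  finally show ?thesis .
qed

text \<open>Conditioning on the constant \<open>\<lambda>_. ()\<close> makes
  \<open>density_ratio\<close> cover the unconditional case.\<close>

lemma mutual_information_eq:
  assumes "finite (range X)" "finite (range Y)"
  shows "\<I>[P](X ; Y) = measure_pmf.expectation P (\<lambda>\<omega>. log 2 (density_ratio P X Y (\<lambda>_. ()) (X \<omega>) (Y \<omega>) ()))"
proof -
  interpret information_space "measure_pmf P" 2 by (rule information_space_pmf)
  note fr = finite_range_Pair assms
  have "\<I>[P](X ; Y) = (\<Sum>(x, y)\<in>range (X \<diamondop> Y). mass P (\<lambda>\<omega>. (X \<omega>, Y \<omega>) = (x, y)) *
     log 2 (mass P (\<lambda>\<omega>. (X \<omega>, Y \<omega>) = (x, y)) / (mass P (\<lambda>\<omega>. X \<omega> = x) * mass P (\<lambda>\<omega>. Y \<omega> = y))))"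
    unfolding pmf_mutual_information_def
    using mutual_information_simple_distributed[OF simple_distributed_pmf[OF fr(2)] simple_distributed_pmf[OF fr(3)] simple_distributed_pmf[OF fr(1)[OF fr(2,3)]]]
    by simp
  also have "\<dots> = (\<Sum>v\<in>range (X \<diamondop> Y). mass P (\<lambda>\<omega>. (X \<omega>, Y \<omega>) = v) *
     (\<lambda>(x, y). log 2 (density_ratio P X Y (\<lambda>_. ()) x y ())) v)"
    by (intro sum.cong) (auto simp: density_ratio_def)
  also have "\<dots> = measure_pmf.expectation P (\<lambda>\<omega>. log 2 (density_ratio P X Y (\<lambda>_. ()) (X \<omega>) (Y \<omega>) ()))"
    using fr by (subst expectation_finite_range[symmetric]) auto
  finally show ?thesis .
qed

lemma cond_entropy_eq:
  assumes "finite (range X)" "finite (range Y)"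
  shows "\<H>[P](X | Y) = - measure_pmf.expectation P (\<lambda>\<omega>. log 2 (mass P (\<lambda>\<eta>. X \<eta> = X \<omega> \<and> Y \<eta> = Y \<omega>) / mass P (\<lambda>\<eta>. Y \<eta> = Y \<omega>)))"
proof -
  interpret information_space "measure_pmf P" 2 by (rule information_space_pmf)
  note fr = finite_range_Pair assms
  have "\<H>[P](X | Y) = - (\<Sum>(x, y)\<in>range (X \<diamondop> Y). mass P (\<lambda>\<omega>. (X \<omega>, Y \<omega>) = (x, y)) *
     log 2 (mass P (\<lambda>\<omega>. (X \<omega>, Y \<omega>) = (x, y)) / mass P (\<lambda>\<omega>. Y \<omega> = y)))"
    unfolding pmf_conditional_entropy_def
    using conditional_entropy_eq[OF simple_distributed_pmf[OF fr(3)] simple_distributed_pmf[OF fr(1)[OF fr(2,3)]]]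
    by simp
  also have "\<dots> = - (\<Sum>v\<in>range (X \<diamondop> Y). mass P (\<lambda>\<omega>. (X \<omega>, Y \<omega>) = v) *
     (\<lambda>(x, y). log 2 (mass P (\<lambda>\<eta>. X \<eta> = x \<and> Y \<eta> = y) / mass P (\<lambda>\<eta>. Y \<eta> = y))) v)"
    by (intro arg_cong[of _ _ uminus] sum.cong) auto
  also have "\<dots> = - measure_pmf.expectation P (\<lambda>\<omega>. log 2 (mass P (\<lambda>\<eta>. X \<eta> = X \<omega> \<and> Y \<eta> = Y \<omega>) / mass P (\<lambda>\<eta>. Y \<eta> = Y \<omega>)))"
    using fr by (subst expectation_finite_range[symmetric]) auto
  finally show ?thesis .
qed

lemma entropy_eq:
  assumes "finite (range X)"
  shows "\<H>[P](X) = - measure_pmf.expectation P (\<lambda>\<omega>. log 2 (mass P (\<lambda>\<eta>. X \<eta> = X \<omega>)))"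
proof -
  interpret information_space "measure_pmf P" 2 by (rule information_space_pmf)
  have "\<H>[P](X) = - (\<Sum>x\<in>range X. mass P (\<lambda>\<omega>. X \<omega> = x) * log 2 (mass P (\<lambda>\<omega>. X \<omega> = x)))"
    unfolding pmf_entropy_def
    using entropy_simple_distributed[OF simple_distributed_pmf[OF assms]]
    by simp
  also have "\<dots> = - measure_pmf.expectation P (\<lambda>\<omega>. log 2 (mass P (\<lambda>\<eta>. X \<eta> = X \<omega>)))"
    using assms by (subst expectation_finite_range[where V = X, symmetric]) auto
  finally show ?thesis .
qed

lemma cond_mutual_information_nonneg:
  assumes "finite (range X)" "finite (range Y)" "finite (range Z)"
  shows "0 \<le> \<I>[P](X ; Y | Z)"
proof -
  interpret information_space "measure_pmf P" 2 by (rule information_space_pmf)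
  show ?thesis
    unfolding pmf_conditional_mutual_information_def
    using conditional_mutual_information_nonneg[OF assms[THEN simple_function_pmf]] by simp
qed

lemma integrable_finite_range:
  fixes h :: "'b \<Rightarrow> real"
  assumes "finite (range V)"
  shows "integrable (measure_pmf P) (\<lambda>\<omega>. h (V \<omega>))"
proof -
  have "integrable (measure_pmf (map_pmf V P)) h"
    using assms by (intro integrable_measure_pmf_finite) (auto intro: finite_subset[of "V ` set_pmf P" "range V"])
  then show ?thesis by simp
qed

text \<open>Chain rule: I(AB;Y|Z) = I(A;Y|Z) + I(B;Y|AZ), and the first summand is nonnegative.
  \<open>X\<close> and \<open>Z'\<close> are described only by the partitions they induce, so the
  order of components in a tuple does not matter.\<close>

lemma cond_mutual_information_mono:
  assumes fr: "finite (range A)" "finite (range B)" "finite (range X)" "finite (range Y)" "finite (range Z)" "finite (range Z')"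
    and X: "\<And>\<omega> \<eta>. X \<eta> = X \<omega> \<longleftrightarrow> A \<eta> = A \<omega> \<and> B \<eta> = B \<omega>"
    and Z': "\<And>\<omega> \<eta>. Z' \<eta> = Z' \<omega> \<longleftrightarrow> A \<eta> = A \<omega> \<and> Z \<eta> = Z \<omega>"
  shows "\<I>[P](B ; Y | Z') \<le> \<I>[P](X ; Y | Z)"
proof -
  let ?E = "measure_pmf.expectation P"
  have eq: "log 2 (density_ratio P X Y Z (X \<omega>) (Y \<omega>) (Z \<omega>)) =
     log 2 (density_ratio P A Y Z (A \<omega>) (Y \<omega>) (Z \<omega>)) + log 2 (density_ratio P B Y Z' (B \<omega>) (Y \<omega>) (Z' \<omega>))"
    if \<omega>: "\<omega> \<in> set_pmf P" for \<omega>
  proof -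
    have "density_ratio P X Y Z (X \<omega>) (Y \<omega>) (Z \<omega>) =
      density_ratio P A Y Z (A \<omega>) (Y \<omega>) (Z \<omega>) * density_ratio P B Y Z' (B \<omega>) (Y \<omega>) (Z' \<omega>)"
    proof -
      have e: "(\<lambda>\<eta>. B \<eta> = B \<omega> \<and> Y \<eta> = Y \<omega> \<and> A \<eta> = A \<omega> \<and> Z \<eta> = Z \<omega>) = (\<lambda>\<eta>. (A \<eta> = A \<omega> \<and> B \<eta> = B \<omega>) \<and> Y \<eta> = Y \<omega> \<and> Z \<eta> = Z \<omega>)"
        "(\<lambda>\<eta>. B \<eta> = B \<omega> \<and> A \<eta> = A \<omega> \<and> Z \<eta> = Z \<omega>) = (\<lambda>\<eta>. (A \<eta> = A \<omega> \<and> B \<eta> = B \<omega>) \<and> Z \<eta> = Z \<omega>)"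
        "(\<lambda>\<eta>. Y \<eta> = Y \<omega> \<and> A \<eta> = A \<omega> \<and> Z \<eta> = Z \<omega>) = (\<lambda>\<eta>. A \<eta> = A \<omega> \<and> Y \<eta> = Y \<omega> \<and> Z \<eta> = Z \<omega>)"
        by auto
      have "0 < mass P (\<lambda>\<eta>. A \<eta> = A \<omega> \<and> Z \<eta> = Z \<omega>)" "0 < mass P (\<lambda>\<eta>. A \<eta> = A \<omega> \<and> Y \<eta> = Y \<omega> \<and> Z \<eta> = Z \<omega>)"
        using \<omega> by (auto intro: mass_pos)
      then show ?thesis unfolding density_ratio_def X Z' e by (simp add: mult_ac)
    qed
    then show ?thesis
      using density_ratio_pos[OF \<omega>, of A Y Z] density_ratio_pos[OF \<omega>, of B Y Z'] by (simp add: log_mult_pos)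
  qed
  have "\<I>[P](X ; Y | Z) = ?E (\<lambda>\<omega>. log 2 (density_ratio P A Y Z (A \<omega>) (Y \<omega>) (Z \<omega>)) + log 2 (density_ratio P B Y Z' (B \<omega>) (Y \<omega>) (Z' \<omega>)))"
    unfolding cond_mutual_information_eq[OF fr(3-5)] by (intro integral_cong_AE) (auto simp: AE_measure_pmf_iff eq)
  also have "\<dots> = \<I>[P](A ; Y | Z) + \<I>[P](B ; Y | Z')"
    unfolding cond_mutual_information_eq[OF fr(1,4,5)] cond_mutual_information_eq[OF fr(2,4,6)]
    using fr integrable_finite_range[of "A \<diamondop> Y \<diamondop> Z" P "\<lambda>(x, y, z). log 2 (density_ratio P A Y Z x y z)"]
      integrable_finite_range[of "B \<diamondop> Y \<diamondop> Z'" P "\<lambda>(x, y, z). log 2 (density_ratio P B Y Z' x y z)"]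
    by (intro Bochner_Integration.integral_add) (simp_all add: finite_range_Pair)
  finally show ?thesis using cond_mutual_information_nonneg[OF fr(1,4,5)] by simp
qed

lemma mass_cong: "(\<And>\<omega>. \<omega> \<in> set_pmf P \<Longrightarrow> E \<omega> \<longleftrightarrow> E' \<omega>) \<Longrightarrow> mass P E = mass P E'"
  by (intro measure_pmf.finite_measure_eq_AE) (auto simp: AE_measure_pmf_iff)

text \<open>Only the partition of the support induced by a variable enters. This permits reordering
  tuples and replacing \<open>K\<close> by a variable that determines the same partition almost
  surely.\<close>

lemma cond_mutual_information_cong:
  assumes fr: "finite (range X)" "finite (range X')" "finite (range Y)" "finite (range Z)" "finite (range Z')"
    and X: "\<And>\<omega> \<eta>. \<omega> \<in> set_pmf P \<Longrightarrow> \<eta> \<in> set_pmf P \<Longrightarrow> X' \<eta> = X' \<omega> \<longleftrightarrow> X \<eta> = X \<omega>"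
    and Z: "\<And>\<omega> \<eta>. \<omega> \<in> set_pmf P \<Longrightarrow> \<eta> \<in> set_pmf P \<Longrightarrow> Z' \<eta> = Z' \<omega> \<longleftrightarrow> Z \<eta> = Z \<omega>"
  shows "\<I>[P](X' ; Y | Z') = \<I>[P](X ; Y | Z)"
  unfolding cond_mutual_information_eq[OF fr(1,3,4)] cond_mutual_information_eq[OF fr(2,3,5)] density_ratio_def
  using X Z by (intro integral_cong_AE) (auto simp: AE_measure_pmf_iff cong: mass_cong)

lemma cond_entropy_cong:
  assumes fr: "finite (range X)" "finite (range Z)" "finite (range Z')"
    and Z: "\<And>\<omega> \<eta>. \<omega> \<in> set_pmf P \<Longrightarrow> \<eta> \<in> set_pmf P \<Longrightarrow> Z' \<eta> = Z' \<omega> \<longleftrightarrow> Z \<eta> = Z \<omega>"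
  shows "\<H>[P](X | Z') = \<H>[P](X | Z)"
  unfolding cond_entropy_eq[OF fr(1,2)] cond_entropy_eq[OF fr(1,3)]
  using Z by (intro arg_cong[of _ _ uminus] integral_cong_AE) (auto simp: AE_measure_pmf_iff cong: mass_cong)

section \<open>Change of measure for wrong candidates\<close>

lemma nn_integral_finite_range:
  assumes "finite (range V)"
  shows "(\<integral>\<^sup>+\<omega>. h (V \<omega>) \<partial>measure_pmf P) = (\<Sum>v\<in>range V. h v * ennreal (mass P (\<lambda>\<omega>. V \<omega> = v)))"
proof -
  have "(\<integral>\<^sup>+\<omega>. h (V \<omega>) \<partial>measure_pmf P) = (\<integral>\<^sup>+v. h v \<partial>measure_pmf (map_pmf V P))"
    by simp
  also have "\<dots> = (\<Sum>v\<in>range V. h v * ennreal (pmf (map_pmf V P) v))"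
    using assms by (intro nn_integral_measure_pmf_support) (auto simp: set_pmf_iff)
  finally show ?thesis by (simp add: pmf_map_eq_mass)
qed

text \<open>The weight is 1 / p(y|z): it cancels the conditional law of \<open>Y\<close> and leaves
  counting measure on its values. Values of probability zero drop out, hence the inequality.\<close>

lemma nn_integral_inverse_conditional_le:
  fixes Y :: "'a \<Rightarrow> 'y::finite"
  assumes "finite (range Z)"
  shows "(\<integral>\<^sup>+\<omega>. h (Y \<omega>) (Z \<omega>) * ennreal (mass P (\<lambda>\<eta>. Z \<eta> = Z \<omega>) / mass P (\<lambda>\<eta>. Y \<eta> = Y \<omega> \<and> Z \<eta> = Z \<omega>)) \<partial>measure_pmf P) \<le>
    (\<integral>\<^sup>+\<omega>. (\<Sum>y\<in>UNIV. h y (Z \<omega>)) \<partial>measure_pmf P)"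
proof -
  have fr: "finite (range (Y \<diamondop> Z))" using assms by (intro finite_range_Pair) auto
  have "(\<integral>\<^sup>+\<omega>. h (Y \<omega>) (Z \<omega>) * ennreal (mass P (\<lambda>\<eta>. Z \<eta> = Z \<omega>) / mass P (\<lambda>\<eta>. Y \<eta> = Y \<omega> \<and> Z \<eta> = Z \<omega>)) \<partial>measure_pmf P) =
    (\<Sum>(y, z)\<in>range (Y \<diamondop> Z). h y z * ennreal (mass P (\<lambda>\<eta>. Z \<eta> = z) / mass P (\<lambda>\<eta>. Y \<eta> = y \<and> Z \<eta> = z)) *
        ennreal (mass P (\<lambda>\<eta>. Y \<eta> = y \<and> Z \<eta> = z)))"
    using nn_integral_finite_range[OF fr, where P = P and h = "\<lambda>(y, z). h y z * ennreal (mass P (\<lambda>\<eta>. Z \<eta> = z) / mass P (\<lambda>\<eta>. Y \<eta> = y \<and> Z \<eta> = z))"]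
    by (simp add: split_def prod_eq_iff)
  also have "\<dots> \<le> (\<Sum>(y, z)\<in>range (Y \<diamondop> Z). h y z * ennreal (mass P (\<lambda>\<eta>. Z \<eta> = z)))"
    by (intro sum_mono) (auto simp: mult.assoc simp flip: ennreal_mult intro!: mult_left_mono)
  also have "\<dots> \<le> (\<Sum>(y, z)\<in>UNIV \<times> range Z. h y z * ennreal (mass P (\<lambda>\<eta>. Z \<eta> = z)))"
    using assms by (intro sum_mono2) auto
  also have "\<dots> = (\<Sum>z\<in>range Z. (\<Sum>y\<in>UNIV. h y z) * ennreal (mass P (\<lambda>\<eta>. Z \<eta> = z)))"
    by (simp add: sum.cartesian_product[symmetric] sum_distrib_right sum.swap[of _ "range Z"])
  also have "\<dots> = (\<integral>\<^sup>+\<omega>. (\<Sum>y\<in>UNIV. h y (Z \<omega>)) \<partial>measure_pmf P)"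
    using assms by (subst nn_integral_finite_range) auto
  finally show ?thesis .
qed

text \<open>Equality fails only for a null event in the denominator, where division yields
  0.\<close>

lemma sum_conditional_le_1:
  fixes Y :: "'a \<Rightarrow> 'y::finite"
  shows "(\<Sum>y\<in>UNIV. mass P (\<lambda>\<omega>. X \<omega> = x \<and> Y \<omega> = y \<and> Z \<omega> = z) / mass P (\<lambda>\<omega>. X \<omega> = x \<and> Z \<omega> = z)) \<le> 1"
proof -
  have "(\<Sum>y\<in>UNIV. mass P (\<lambda>\<omega>. X \<omega> = x \<and> Y \<omega> = y \<and> Z \<omega> = z)) = mass P (\<lambda>\<omega>. X \<omega> = x \<and> Z \<omega> = z)"
    by (subst measure_pmf.finite_measure_finite_Union[symmetric])
      (auto simp: disjoint_family_on_def intro!: arg_cong[of _ _ "measure_pmf.prob P"])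
  then show ?thesis by (simp flip: sum_divide_distrib)
qed

text \<open>The competitor \<open>x\<close> is drawn from \<open>Z\<close> alone, without looking at
  the output. The ratio is p(y|x,z) / p(y|z): its denominator cancels against the true law of the
  output, and its numerator sums to at most 1 over \<open>y\<close> for every single
  \<open>x\<close>, so any law \<open>J\<close> will do. The weights \<open>r\<close> then pay for
  the sum over candidates.\<close>

lemma packing:
  fixes Y :: "'a \<Rightarrow> 'y::finite" and J :: "'s::finite \<Rightarrow> 'z \<Rightarrow> 'x pmf"
  assumes fr: "finite (range Z)"
    and r: "\<And>s z. 0 \<le> r s z" "\<And>z. (\<Sum>s\<in>UNIV. r s z) \<le> 1"
  shows "(\<Sum>s\<in>UNIV. \<integral>\<^sup>+\<omega>. \<integral>\<^sup>+x. ennreal (r s (Z \<omega>) * density_ratio P X Y Z x (Y \<omega>) (Z \<omega>)) \<partial>measure_pmf (J s (Z \<omega>)) \<partial>measure_pmf P) \<le> 1"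
proof -
  define v where "v x y z = mass P (\<lambda>\<omega>. X \<omega> = x \<and> Y \<omega> = y \<and> Z \<omega> = z) / mass P (\<lambda>\<omega>. X \<omega> = x \<and> Z \<omega> = z)" for x y z
  have v: "0 \<le> v x y z" "(\<Sum>y\<in>UNIV. v x y z) \<le> 1" for x y z
    unfolding v_def by (simp, rule sum_conditional_le_1)
  have "(\<integral>\<^sup>+\<omega>. \<integral>\<^sup>+x. ennreal (r s (Z \<omega>) * density_ratio P X Y Z x (Y \<omega>) (Z \<omega>)) \<partial>measure_pmf (J s (Z \<omega>)) \<partial>measure_pmf P) \<le>
    (\<integral>\<^sup>+\<omega>. ennreal (r s (Z \<omega>)) \<partial>measure_pmf P)" for s
  proof -
    have "(\<integral>\<^sup>+\<omega>. \<integral>\<^sup>+x. ennreal (r s (Z \<omega>) * density_ratio P X Y Z x (Y \<omega>) (Z \<omega>)) \<partial>measure_pmf (J s (Z \<omega>)) \<partial>measure_pmf P) =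
      (\<integral>\<^sup>+\<omega>. (\<integral>\<^sup>+x. ennreal (r s (Z \<omega>) * v x (Y \<omega>) (Z \<omega>)) \<partial>measure_pmf (J s (Z \<omega>))) *
        ennreal (mass P (\<lambda>\<eta>. Z \<eta> = Z \<omega>) / mass P (\<lambda>\<eta>. Y \<eta> = Y \<omega> \<and> Z \<eta> = Z \<omega>)) \<partial>measure_pmf P)"
      by (subst nn_integral_multc[symmetric])
        (auto simp: density_ratio_def v_def r v simp flip: ennreal_mult intro!: nn_integral_cong)
    also have "\<dots> \<le> (\<integral>\<^sup>+\<omega>. (\<Sum>y\<in>UNIV. \<integral>\<^sup>+x. ennreal (r s (Z \<omega>) * v x y (Z \<omega>)) \<partial>measure_pmf (J s (Z \<omega>))) \<partial>measure_pmf P)"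
      by (rule nn_integral_inverse_conditional_le[OF fr, where h = "\<lambda>y z. \<integral>\<^sup>+x. ennreal (r s z * v x y z) \<partial>measure_pmf (J s z)"])
    also have "\<dots> = (\<integral>\<^sup>+\<omega>. \<integral>\<^sup>+x. ennreal (r s (Z \<omega>) * (\<Sum>y\<in>UNIV. v x y (Z \<omega>))) \<partial>measure_pmf (J s (Z \<omega>)) \<partial>measure_pmf P)"
      by (simp add: nn_integral_sum[symmetric] r v sum_distrib_left)
    also have "\<dots> \<le> (\<integral>\<^sup>+\<omega>. \<integral>\<^sup>+x. ennreal (r s (Z \<omega>)) \<partial>measure_pmf (J s (Z \<omega>)) \<partial>measure_pmf P)"
      using r v by (intro nn_integral_mono ennreal_leI mult_left_le) auto
    finally show ?thesis by simp
  qed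
  then have "(\<Sum>s\<in>UNIV. \<integral>\<^sup>+\<omega>. \<integral>\<^sup>+x. ennreal (r s (Z \<omega>) * density_ratio P X Y Z x (Y \<omega>) (Z \<omega>)) \<partial>measure_pmf (J s (Z \<omega>)) \<partial>measure_pmf P) \<le>
    (\<Sum>s\<in>UNIV. \<integral>\<^sup>+\<omega>. ennreal (r s (Z \<omega>)) \<partial>measure_pmf P)"
    by (intro sum_mono)
  also have "\<dots> = (\<integral>\<^sup>+\<omega>. ennreal (\<Sum>s\<in>UNIV. r s (Z \<omega>)) \<partial>measure_pmf P)"
    by (simp add: nn_integral_sum[symmetric] r)
  also have "\<dots> \<le> (\<integral>\<^sup>+\<omega>. 1 \<partial>measure_pmf P)"
    using r by (intro nn_integral_mono) simp
  finally show ?thesis by simp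
qed

section \<open>Single-letter analysis of one receiver\<close>

text \<open>None of the inner kernels depends on \<open>a\<close>, so its integral can move inside
  all three. It serves to carry a variable of the competitor past the true channel input and
  output.\<close>

lemma nn_integral_pmf_rotate:
  "(\<integral>\<^sup>+a. \<integral>\<^sup>+b. \<integral>\<^sup>+c. \<integral>\<^sup>+d. h a b c d \<partial>measure_pmf (D b c) \<partial>measure_pmf (C b) \<partial>measure_pmf B \<partial>measure_pmf A) =
   (\<integral>\<^sup>+b. \<integral>\<^sup>+c. \<integral>\<^sup>+d. \<integral>\<^sup>+a. h a b c d \<partial>measure_pmf A \<partial>measure_pmf (D b c) \<partial>measure_pmf (C b) \<partial>measure_pmf B)"
proof -
  have "(\<integral>\<^sup>+a. \<integral>\<^sup>+b. \<integral>\<^sup>+c. \<integral>\<^sup>+d. h a b c d \<partial>measure_pmf (D b c) \<partial>measure_pmf (C b) \<partial>measure_pmf B \<partial>measure_pmf A) =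
     (\<integral>\<^sup>+b. \<integral>\<^sup>+a. \<integral>\<^sup>+c. \<integral>\<^sup>+d. h a b c d \<partial>measure_pmf (D b c) \<partial>measure_pmf (C b) \<partial>measure_pmf A \<partial>measure_pmf B)"
    by (rule nn_integral_pmf_commute)
  also have "\<dots> = (\<integral>\<^sup>+b. \<integral>\<^sup>+c. \<integral>\<^sup>+a. \<integral>\<^sup>+d. h a b c d \<partial>measure_pmf (D b c) \<partial>measure_pmf A \<partial>measure_pmf (C b) \<partial>measure_pmf B)"
    by (intro nn_integral_cong nn_integral_pmf_commute)
  also have "\<dots> = (\<integral>\<^sup>+b. \<integral>\<^sup>+c. \<integral>\<^sup>+d. \<integral>\<^sup>+a. h a b c d \<partial>measure_pmf A \<partial>measure_pmf (D b c) \<partial>measure_pmf (C b) \<partial>measure_pmf B)"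
    by (intro nn_integral_cong nn_integral_pmf_commute)
  finally show ?thesis .
qed

lemma pmf_eqI_nn_integral:
  assumes "\<And>h. (\<integral>\<^sup>+x. h x \<partial>measure_pmf M) = (\<integral>\<^sup>+x. h x \<partial>measure_pmf M')"
  shows "M = M'"
proof (rule pmf_eqI)
  fix x
  have "ennreal (pmf M x) = ennreal (pmf M' x)"
    using assms[of "indicator {x}"] by (simp add: emeasure_pmf_single)
  then show "pmf M x = pmf M' x" by simp
qed

text \<open>\<open>N\<close> is the marginal channel to the receiver under study. Stating
  \<open>law\<close> for all integrands lets it fold nested integrals back into one integral over
  the sample space, whatever else is nested inside.\<close>

locale letters_joint = letters p f g pw0 pw1 pw2 px1 px2 N
  for p :: "('s::finite \<times> 't::finite) pmf" and f :: "'s \<Rightarrow> 'k" and g :: "'t \<Rightarrow> 'k"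
    and pw0 :: "'z::finite pmf" and pw1 :: "'z \<Rightarrow> 'w1::finite pmf" and pw2 :: "'z \<Rightarrow> 'w2::finite pmf"
    and px1 :: "'s \<Rightarrow> 'w1 \<Rightarrow> 'z \<Rightarrow> 'x1::finite pmf" and px2 :: "'t \<Rightarrow> 'w2 \<Rightarrow> 'z \<Rightarrow> 'x2 pmf"
    and N :: "'x1 \<Rightarrow> 'x2 \<Rightarrow> 'y::finite pmf" +
  fixes P :: "'a pmf" and S :: "'a \<Rightarrow> 's" and W0 :: "'a \<Rightarrow> 'z" and W1 :: "'a \<Rightarrow> 'w1" and W2 :: "'a \<Rightarrow> 'w2"
    and X1 :: "'a \<Rightarrow> 'x1" and Y :: "'a \<Rightarrow> 'y" and K :: "'a \<Rightarrow> 'k"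
  assumes K: "K = (\<lambda>\<omega>. f (S \<omega>))"
    and law: "\<And>h. (\<integral>\<^sup>+\<omega>. h (S \<omega>) (W0 \<omega>) (W1 \<omega>) (W2 \<omega>) (X1 \<omega>) (Y \<omega>) \<partial>measure_pmf P) =
      (\<integral>\<^sup>+st. \<integral>\<^sup>+z. \<integral>\<^sup>+u1. \<integral>\<^sup>+v1. \<integral>\<^sup>+u2. \<integral>\<^sup>+v2. \<integral>\<^sup>+y. h (fst st) z u1 u2 v1 y
        \<partial>measure_pmf (N v1 v2) \<partial>measure_pmf (px2 (snd st) u2 z) \<partial>measure_pmf (pw2 z)
        \<partial>measure_pmf (px1 (fst st) u1 z) \<partial>measure_pmf (pw1 z) \<partial>measure_pmf pw0 \<partial>measure_pmf p)"
begin

lemma letter_truth_eq: "letter_truth = map_pmf (\<lambda>\<omega>. (S \<omega>, W0 \<omega>, W1 \<omega>, W2 \<omega>, X1 \<omega>, Y \<omega>)) P"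
  by (rule pmf_eqI_nn_integral)
    (simp add: letter_truth_def nn_integral_bind_pmf law[where h = "\<lambda>s z u1 u2 v y. h (s, z, u1, u2, v, y)" for h])

text \<open>Given the centre and the shared satellites, the competitor's words are drawn
  independently of the output. Its integrals over \<open>u2'\<close>, \<open>v1'\<close> and
  \<open>u1'\<close> move inward past the output, one after another; the outer integrals are then
  exactly the joint law.\<close>

lemma nn_integral_letter_confuse:
  "(\<integral>\<^sup>+r. h r \<partial>measure_pmf (letter_confuse \<beta>1 \<beta>2 s')) =
   (\<integral>\<^sup>+\<omega>. \<integral>\<^sup>+u1. \<integral>\<^sup>+v1. \<integral>\<^sup>+u2. h (f s' = K \<omega>, s', W0 \<omega>, u1, u2, v1, Y \<omega>)
     \<partial>measure_pmf (if \<beta>2 then return_pmf (W2 \<omega>) else pw2 (W0 \<omega>))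
     \<partial>measure_pmf (px1 s' u1 (W0 \<omega>))
     \<partial>measure_pmf (if \<beta>1 then return_pmf (W1 \<omega>) else pw1 (W0 \<omega>)) \<partial>measure_pmf P)"
proof -
  define h' where "h' st z u1 u1' v1' u2 u2' y = h (f s' = f (fst st), s', z, u1', u2', v1', y)"
    for st :: "'s \<times> 't" and z :: 'z and u1 u1' :: 'w1 and v1' :: 'x1 and u2 u2' :: 'w2 and y :: 'y
  let ?A = "\<lambda>u1 z. measure_pmf (if \<beta>1 then return_pmf u1 else pw1 z)"
  let ?B = "\<lambda>u2 z. measure_pmf (if \<beta>2 then return_pmf u2 else pw2 z)"
  have "(\<integral>\<^sup>+r. h r \<partial>measure_pmf (letter_confuse \<beta>1 \<beta>2 s')) =
    (\<integral>\<^sup>+st. \<integral>\<^sup>+z. \<integral>\<^sup>+u1. \<integral>\<^sup>+v1. \<integral>\<^sup>+u1'. \<integral>\<^sup>+v1'. \<integral>\<^sup>+u2. \<integral>\<^sup>+v2. \<integral>\<^sup>+u2'. \<integral>\<^sup>+y. h' st z u1 u1' v1' u2 u2' y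
        \<partial>measure_pmf (N v1 v2) \<partial>?B u2 z \<partial>measure_pmf (px2 (snd st) u2 z) \<partial>measure_pmf (pw2 z)
        \<partial>measure_pmf (px1 s' u1' z) \<partial>?A u1 z
        \<partial>measure_pmf (px1 (fst st) u1 z) \<partial>measure_pmf (pw1 z) \<partial>measure_pmf pw0 \<partial>measure_pmf p)"
    by (simp add: letter_confuse_def nn_integral_bind_pmf h'_def)
  also have "\<dots> =
    (\<integral>\<^sup>+st. \<integral>\<^sup>+z. \<integral>\<^sup>+u1. \<integral>\<^sup>+v1. \<integral>\<^sup>+u1'. \<integral>\<^sup>+v1'. \<integral>\<^sup>+u2. \<integral>\<^sup>+v2. \<integral>\<^sup>+y. \<integral>\<^sup>+u2'. h' st z u1 u1' v1' u2 u2' y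
        \<partial>?B u2 z \<partial>measure_pmf (N v1 v2) \<partial>measure_pmf (px2 (snd st) u2 z) \<partial>measure_pmf (pw2 z)
        \<partial>measure_pmf (px1 s' u1' z) \<partial>?A u1 z
        \<partial>measure_pmf (px1 (fst st) u1 z) \<partial>measure_pmf (pw1 z) \<partial>measure_pmf pw0 \<partial>measure_pmf p)"
    by (intro nn_integral_cong nn_integral_pmf_commute)
  also have "\<dots> =
    (\<integral>\<^sup>+st. \<integral>\<^sup>+z. \<integral>\<^sup>+u1. \<integral>\<^sup>+v1. \<integral>\<^sup>+u1'. \<integral>\<^sup>+u2. \<integral>\<^sup>+v2. \<integral>\<^sup>+y. \<integral>\<^sup>+v1'. \<integral>\<^sup>+u2'. h' st z u1 u1' v1' u2 u2' y
        \<partial>?B u2 z \<partial>measure_pmf (px1 s' u1' z)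
        \<partial>measure_pmf (N v1 v2) \<partial>measure_pmf (px2 (snd st) u2 z) \<partial>measure_pmf (pw2 z)
        \<partial>?A u1 z
        \<partial>measure_pmf (px1 (fst st) u1 z) \<partial>measure_pmf (pw1 z) \<partial>measure_pmf pw0 \<partial>measure_pmf p)"
    by (intro nn_integral_cong nn_integral_pmf_rotate)
  also have "\<dots> =
    (\<integral>\<^sup>+st. \<integral>\<^sup>+z. \<integral>\<^sup>+u1. \<integral>\<^sup>+v1. \<integral>\<^sup>+u2. \<integral>\<^sup>+v2. \<integral>\<^sup>+y. \<integral>\<^sup>+u1'. \<integral>\<^sup>+v1'. \<integral>\<^sup>+u2'. h' st z u1 u1' v1' u2 u2' y
        \<partial>?B u2 z \<partial>measure_pmf (px1 s' u1' z) \<partial>?A u1 z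
        \<partial>measure_pmf (N v1 v2) \<partial>measure_pmf (px2 (snd st) u2 z) \<partial>measure_pmf (pw2 z)
        \<partial>measure_pmf (px1 (fst st) u1 z) \<partial>measure_pmf (pw1 z) \<partial>measure_pmf pw0 \<partial>measure_pmf p)"
    by (intro nn_integral_cong nn_integral_pmf_rotate)
  finally show ?thesis
    unfolding h'_def K
      law[where h = "\<lambda>s z u1 u2 v1 y. \<integral>\<^sup>+u1'. \<integral>\<^sup>+v1'. \<integral>\<^sup>+u2'. h (f s' = f s, s', z, u1', u2', v1', y)
        \<partial>?B u2 z \<partial>measure_pmf (px1 s' u1' z) \<partial>?A u1 z"] .
qed

text \<open>Here the competitor's centre \<open>z'\<close> moves inward as well, so that the truth
  influences the outcome only through the output.\<close>

lemma nn_integral_letter_fresh: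
  "(\<integral>\<^sup>+r. h r \<partial>measure_pmf (letter_fresh s')) =
   (\<integral>\<^sup>+\<omega>. \<integral>\<^sup>+z. \<integral>\<^sup>+u1. \<integral>\<^sup>+v1. \<integral>\<^sup>+u2. h (s', z, u1, u2, v1, Y \<omega>)
     \<partial>measure_pmf (pw2 z) \<partial>measure_pmf (px1 s' u1 z) \<partial>measure_pmf (pw1 z) \<partial>measure_pmf pw0 \<partial>measure_pmf P)"
proof -
  have "(\<integral>\<^sup>+r. h r \<partial>measure_pmf (letter_fresh s')) =
    (\<integral>\<^sup>+st. \<integral>\<^sup>+z. \<integral>\<^sup>+z'. \<integral>\<^sup>+u1. \<integral>\<^sup>+v1. \<integral>\<^sup>+u1'. \<integral>\<^sup>+v1'. \<integral>\<^sup>+u2. \<integral>\<^sup>+v2. \<integral>\<^sup>+u2'. \<integral>\<^sup>+y. h (s', z', u1', u2', v1', y)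
        \<partial>measure_pmf (N v1 v2) \<partial>measure_pmf (pw2 z') \<partial>measure_pmf (px2 (snd st) u2 z) \<partial>measure_pmf (pw2 z)
        \<partial>measure_pmf (px1 s' u1' z') \<partial>measure_pmf (pw1 z')
        \<partial>measure_pmf (px1 (fst st) u1 z) \<partial>measure_pmf (pw1 z) \<partial>measure_pmf pw0 \<partial>measure_pmf pw0 \<partial>measure_pmf p)"
    by (simp add: letter_fresh_def nn_integral_bind_pmf)
  also have "\<dots> =
    (\<integral>\<^sup>+st. \<integral>\<^sup>+z. \<integral>\<^sup>+z'. \<integral>\<^sup>+u1. \<integral>\<^sup>+v1. \<integral>\<^sup>+u1'. \<integral>\<^sup>+v1'. \<integral>\<^sup>+u2. \<integral>\<^sup>+v2. \<integral>\<^sup>+y. \<integral>\<^sup>+u2'. h (s', z', u1', u2', v1', y)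
        \<partial>measure_pmf (pw2 z') \<partial>measure_pmf (N v1 v2) \<partial>measure_pmf (px2 (snd st) u2 z) \<partial>measure_pmf (pw2 z)
        \<partial>measure_pmf (px1 s' u1' z') \<partial>measure_pmf (pw1 z')
        \<partial>measure_pmf (px1 (fst st) u1 z) \<partial>measure_pmf (pw1 z) \<partial>measure_pmf pw0 \<partial>measure_pmf pw0 \<partial>measure_pmf p)"
    by (intro nn_integral_cong nn_integral_pmf_commute)
  also have "\<dots> =
    (\<integral>\<^sup>+st. \<integral>\<^sup>+z. \<integral>\<^sup>+z'. \<integral>\<^sup>+u1. \<integral>\<^sup>+v1. \<integral>\<^sup>+u1'. \<integral>\<^sup>+u2. \<integral>\<^sup>+v2. \<integral>\<^sup>+y. \<integral>\<^sup>+v1'. \<integral>\<^sup>+u2'. h (s', z', u1', u2', v1', y)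
        \<partial>measure_pmf (pw2 z') \<partial>measure_pmf (px1 s' u1' z')
        \<partial>measure_pmf (N v1 v2) \<partial>measure_pmf (px2 (snd st) u2 z) \<partial>measure_pmf (pw2 z) \<partial>measure_pmf (pw1 z')
        \<partial>measure_pmf (px1 (fst st) u1 z) \<partial>measure_pmf (pw1 z) \<partial>measure_pmf pw0 \<partial>measure_pmf pw0 \<partial>measure_pmf p)"
    by (intro nn_integral_cong nn_integral_pmf_rotate)
  also have "\<dots> =
    (\<integral>\<^sup>+st. \<integral>\<^sup>+z. \<integral>\<^sup>+z'. \<integral>\<^sup>+u1. \<integral>\<^sup>+v1. \<integral>\<^sup>+u2. \<integral>\<^sup>+v2. \<integral>\<^sup>+y. \<integral>\<^sup>+u1'. \<integral>\<^sup>+v1'. \<integral>\<^sup>+u2'. h (s', z', u1', u2', v1', y)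
        \<partial>measure_pmf (pw2 z') \<partial>measure_pmf (px1 s' u1' z') \<partial>measure_pmf (pw1 z')
        \<partial>measure_pmf (N v1 v2) \<partial>measure_pmf (px2 (snd st) u2 z) \<partial>measure_pmf (pw2 z)
        \<partial>measure_pmf (px1 (fst st) u1 z) \<partial>measure_pmf (pw1 z) \<partial>measure_pmf pw0 \<partial>measure_pmf pw0 \<partial>measure_pmf p)"
    by (intro nn_integral_cong nn_integral_pmf_rotate)
  also have "\<dots> =
    (\<integral>\<^sup>+st. \<integral>\<^sup>+z. \<integral>\<^sup>+u1. \<integral>\<^sup>+v1. \<integral>\<^sup>+u2. \<integral>\<^sup>+z'. \<integral>\<^sup>+v2. \<integral>\<^sup>+y. \<integral>\<^sup>+u1'. \<integral>\<^sup>+v1'. \<integral>\<^sup>+u2'. h (s', z', u1', u2', v1', y)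
        \<partial>measure_pmf (pw2 z') \<partial>measure_pmf (px1 s' u1' z') \<partial>measure_pmf (pw1 z')
        \<partial>measure_pmf (N v1 v2) \<partial>measure_pmf (px2 (snd st) u2 z) \<partial>measure_pmf pw0 \<partial>measure_pmf (pw2 z)
        \<partial>measure_pmf (px1 (fst st) u1 z) \<partial>measure_pmf (pw1 z) \<partial>measure_pmf pw0 \<partial>measure_pmf p)"
    by (intro nn_integral_cong nn_integral_pmf_rotate)
  also have "\<dots> =
    (\<integral>\<^sup>+st. \<integral>\<^sup>+z. \<integral>\<^sup>+u1. \<integral>\<^sup>+v1. \<integral>\<^sup>+u2. \<integral>\<^sup>+v2. \<integral>\<^sup>+z'. \<integral>\<^sup>+y. \<integral>\<^sup>+u1'. \<integral>\<^sup>+v1'. \<integral>\<^sup>+u2'. h (s', z', u1', u2', v1', y)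
        \<partial>measure_pmf (pw2 z') \<partial>measure_pmf (px1 s' u1' z') \<partial>measure_pmf (pw1 z')
        \<partial>measure_pmf (N v1 v2) \<partial>measure_pmf pw0 \<partial>measure_pmf (px2 (snd st) u2 z) \<partial>measure_pmf (pw2 z)
        \<partial>measure_pmf (px1 (fst st) u1 z) \<partial>measure_pmf (pw1 z) \<partial>measure_pmf pw0 \<partial>measure_pmf p)"
    by (intro nn_integral_cong nn_integral_pmf_commute)
  also have "\<dots> =
    (\<integral>\<^sup>+st. \<integral>\<^sup>+z. \<integral>\<^sup>+u1. \<integral>\<^sup>+v1. \<integral>\<^sup>+u2. \<integral>\<^sup>+v2. \<integral>\<^sup>+y. \<integral>\<^sup>+z'. \<integral>\<^sup>+u1'. \<integral>\<^sup>+v1'. \<integral>\<^sup>+u2'. h (s', z', u1', u2', v1', y)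
        \<partial>measure_pmf (pw2 z') \<partial>measure_pmf (px1 s' u1' z') \<partial>measure_pmf (pw1 z') \<partial>measure_pmf pw0
        \<partial>measure_pmf (N v1 v2) \<partial>measure_pmf (px2 (snd st) u2 z) \<partial>measure_pmf (pw2 z)
        \<partial>measure_pmf (px1 (fst st) u1 z) \<partial>measure_pmf (pw1 z) \<partial>measure_pmf pw0 \<partial>measure_pmf p)"
    by (intro nn_integral_cong nn_integral_pmf_commute)
  finally show ?thesis
    unfolding law[where h = "\<lambda>s z u1 u2 v1 y. \<integral>\<^sup>+z'. \<integral>\<^sup>+u1'. \<integral>\<^sup>+v1'. \<integral>\<^sup>+u2'. h (s', z', u1', u2', v1', y)
        \<partial>measure_pmf (pw2 z') \<partial>measure_pmf (px1 s' u1' z') \<partial>measure_pmf (pw1 z') \<partial>measure_pmf pw0"] .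
qed

text \<open>
  A wrong candidate is scored by its density ratio times its prior weight, so that summing over all
  candidates costs nothing in the packing bound.
\<close>

definition posterior :: "'s \<Rightarrow> 'k \<Rightarrow> real" where
  "posterior s k = of_bool (f s = k) * (mass P (\<lambda>\<omega>. S \<omega> = s) / mass P (\<lambda>\<omega>. K \<omega> = k))"

lemma posterior_nonneg: "0 \<le> posterior s k"
  by (simp add: posterior_def)

text \<open>The source letters with common part \<open>k\<close> partition the event that
  \<open>K\<close> equals \<open>k\<close>; a null event leaves the sum 0.\<close>

lemma sum_posterior_le_1: "(\<Sum>s\<in>UNIV. posterior s k) \<le> 1"
proof -
  have "(\<Sum>s\<in>UNIV. of_bool (f s = k) * mass P (\<lambda>\<omega>. S \<omega> = s)) = (\<Sum>s\<in>{s. f s = k}. mass P (\<lambda>\<omega>. S \<omega> = s))"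
    by (intro sum.mono_neutral_cong_right) auto
  also have "\<dots> = mass P (\<lambda>\<omega>. K \<omega> = k)"
    by (subst measure_pmf.finite_measure_finite_Union[symmetric])
      (auto simp: disjoint_family_on_def K intro!: arg_cong[of _ _ "measure_pmf.prob P"])
  finally show ?thesis
    by (simp add: posterior_def flip: sum_divide_distrib)
qed

text \<open>A satellite in the right bin goes to the conditioning side, and a wrongly guessed
  \<open>W2\<close> joins the tested variables. A wrong satellite of user 1 is not listed: given
  source letter, input, centre and \<open>W2\<close> it carries no further information about the
  output.\<close>

fun score :: "bool \<Rightarrow> bool \<Rightarrow> ('s \<times> 'z \<times> 'w1 \<times> 'w2 \<times> 'x1 \<times> 'y) \<Rightarrow> real" where
  "score True True (s, z, u1, u2, v, y) =
     posterior s (f s) * density_ratio P (S \<diamondop> X1) Y (W0 \<diamondop> W1 \<diamondop> W2 \<diamondop> K) (s, v) y (z, u1, u2, f s)"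
| "score True False (s, z, u1, u2, v, y) =
     posterior s (f s) * density_ratio P (S \<diamondop> W2 \<diamondop> X1) Y (W0 \<diamondop> W1 \<diamondop> K) (s, u2, v) y (z, u1, f s)"
| "score False True (s, z, u1, u2, v, y) =
     posterior s (f s) * density_ratio P (S \<diamondop> X1) Y (W0 \<diamondop> W2 \<diamondop> K) (s, v) y (z, u2, f s)"
| "score False False (s, z, u1, u2, v, y) =
     posterior s (f s) * density_ratio P (S \<diamondop> W2 \<diamondop> X1) Y (W0 \<diamondop> K) (s, u2, v) y (z, f s)"

text \<open>With the common part wrong nothing is shared with the truth, so nothing is conditioned
  on. The weight is the unconditional prior, which is how H(S) takes the place of H(S|K).\<close>

fun score_fresh :: "('s \<times> 'z \<times> 'w1 \<times> 'w2 \<times> 'x1 \<times> 'y) \<Rightarrow> real" where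
  "score_fresh (s, z, u1, u2, v, y) =
     mass P (\<lambda>\<omega>. S \<omega> = s) * density_ratio P (W0 \<diamondop> W2 \<diamondop> S \<diamondop> X1) Y (\<lambda>_. ()) (z, u2, s, v) y ()"

lemma finite_range_K: "finite (range K)"
  by (rule finite_subset[of _ "range f"]) (auto simp: K)

lemmas finite_ranges = finite_range_Pair finite_range_K finite

text \<open>In each case the codewords shared with the truth form \<open>Z\<close>, and
  \<open>J\<close> draws the remaining ones.\<close>

lemma packing_confuse:
  "(\<Sum>s\<in>UNIV. \<integral>\<^sup>+r. of_bool (fst r) * ennreal (score \<beta>1 \<beta>2 (snd r)) \<partial>measure_pmf (letter_confuse \<beta>1 \<beta>2 s)) \<le> 1"
proof -
  note simps = nn_integral_letter_confuse split_def nn_integral_bind_pmf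
  consider "\<beta>1 = True" "\<beta>2 = True" | "\<beta>1 = True" "\<beta>2 = False" | "\<beta>1 = False" "\<beta>2 = True" | "\<beta>1 = False" "\<beta>2 = False"
    by auto
  then show ?thesis
  proof cases
    case 1
    \<comment> \<open>Both sides vanish if the common parts differ, since \<open>posterior\<close>
      contains that indicator. Hence the weight can be read off from \<open>K\<close>, a component
      of \<open>Z\<close>, as the packing bound requires.\<close>
    have "of_bool (f s = K \<omega>) * ennreal (score True True (s, W0 \<omega>, W1 \<omega>, W2 \<omega>, v, Y \<omega>)) =
      ennreal (posterior s (K \<omega>) * density_ratio P (S \<diamondop> X1) Y (W0 \<diamondop> W1 \<diamondop> W2 \<diamondop> K) (s, v) (Y \<omega>) (W0 \<omega>, W1 \<omega>, W2 \<omega>, K \<omega>))" for s v \<omega>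
      by (cases "f s = K \<omega>") (simp_all add: posterior_def)
    then show ?thesis
      using packing[where Z = "W0 \<diamondop> W1 \<diamondop> W2 \<diamondop> K" and X = "S \<diamondop> X1" and Y = Y and P = P
        and r = "\<lambda>s c. posterior s (snd (snd (snd c)))"
        and J = "\<lambda>s (z, u1, u2, k). px1 s u1 z \<bind> (\<lambda>v. return_pmf (s, v))",
        OF finite_ranges(1)[OF finite finite_ranges(1)[OF finite finite_ranges(1)[OF finite finite_range_K]]]
          posterior_nonneg sum_posterior_le_1] 1
      by (simp add: simps del: score.simps)
  next
    case 2
    have "of_bool (f s = K \<omega>) * ennreal (score True False (s, W0 \<omega>, W1 \<omega>, u2, v, Y \<omega>)) =
      ennreal (posterior s (K \<omega>) * density_ratio P (S \<diamondop> W2 \<diamondop> X1) Y (W0 \<diamondop> W1 \<diamondop> K) (s, u2, v) (Y \<omega>) (W0 \<omega>, W1 \<omega>, K \<omega>))" for s u2 v \<omega>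
      by (cases "f s = K \<omega>") (simp_all add: posterior_def)
    then show ?thesis
      using packing[where Z = "W0 \<diamondop> W1 \<diamondop> K" and X = "S \<diamondop> W2 \<diamondop> X1" and Y = Y and P = P
        and r = "\<lambda>s c. posterior s (snd (snd c))"
        and J = "\<lambda>s (z, u1, k). px1 s u1 z \<bind> (\<lambda>v. pw2 z \<bind> (\<lambda>u2. return_pmf (s, u2, v)))",
        OF finite_ranges(1)[OF finite finite_ranges(1)[OF finite finite_range_K]] posterior_nonneg sum_posterior_le_1] 2
      by (simp add: simps del: score.simps)
  next
    case 3
    have "of_bool (f s = K \<omega>) * ennreal (score False True (s, W0 \<omega>, u1, W2 \<omega>, v, Y \<omega>)) =
      ennreal (posterior s (K \<omega>) * density_ratio P (S \<diamondop> X1) Y (W0 \<diamondop> W2 \<diamondop> K) (s, v) (Y \<omega>) (W0 \<omega>, W2 \<omega>, K \<omega>))" for s u1 v \<omega>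
      by (cases "f s = K \<omega>") (simp_all add: posterior_def)
    then show ?thesis
      using packing[where Z = "W0 \<diamondop> W2 \<diamondop> K" and X = "S \<diamondop> X1" and Y = Y and P = P
        and r = "\<lambda>s c. posterior s (snd (snd c))"
        and J = "\<lambda>s (z, u2, k). pw1 z \<bind> (\<lambda>u1. px1 s u1 z \<bind> (\<lambda>v. return_pmf (s, v)))",
        OF finite_ranges(1)[OF finite finite_ranges(1)[OF finite finite_range_K]] posterior_nonneg sum_posterior_le_1] 3
      by (simp add: simps del: score.simps)
  next
    case 4
    have "of_bool (f s = K \<omega>) * ennreal (score False False (s, W0 \<omega>, u1, u2, v, Y \<omega>)) =
      ennreal (posterior s (K \<omega>) * density_ratio P (S \<diamondop> W2 \<diamondop> X1) Y (W0 \<diamondop> K) (s, u2, v) (Y \<omega>) (W0 \<omega>, K \<omega>))" for s u1 u2 v \<omega>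
      by (cases "f s = K \<omega>") (simp_all add: posterior_def)
    then show ?thesis
      using packing[where Z = "W0 \<diamondop> K" and X = "S \<diamondop> W2 \<diamondop> X1" and Y = Y and P = P
        and r = "\<lambda>s c. posterior s (snd c)"
        and J = "\<lambda>s (z, k). pw1 z \<bind> (\<lambda>u1. px1 s u1 z \<bind> (\<lambda>v. pw2 z \<bind> (\<lambda>u2. return_pmf (s, u2, v))))",
        OF finite_ranges(1)[OF finite finite_range_K] posterior_nonneg sum_posterior_le_1] 4
      by (simp add: simps del: score.simps)
  qed
qed

lemma packing_fresh: "(\<Sum>s\<in>UNIV. \<integral>\<^sup>+r. ennreal (score_fresh r) \<partial>measure_pmf (letter_fresh s)) \<le> 1"
proof -
  have "(\<Sum>s\<in>UNIV. mass P (\<lambda>\<omega>. S \<omega> = s)) = 1"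
    using sum_pmf_eq_1[of UNIV "map_pmf S P"] by (simp add: pmf_map_eq_mass)
  then show ?thesis
    using packing[where Z = "\<lambda>_. ()" and X = "W0 \<diamondop> W2 \<diamondop> S \<diamondop> X1" and Y = Y and P = P
      and r = "\<lambda>s _. mass P (\<lambda>\<omega>. S \<omega> = s)"
      and J = "\<lambda>s _. pw0 \<bind> (\<lambda>z. pw1 z \<bind> (\<lambda>u1. px1 s u1 z \<bind> (\<lambda>v. pw2 z \<bind> (\<lambda>u2. return_pmf (z, u2, s, v)))))"]
    by (simp add: nn_integral_letter_fresh nn_integral_bind_pmf)
qed

lemma K_eq: "f (S \<omega>) = K \<omega>"
  by (simp add: K)

lemma K_pair: "mass P (\<lambda>\<eta>. S \<eta> = S \<omega> \<and> K \<eta> = K \<omega>) = mass P (\<lambda>\<eta>. S \<eta> = S \<omega>)"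
  by (intro mass_cong) (auto simp: K)

lemma posterior_K: "posterior (S \<omega>) (f (S \<omega>)) = mass P (\<lambda>\<eta>. S \<eta> = S \<omega> \<and> K \<eta> = K \<omega>) / mass P (\<lambda>\<eta>. K \<eta> = K \<omega>)"
  unfolding K_pair by (simp add: posterior_def K_eq)

text \<open>On the support both factors are positive, so the logarithm splits: the weight
  contributes -H(S|K), the ratio the mutual information.\<close>

lemma expectation_log_posterior_ratio:
  assumes fr: "finite (range X)" "finite (range Z)"
  shows "measure_pmf.expectation P (\<lambda>\<omega>. log 2 (posterior (S \<omega>) (f (S \<omega>)) * density_ratio P X Y Z (X \<omega>) (Y \<omega>) (Z \<omega>))) =
    \<I>[P](X ; Y | Z) - \<H>[P](S | K)"
proof -
  have "measure_pmf.expectation P (\<lambda>\<omega>. log 2 (posterior (S \<omega>) (f (S \<omega>)) * density_ratio P X Y Z (X \<omega>) (Y \<omega>) (Z \<omega>))) =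
    measure_pmf.expectation P (\<lambda>\<omega>. log 2 (posterior (S \<omega>) (f (S \<omega>))) + log 2 (density_ratio P X Y Z (X \<omega>) (Y \<omega>) (Z \<omega>)))"
  proof (intro integral_cong_AE)
    show "AE \<omega> in measure_pmf P. log 2 (posterior (S \<omega>) (f (S \<omega>)) * density_ratio P X Y Z (X \<omega>) (Y \<omega>) (Z \<omega>)) =
      log 2 (posterior (S \<omega>) (f (S \<omega>))) + log 2 (density_ratio P X Y Z (X \<omega>) (Y \<omega>) (Z \<omega>))"
    proof (rule AE_pmfI)
      fix \<omega> assume \<omega>: "\<omega> \<in> set_pmf P"
      have "0 < posterior (S \<omega>) (f (S \<omega>))"
        unfolding posterior_K using \<omega> by (intro divide_pos_pos mass_pos) auto
      then show "log 2 (posterior (S \<omega>) (f (S \<omega>)) * density_ratio P X Y Z (X \<omega>) (Y \<omega>) (Z \<omega>)) =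
        log 2 (posterior (S \<omega>) (f (S \<omega>))) + log 2 (density_ratio P X Y Z (X \<omega>) (Y \<omega>) (Z \<omega>))"
        using density_ratio_pos[OF \<omega>, of X Y Z] by (simp add: log_mult_pos)
    qed
  qed auto
  also have "\<dots> = measure_pmf.expectation P (\<lambda>\<omega>. log 2 (posterior (S \<omega>) (f (S \<omega>)))) +
    measure_pmf.expectation P (\<lambda>\<omega>. log 2 (density_ratio P X Y Z (X \<omega>) (Y \<omega>) (Z \<omega>)))"
    using fr integrable_finite_range[of S P "\<lambda>s. log 2 (posterior s (f s))"]
      integrable_finite_range[of "X \<diamondop> Y \<diamondop> Z" P "\<lambda>(x, y, z). log 2 (density_ratio P X Y Z x y z)"]
    by (intro Bochner_Integration.integral_add) (simp_all add: finite_ranges)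
  finally show ?thesis
    using fr by (simp add: cond_mutual_information_eq cond_entropy_eq finite_ranges posterior_K)
qed

lemma expectation_log_score:
  "measure_pmf.expectation letter_truth (\<lambda>r. log 2 (score True True r)) = \<I>[P](S \<diamondop> X1 ; Y | W0 \<diamondop> W1 \<diamondop> W2 \<diamondop> K) - \<H>[P](S | K)"
  "measure_pmf.expectation letter_truth (\<lambda>r. log 2 (score True False r)) = \<I>[P](S \<diamondop> W2 \<diamondop> X1 ; Y | W0 \<diamondop> W1 \<diamondop> K) - \<H>[P](S | K)"
  "measure_pmf.expectation letter_truth (\<lambda>r. log 2 (score False True r)) = \<I>[P](S \<diamondop> X1 ; Y | W0 \<diamondop> W2 \<diamondop> K) - \<H>[P](S | K)"
  "measure_pmf.expectation letter_truth (\<lambda>r. log 2 (score False False r)) = \<I>[P](S \<diamondop> W2 \<diamondop> X1 ; Y | W0 \<diamondop> K) - \<H>[P](S | K)"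
  using expectation_log_posterior_ratio[of "S \<diamondop> X1" "W0 \<diamondop> W1 \<diamondop> W2 \<diamondop> K"]
    expectation_log_posterior_ratio[of "S \<diamondop> W2 \<diamondop> X1" "W0 \<diamondop> W1 \<diamondop> K"]
    expectation_log_posterior_ratio[of "S \<diamondop> X1" "W0 \<diamondop> W2 \<diamondop> K"]
    expectation_log_posterior_ratio[of "S \<diamondop> W2 \<diamondop> X1" "W0 \<diamondop> K"]
  by (simp_all add: letter_truth_eq finite_ranges K_eq)

lemma expectation_log_score_fresh:
  "measure_pmf.expectation letter_truth (\<lambda>r. log 2 (score_fresh r)) = \<I>[P](W0 \<diamondop> W2 \<diamondop> S \<diamondop> X1 ; Y) - \<H>[P](S)"
proof -
  let ?d = "\<lambda>\<omega>. density_ratio P (W0 \<diamondop> W2 \<diamondop> S \<diamondop> X1) Y (\<lambda>_. ()) (W0 \<omega>, W2 \<omega>, S \<omega>, X1 \<omega>) (Y \<omega>) ()"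
  have "measure_pmf.expectation letter_truth (\<lambda>r. log 2 (score_fresh r)) =
    measure_pmf.expectation P (\<lambda>\<omega>. log 2 (mass P (\<lambda>\<eta>. S \<eta> = S \<omega>) * ?d \<omega>))"
    by (simp add: letter_truth_eq)
  also have "\<dots> = measure_pmf.expectation P (\<lambda>\<omega>. log 2 (mass P (\<lambda>\<eta>. S \<eta> = S \<omega>)) + log 2 (?d \<omega>))"
  proof (intro integral_cong_AE)
    show "AE \<omega> in measure_pmf P. log 2 (mass P (\<lambda>\<eta>. S \<eta> = S \<omega>) * ?d \<omega>) = log 2 (mass P (\<lambda>\<eta>. S \<eta> = S \<omega>)) + log 2 (?d \<omega>)"
    proof (rule AE_pmfI)
      fix \<omega> assume \<omega>: "\<omega> \<in> set_pmf P"
      show "log 2 (mass P (\<lambda>\<eta>. S \<eta> = S \<omega>) * ?d \<omega>) = log 2 (mass P (\<lambda>\<eta>. S \<eta> = S \<omega>)) + log 2 (?d \<omega>)"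
        using mass_pos[OF \<omega>, of "\<lambda>\<eta>. S \<eta> = S \<omega>"] density_ratio_pos[OF \<omega>, of "W0 \<diamondop> W2 \<diamondop> S \<diamondop> X1" Y "\<lambda>_. ()"]
        by (simp add: log_mult_pos)
    qed
  qed auto
  also have "\<dots> = measure_pmf.expectation P (\<lambda>\<omega>. log 2 (mass P (\<lambda>\<eta>. S \<eta> = S \<omega>))) + measure_pmf.expectation P (\<lambda>\<omega>. log 2 (?d \<omega>))"
    using integrable_finite_range[of S P "\<lambda>s. log 2 (mass P (\<lambda>\<eta>. S \<eta> = s))"]
      integrable_finite_range[of "(W0 \<diamondop> W2 \<diamondop> S \<diamondop> X1) \<diamondop> Y" P "\<lambda>(x, y). log 2 (density_ratio P (W0 \<diamondop> W2 \<diamondop> S \<diamondop> X1) Y (\<lambda>_. ()) x y ())"]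
    by (intro Bochner_Integration.integral_add) simp_all
  finally show ?thesis
    by (simp add: mutual_information_eq entropy_eq)
qed

text \<open>One condition per test. \<open>R1\<close> helps exactly when the bins of user 1 collide;
  \<open>R2\<close> is paid when the bin of user 2 is guessed wrongly, and always when the common
  part is wrong.\<close>

theorem decoder_error_vanishes:
  assumes R: "0 < R1" "0 < R2"
    and "\<H>[P](S | K) - R1 < \<I>[P](S \<diamondop> X1 ; Y | W0 \<diamondop> W1 \<diamondop> W2 \<diamondop> K)"
    and "\<H>[P](S | K) - R1 + R2 < \<I>[P](S \<diamondop> W2 \<diamondop> X1 ; Y | W0 \<diamondop> W1 \<diamondop> K)"
    and "\<H>[P](S | K) < \<I>[P](S \<diamondop> X1 ; Y | W0 \<diamondop> W2 \<diamondop> K)"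
    and "\<H>[P](S | K) + R2 < \<I>[P](S \<diamondop> W2 \<diamondop> X1 ; Y | W0 \<diamondop> K)"
    and "\<H>[P](S) + R2 < \<I>[P](W0 \<diamondop> W2 \<diamondop> S \<diamondop> X1 ; Y)"
  shows "\<exists>\<delta>. \<delta> \<longlonglongrightarrow> (0::real) \<and> (\<forall>n. \<exists>A. (\<integral>\<^sup>+C. error_prob (block_source n p) (block_channel n N) A (block_map n f)
      ({..<n} \<rightarrow>\<^sub>E UNIV) (code_size R2 n) C
      \<partial>measure_pmf (block_codebook n (code_size R1 n) (code_size R2 n) f g pw0 pw1 pw2 px1 px2)) \<le> ennreal (\<delta> n))"
proof (rule average_error_vanishes[where G = score and Ge = score_fresh])
  show "finite (set_pmf letter_truth)" by simp
  show "0 \<le> score \<beta>1 \<beta>2 r" for \<beta>1 \<beta>2 r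
    by (cases "(\<beta>1, \<beta>2, r)" rule: score.cases) (simp_all add: posterior_nonneg density_ratio_nonneg)
  show "0 \<le> score_fresh r" for r
    by (cases r rule: score_fresh.cases) (simp add: density_ratio_nonneg)
  fix r assume "r \<in> set_pmf letter_truth"
  then obtain \<omega> where \<omega>: "\<omega> \<in> set_pmf P" and r: "r = (S \<omega>, W0 \<omega>, W1 \<omega>, W2 \<omega>, X1 \<omega>, Y \<omega>)"
    by (auto simp: letter_truth_eq)
  have post: "0 < posterior (S \<omega>) (f (S \<omega>))"
    unfolding posterior_K using \<omega> by (intro divide_pos_pos mass_pos) auto
  show "0 < score \<beta>1 \<beta>2 r" for \<beta>1 \<beta>2
    using post density_ratio_pos[OF \<omega>, of "S \<diamondop> X1" Y "W0 \<diamondop> W1 \<diamondop> W2 \<diamondop> K"]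
      density_ratio_pos[OF \<omega>, of "S \<diamondop> W2 \<diamondop> X1" Y "W0 \<diamondop> W1 \<diamondop> K"]
      density_ratio_pos[OF \<omega>, of "S \<diamondop> X1" Y "W0 \<diamondop> W2 \<diamondop> K"]
      density_ratio_pos[OF \<omega>, of "S \<diamondop> W2 \<diamondop> X1" Y "W0 \<diamondop> K"]
    by (cases \<beta>1; cases \<beta>2) (simp_all add: r K_eq)
  show "0 < score_fresh r"
    using mass_pos[OF \<omega>, of "\<lambda>\<eta>. S \<eta> = S \<omega>"] density_ratio_pos[OF \<omega>, of "W0 \<diamondop> W2 \<diamondop> S \<diamondop> X1" Y "\<lambda>_. ()"]
    by (simp add: r)
qed (use assms packing_confuse packing_fresh in \<open>simp_all add: expectation_log_score expectation_log_score_fresh\<close>)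

end

section \<open>Both receivers\<close>

text \<open>Keeping every draw in the outcome makes the mass of a whole chain of kernels a plain
  product, the shape of the assumed factorisation.\<close>

lemma pmf_dependent_pair: "pmf (bind_pmf M (\<lambda>x. map_pmf (Pair x) (L x))) (a, b) = pmf M a * pmf (L a) b"
proof -
  have "pmf (map_pmf (Pair x) (L x)) (a, b) = indicator {a} x * pmf (L a) b" for x
  proof (cases "x = a")
    case True
    then show ?thesis by (simp add: pmf_map_inj' inj_on_def)
  next
    case False
    then show ?thesis by (auto simp: pmf_eq_0_set_pmf)
  qed
  then show ?thesis by (simp add: pmf_bind measure_pmf_single)
qed

text \<open>Given sources and centre the two users draw independently; receiver 2 needs the law with
  user 2 drawn before user 1.\<close>

lemma nn_integral_pmf_swap_blocks:
  "(\<integral>\<^sup>+a. \<integral>\<^sup>+b. \<integral>\<^sup>+c. \<integral>\<^sup>+d. h a b c d \<partial>measure_pmf (D c) \<partial>measure_pmf C \<partial>measure_pmf (B a) \<partial>measure_pmf A) =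
   (\<integral>\<^sup>+c. \<integral>\<^sup>+d. \<integral>\<^sup>+a. \<integral>\<^sup>+b. h a b c d \<partial>measure_pmf (B a) \<partial>measure_pmf A \<partial>measure_pmf (D c) \<partial>measure_pmf C)"
proof -
  have "(\<integral>\<^sup>+a. \<integral>\<^sup>+b. \<integral>\<^sup>+c. \<integral>\<^sup>+d. h a b c d \<partial>measure_pmf (D c) \<partial>measure_pmf C \<partial>measure_pmf (B a) \<partial>measure_pmf A) =
    (\<integral>\<^sup>+a. \<integral>\<^sup>+c. \<integral>\<^sup>+d. \<integral>\<^sup>+b. h a b c d \<partial>measure_pmf (B a) \<partial>measure_pmf (D c) \<partial>measure_pmf C \<partial>measure_pmf A)"
    by (subst nn_integral_pmf_commute, intro nn_integral_cong, rule nn_integral_pmf_commute)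
  also have "\<dots> = (\<integral>\<^sup>+c. \<integral>\<^sup>+a. \<integral>\<^sup>+d. \<integral>\<^sup>+b. h a b c d \<partial>measure_pmf (B a) \<partial>measure_pmf (D c) \<partial>measure_pmf A \<partial>measure_pmf C)"
    by (rule nn_integral_pmf_commute)
  also have "\<dots> = (\<integral>\<^sup>+c. \<integral>\<^sup>+d. \<integral>\<^sup>+a. \<integral>\<^sup>+b. h a b c d \<partial>measure_pmf (B a) \<partial>measure_pmf A \<partial>measure_pmf (D c) \<partial>measure_pmf C)"
    by (intro nn_integral_cong nn_integral_pmf_commute)
  finally show ?thesis .
qed

lemma nn_integral_factorization:
  assumes factorization: "\<And>s t w0 w1 w2 x1 x2 y1 y2.
      \<P>(\<omega> in measure_pmf P. S \<omega> = s \<and> T \<omega> = t \<and> W0 \<omega> = w0 \<and> W1 \<omega> = w1 \<and> W2 \<omega> = w2 \<and>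
          X1 \<omega> = x1 \<and> X2 \<omega> = x2 \<and> Y1 \<omega> = y1 \<and> Y2 \<omega> = y2) =
      pmf p (s, t) * pmf p_w0 w0 * pmf (p_w1 w0) w1 * pmf (p_w2 w0) w2 *
      pmf (p_x1 s w1 w0) x1 * pmf (p_x2 t w2 w0) x2 * pmf (W x1 x2) (y1, y2)"
  shows "(\<integral>\<^sup>+\<omega>. h (S \<omega>) (T \<omega>) (W0 \<omega>) (W1 \<omega>) (W2 \<omega>) (X1 \<omega>) (X2 \<omega>) (Y1 \<omega>, Y2 \<omega>) \<partial>measure_pmf P) =
      (\<integral>\<^sup>+st. \<integral>\<^sup>+z. \<integral>\<^sup>+u1. \<integral>\<^sup>+v1. \<integral>\<^sup>+u2. \<integral>\<^sup>+v2. \<integral>\<^sup>+y. h (fst st) (snd st) z u1 u2 v1 v2 y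
        \<partial>measure_pmf (W v1 v2) \<partial>measure_pmf (p_x2 (snd st) u2 z) \<partial>measure_pmf (p_w2 z)
        \<partial>measure_pmf (p_x1 (fst st) u1 z) \<partial>measure_pmf (p_w1 z) \<partial>measure_pmf p_w0 \<partial>measure_pmf p)"
proof -
  define M where "M = p \<bind> (\<lambda>st. map_pmf (Pair st) (p_w0 \<bind> (\<lambda>z. map_pmf (Pair z) (p_w1 z \<bind> (\<lambda>u1. map_pmf (Pair u1)
    (p_x1 (fst st) u1 z \<bind> (\<lambda>v1. map_pmf (Pair v1) (p_w2 z \<bind> (\<lambda>u2. map_pmf (Pair u2)
    (p_x2 (snd st) u2 z \<bind> (\<lambda>v2. map_pmf (Pair v2) (W v1 v2))))))))))))"
  define V where "V \<omega> = ((S \<omega>, T \<omega>), W0 \<omega>, W1 \<omega>, X1 \<omega>, W2 \<omega>, X2 \<omega>, Y1 \<omega>, Y2 \<omega>)" for \<omega>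
  have "pmf (map_pmf V P) v = pmf M v" for v
  proof -
    obtain s t w0 w1 x1 w2 x2 y1 y2 where v: "v = ((s, t), w0, w1, x1, w2, x2, y1, y2)"
      by (metis surj_pair)
    have "pmf (map_pmf V P) v = \<P>(\<omega> in measure_pmf P. S \<omega> = s \<and> T \<omega> = t \<and> W0 \<omega> = w0 \<and> W1 \<omega> = w1 \<and> W2 \<omega> = w2 \<and>
          X1 \<omega> = x1 \<and> X2 \<omega> = x2 \<and> Y1 \<omega> = y1 \<and> Y2 \<omega> = y2)"
      unfolding pmf_map_eq_mass v V_def by (auto intro!: arg_cong[of _ _ "measure_pmf.prob P"])
    also have "\<dots> = pmf M v"
      unfolding factorization M_def v pmf_dependent_pair by simp
    finally show "pmf (map_pmf V P) v = pmf M v" .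
  qed
  then have "map_pmf V P = M" by (rule pmf_eqI)
  moreover have "(\<integral>\<^sup>+\<omega>. h (S \<omega>) (T \<omega>) (W0 \<omega>) (W1 \<omega>) (W2 \<omega>) (X1 \<omega>) (X2 \<omega>) (Y1 \<omega>, Y2 \<omega>) \<partial>measure_pmf P) =
    (\<integral>\<^sup>+v. (case v of ((s, t), z, u1, v1, u2, v2, y) \<Rightarrow> h s t z u1 u2 v1 v2 y) \<partial>measure_pmf (map_pmf V P))"
    by (simp add: V_def)
  ultimately show ?thesis
    by (simp add: M_def nn_integral_bind_pmf split_def)
qed

text \<open>
  Fourier--Motzkin elimination of the bin rates.  The monotonicity assumptions account for the
  eliminated inequalities that are absent from the theorem.
\<close>

lemma rate_splitting:
  fixes a1 b1 c1 d1 e1 a2 b2 c2 d2 e2 hS hT HS HT :: real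
  assumes "hS < c1" "hT < c2" "HS < e1" "HT < e2"
    "hS + hT < a1 + d2" "hS + hT < a2 + d1" "hS + hT < b1 + b2"
    "hS + HT < e2 + a1" "HS + hT < e1 + a2"
    "2 * hS + hT < a1 + d1 + b2" "hS + 2 * hT < a2 + d2 + b1"
    "HS + hS + hT < a1 + e1 + b2" "HT + hS + hT < a2 + e2 + b1"
    and mono: "c1 \<le> d1" "c2 \<le> d2" "a1 \<le> b1" "a2 \<le> b2"
  shows "\<exists>R1 R2. 0 < R1 \<and> 0 < R2 \<and>
    hS - R1 < a1 \<and> hS - R1 + R2 < b1 \<and> hS + R2 < d1 \<and> HS + R2 < e1 \<and>
    hT - R2 < a2 \<and> hT - R2 + R1 < b2 \<and> hT + R1 < d2 \<and> HT + R1 < e2"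
proof -
  define L1 where "L1 = max 0 (hS - a1)"
  define L2 where "L2 = max 0 (hT - a2)"
  define U1 where "U1 = min (d2 - hT) (e2 - HT)"
  define U2 where "U2 = min (d1 - hS) (e1 - HS)"
  note defs = L1_def L2_def U1_def U2_def
  \<comment> \<open>\<open>R1\<close> must lie between \<open>L1\<close> and \<open>U1\<close>,
    \<open>R2\<close> between \<open>L2\<close> and \<open>U2\<close>, while \<open>b1 - hS\<close>
    and \<open>b2 - hT\<close> bound their difference in both directions. Eliminating
    \<open>R2\<close> and then \<open>R1\<close> leaves these five facts. \<open>mono\<close> enters
    where a lower bound is the 0 of a positive rate: for instance \<open>hS + hT < d1 + b2\<close>
    follows from \<open>hS + hT < a2 + d1\<close> and \<open>a2 \<le> b2\<close>.\<close>
  have 1: "L1 < U1" "L2 < U2" "L1 < U2 + (b2 - hT)" "L2 - (b1 - hS) < U1" "0 < (b1 - hS) + (b2 - hT)"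
    using assms unfolding defs by (auto simp: max_def min_def)
  then have "max L1 (L2 - (b1 - hS)) < min U1 (U2 + (b2 - hT))" by auto
  then obtain R1 where R1: "max L1 (L2 - (b1 - hS)) < R1" "R1 < min U1 (U2 + (b2 - hT))"
    using dense by blast
  then have "max L2 (R1 - (b2 - hT)) < min U2 (R1 + (b1 - hS))" using 1 by auto
  then obtain R2 where R2: "max L2 (R1 - (b2 - hT)) < R2" "R2 < min U2 (R1 + (b1 - hS))"
    using dense by blast
  show ?thesis
    using R1 R2 by (intro exI[of _ R1] exI[of _ R2]) (auto simp: defs)
qed

lemma block_codebook_swap:
  "block_codebook n M2 M1 g f pw0 pw2 pw1 px2 px1 =
   map_pmf (\<lambda>(w0, c1, c2). (w0, c2, c1)) (block_codebook n M1 M2 f g pw0 pw1 pw2 px1 px2)"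
  unfolding block_codebook_def by (subst codebook_swap, subst Un_commute) (rule refl)

section \<open>Transfer from index functions to list-valued codes\<close>

definition to_list :: "nat \<Rightarrow> (nat \<Rightarrow> 'a) \<Rightarrow> 'a list" where
  "to_list n x = map x [0..<n]"

definition of_list :: "nat \<Rightarrow> 'a list \<Rightarrow> nat \<Rightarrow> 'a" where
  "of_list n l = (\<lambda>i. if i < n then l ! i else undefined)"

lemma length_to_list [simp]: "length (to_list n x) = n"
  by (simp add: to_list_def)

lemma nth_to_list [simp]: "i < n \<Longrightarrow> to_list n x ! i = x i"
  by (simp add: to_list_def)

lemma of_list_to_list: "of_list n (to_list n x) = (\<lambda>i. if i < n then x i else undefined)"
  by (auto simp: of_list_def)

lemma of_list_to_list_PiE: "x \<in> {..<n} \<rightarrow>\<^sub>E UNIV \<Longrightarrow> of_list n (to_list n x) = x"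
  by (auto simp: of_list_to_list PiE_def extensional_def)

lemma to_list_inject: "x \<in> {..<n} \<rightarrow>\<^sub>E UNIV \<Longrightarrow> y \<in> {..<n} \<rightarrow>\<^sub>E UNIV \<Longrightarrow> to_list n x = to_list n y \<longleftrightarrow> x = y"
  by (metis of_list_to_list_PiE)

lemma map_to_list: "map h (to_list n x) = to_list n (h \<circ> x)"
  by (simp add: to_list_def)

lemma replicate_pmf_eq_Pi_pmf: "replicate_pmf n p = map_pmf (to_list n) (Pi_pmf {..<n} d (\<lambda>_. p))"
proof (induction n)
  case 0
  show ?case by (simp add: to_list_def)
next
  case (Suc n)
  \<comment> \<open>Writing \<open>n + 1\<close> splits off the last letter instead of the leading
    one, which matches \<open>insert n {..<n}\<close>.\<close>
  have "replicate_pmf (Suc n) p = replicate_pmf (n + 1) p" by simp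
  also have "\<dots> = replicate_pmf n p \<bind> (\<lambda>xs. p \<bind> (\<lambda>y. return_pmf (xs @ [y])))"
    unfolding replicate_pmf_distrib replicate_pmf_1 by (simp add: bind_map_pmf)
  also have "\<dots> = Pi_pmf {..<n} d (\<lambda>_. p) \<bind> (\<lambda>x. p \<bind> (\<lambda>y. return_pmf (to_list n x @ [y])))"
    unfolding Suc by (simp add: bind_map_pmf)
  also have "\<dots> = p \<bind> (\<lambda>y. Pi_pmf {..<n} d (\<lambda>_. p) \<bind> (\<lambda>x. return_pmf (to_list (Suc n) (x(n := y)))))"
    by (subst bind_commute_pmf) (simp add: to_list_def)
  also have "\<dots> = map_pmf (to_list (Suc n)) (Pi_pmf (insert n {..<n}) d (\<lambda>_. p))"
    by (subst Pi_pmf_insert) (auto simp: pair_pmf_def map_pmf_def bind_assoc_pmf bind_return_pmf)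
  also have "insert n {..<n} = {..<Suc n}" by auto
  finally show ?case .
qed

text \<open>Each weight times its conditional probability is the probability of the joint event,
  also for null events, and these events are disjoint in \<open>s\<close>.\<close>

lemma sum_marginal_cond_prob_le:
  assumes "finite F"
  shows "(\<Sum>s\<in>F. pmf (map_pmf A L) s * \<P>(x in measure_pmf L. s \<noteq> B x \<bar> A x = s)) \<le> measure_pmf.prob L {x. A x \<noteq> B x}"
proof -
  have "(\<Sum>s\<in>F. pmf (map_pmf A L) s * \<P>(x in measure_pmf L. s \<noteq> B x \<bar> A x = s)) \<le>
    (\<Sum>s\<in>F. measure_pmf.prob L {x. A x = s \<and> A x \<noteq> B x})"
  proof (rule sum_mono)
    fix s
    have e: "{x. s \<noteq> B x \<and> A x = s} = {x. A x = s \<and> A x \<noteq> B x}" by auto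
    show "pmf (map_pmf A L) s * \<P>(x in measure_pmf L. s \<noteq> B x \<bar> A x = s) \<le> measure_pmf.prob L {x. A x = s \<and> A x \<noteq> B x}"
      by (simp add: pmf_map_eq_mass cond_prob_def e)
  qed
  also have "\<dots> = measure_pmf.prob L (\<Union>s\<in>F. {x. A x = s \<and> A x \<noteq> B x})"
    using assms by (intro measure_pmf.finite_measure_finite_Union[symmetric]) (auto simp: disjoint_family_on_def)
  also have "\<dots> \<le> measure_pmf.prob L {x. A x \<noteq> B x}"
    by (intro measure_pmf.finite_measure_mono) auto
  finally show ?thesis .
qed

lemma finite_seqs: "finite (seqs n :: 'a::finite list set)"
  unfolding seqs_def using finite_lists_length_eq[of "UNIV :: 'a set" n] by simp

lemma prob_eq_prob_true: "ennreal (measure_pmf.prob L {x. E x}) = prob_true (map_pmf E L)"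
  by (simp add: prob_true_def pmf_map vimage_def)

lemma code_law_eq:
  "code_law p W n (\<lambda>l. to_list n (e1 (of_list n l))) (\<lambda>l. to_list n (e2 (of_list n l))) =
   do { (s, t) \<leftarrow> block_source n p;
        y \<leftarrow> block_channel n W (e1 s) (e2 t);
        return_pmf (to_list n s, to_list n t, to_list n (fst \<circ> y), to_list n (snd \<circ> y)) }"
proof -
  have "of_list n (to_list n (fst \<circ> st)) = fst \<circ> st" "of_list n (to_list n (snd \<circ> st)) = snd \<circ> st"
    if "st \<in> set_pmf (Pi_pmf {..<n} (undefined, undefined) (\<lambda>_. p))" for st
    using that by (auto simp: of_list_to_list set_Pi_pmf PiE_dflt_def fun_eq_iff)
  moreover have "Pi_pmf {..<n} undefined (\<lambda>i. W (to_list n a ! i) (to_list n b ! i)) = block_channel n W a b" for a b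
    unfolding block_channel_def by (intro Pi_pmf_cong) auto
  ultimately show ?thesis
    unfolding code_law_def replicate_pmf_eq_Pi_pmf[where d = "(undefined, undefined)"] channel_power_def block_source_def
      to_list_def[symmetric]
    by (auto simp: bind_map_pmf map_to_list intro!: bind_pmf_cong)
qed

text \<open>Composition with \<open>h\<close> need not keep the default outside the block; the round
  trip through lists restores it.\<close>

lemma block_channel_map:
  "block_channel n (\<lambda>a b. map_pmf h (W a b)) x1 x2 = map_pmf (\<lambda>y. of_list n (to_list n (h \<circ> y))) (block_channel n W x1 x2)"
  unfolding block_channel_def map_pmf_def block_pmf_bind block_pmf_return of_list_to_list comp_apply
  by (simp add: bind_return_pmf)

lemma block_source_swap:
  "block_source n (map_pmf prod.swap p) = map_pmf prod.swap (block_source n p)"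
proof -
  have "Pi_pmf {..<n} (undefined, undefined) (\<lambda>_. map_pmf prod.swap p) = map_pmf ((\<circ>) prod.swap) (Pi_pmf {..<n} (undefined, undefined) (\<lambda>_. p))"
    by (rule Pi_pmf_map) auto
  then show ?thesis
    by (simp add: block_source_def pmf.map_comp o_def)
qed

lemma block_source_PiE:
  assumes "(s, t) \<in> set_pmf (block_source n p)"
  shows "s \<in> {..<n} \<rightarrow>\<^sub>E UNIV" "t \<in> {..<n} \<rightarrow>\<^sub>E UNIV"
  using assms by (auto simp: block_source_def set_Pi_pmf PiE_dflt_def PiE_iff extensional_def)

text \<open>The event depends on the output of receiver 1 alone, so the channel may be replaced by
  its marginal.\<close>

lemma P_e1_le:
  fixes p :: "('s::finite \<times> 't::finite) pmf" and e1 e2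
  assumes d: "\<And>y. d y \<in> {..<n} \<rightarrow>\<^sub>E UNIV"
  shows "ennreal (P_e1 p W n (\<lambda>l. to_list n (e1 (of_list n l))) (\<lambda>l. to_list n (e2 (of_list n l))) (\<lambda>l. to_list n (d (of_list n l)))) \<le>
    prob_true (do { (s, t) \<leftarrow> block_source n p; y \<leftarrow> block_channel n (\<lambda>a b. map_pmf fst (W a b)) (e1 s) (e2 t); return_pmf (d y \<noteq> s) })"
proof -
  let ?L = "code_law p W n (\<lambda>l. to_list n (e1 (of_list n l))) (\<lambda>l. to_list n (e2 (of_list n l)))"
  let ?\<phi> = "\<lambda>l. to_list n (d (of_list n l))"
  have marginal: "map_pmf (map fst) (replicate_pmf n p) = map_pmf fst ?L"
    by (simp add: code_law_def map_bind_pmf map_pmf_def bind_assoc_pmf bind_return_pmf)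
  have "P_e1 p W n (\<lambda>l. to_list n (e1 (of_list n l))) (\<lambda>l. to_list n (e2 (of_list n l))) ?\<phi> \<le>
    measure_pmf.prob ?L {x. fst x \<noteq> ?\<phi> (fst (snd (snd x)))}"
    unfolding P_e1_def marginal split_def by (rule sum_marginal_cond_prob_le[OF finite_seqs])
  then have "ennreal (P_e1 p W n (\<lambda>l. to_list n (e1 (of_list n l))) (\<lambda>l. to_list n (e2 (of_list n l))) ?\<phi>) \<le>
    prob_true (map_pmf (\<lambda>x. fst x \<noteq> ?\<phi> (fst (snd (snd x)))) ?L)"
    unfolding prob_eq_prob_true[symmetric] by (rule ennreal_leI)
  also have "map_pmf (\<lambda>x. fst x \<noteq> ?\<phi> (fst (snd (snd x)))) ?L =
    do { (s, t) \<leftarrow> block_source n p; y \<leftarrow> block_channel n (\<lambda>a b. map_pmf fst (W a b)) (e1 s) (e2 t); return_pmf (d y \<noteq> s) }"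
    unfolding code_law_eq block_channel_map
    using d by (auto simp: map_bind_pmf bind_map_pmf to_list_inject block_source_PiE intro!: bind_pmf_cong)
  finally show ?thesis .
qed

lemma P_e2_le:
  fixes p :: "('s::finite \<times> 't::finite) pmf" and e1 e2
  assumes d: "\<And>y. d y \<in> {..<n} \<rightarrow>\<^sub>E UNIV"
  shows "ennreal (P_e2 p W n (\<lambda>l. to_list n (e1 (of_list n l))) (\<lambda>l. to_list n (e2 (of_list n l))) (\<lambda>l. to_list n (d (of_list n l)))) \<le>
    prob_true (do { (t, s) \<leftarrow> block_source n (map_pmf prod.swap p); y \<leftarrow> block_channel n (\<lambda>b a. map_pmf snd (W a b)) (e2 t) (e1 s); return_pmf (d y \<noteq> t) })"
proof -
  let ?L = "code_law p W n (\<lambda>l. to_list n (e1 (of_list n l))) (\<lambda>l. to_list n (e2 (of_list n l)))"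
  let ?\<phi> = "\<lambda>l. to_list n (d (of_list n l))"
  have marginal: "map_pmf (map snd) (replicate_pmf n p) = map_pmf (\<lambda>x. fst (snd x)) ?L"
    by (simp add: code_law_def map_bind_pmf map_pmf_def bind_assoc_pmf bind_return_pmf)
  have "P_e2 p W n (\<lambda>l. to_list n (e1 (of_list n l))) (\<lambda>l. to_list n (e2 (of_list n l))) ?\<phi> \<le>
    measure_pmf.prob ?L {x. fst (snd x) \<noteq> ?\<phi> (snd (snd (snd x)))}"
    unfolding P_e2_def marginal split_def by (rule sum_marginal_cond_prob_le[OF finite_seqs])
  then have "ennreal (P_e2 p W n (\<lambda>l. to_list n (e1 (of_list n l))) (\<lambda>l. to_list n (e2 (of_list n l))) ?\<phi>) \<le>
    prob_true (map_pmf (\<lambda>x. fst (snd x) \<noteq> ?\<phi> (snd (snd (snd x)))) ?L)"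
    unfolding prob_eq_prob_true[symmetric] by (rule ennreal_leI)
  also have "block_channel n (\<lambda>b a. map_pmf snd (W a b)) x2 x1 = block_channel n (\<lambda>a b. map_pmf snd (W a b)) x1 x2" for x1 x2
    by (simp add: block_channel_def)
  then have "map_pmf (\<lambda>x. fst (snd x) \<noteq> ?\<phi> (snd (snd (snd x)))) ?L =
    do { (t, s) \<leftarrow> block_source n (map_pmf prod.swap p); y \<leftarrow> block_channel n (\<lambda>b a. map_pmf snd (W a b)) (e2 t) (e1 s); return_pmf (d y \<noteq> t) }"
    unfolding code_law_eq block_source_swap
    using d by (auto simp: block_channel_map map_bind_pmf bind_map_pmf to_list_inject block_source_PiE intro!: bind_pmf_cong)
  finally show ?thesis .
qed

text \<open>The random coding argument: some codebook does at least as well as the average.\<close>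

lemma ex_nn_integral_less:
  assumes "(\<integral>\<^sup>+x. h x \<partial>measure_pmf M) < c"
  shows "\<exists>x. h x < c"
proof (rule ccontr)
  assume "\<not> (\<exists>x. h x < c)"
  then have "(\<integral>\<^sup>+x. c \<partial>measure_pmf M) \<le> (\<integral>\<^sup>+x. h x \<partial>measure_pmf M)"
    by (intro nn_integral_mono) (simp add: not_less)
  with assms show False by simp
qed

theorem theorem1:
  fixes p :: "('s::finite \<times> 't::finite) pmf"
    and W :: "('x1::finite, 'x2::finite, 'y1::finite, 'y2::finite) channel"
    and f :: "'s \<Rightarrow> 'k" and g :: "'t \<Rightarrow> 'k"
    and P :: "'a pmf"
    and S :: "'a \<Rightarrow> 's" and T :: "'a \<Rightarrow> 't" and K :: "'a \<Rightarrow> 'k"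
    and W0 :: "'a \<Rightarrow> 'w0::finite" and W1 :: "'a \<Rightarrow> 'w1::finite" and W2 :: "'a \<Rightarrow> 'w2::finite"
    and X1 :: "'a \<Rightarrow> 'x1" and X2 :: "'a \<Rightarrow> 'x2"
    and Y1 :: "'a \<Rightarrow> 'y1" and Y2 :: "'a \<Rightarrow> 'y2"
    and p_w0 :: "'w0 pmf" and p_w1 :: "'w0 \<Rightarrow> 'w1 pmf" and p_w2 :: "'w0 \<Rightarrow> 'w2 pmf"
    and p_x1 :: "'s \<Rightarrow> 'w1 \<Rightarrow> 'w0 \<Rightarrow> 'x1 pmf" and p_x2 :: "'t \<Rightarrow> 'w2 \<Rightarrow> 'w0 \<Rightarrow> 'x2 pmf"
  assumes common: "common_part p f g"
    and K: "K = (\<lambda>\<omega>. f (S \<omega>))"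
    and factorization: "\<And>s t w0 w1 w2 x1 x2 y1 y2.
      \<P>(\<omega> in measure_pmf P. S \<omega> = s \<and> T \<omega> = t \<and> W0 \<omega> = w0 \<and> W1 \<omega> = w1 \<and> W2 \<omega> = w2 \<and>
          X1 \<omega> = x1 \<and> X2 \<omega> = x2 \<and> Y1 \<omega> = y1 \<and> Y2 \<omega> = y2) =
      pmf p (s, t) * pmf p_w0 w0 * pmf (p_w1 w0) w1 * pmf (p_w2 w0) w2 *
      pmf (p_x1 s w1 w0) x1 * pmf (p_x2 t w2 w0) x2 * pmf (W x1 x2) (y1, y2)"
    and "\<H>[P](S | K) < \<I>[P](S \<diamondop> X1 ; Y1 | W0 \<diamondop> W2 \<diamondop> K)"
    and "\<H>[P](T | K) < \<I>[P](T \<diamondop> X2 ; Y2 | W0 \<diamondop> W1 \<diamondop> K)"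
    and "\<H>[P](S) < \<I>[P](W0 \<diamondop> W2 \<diamondop> S \<diamondop> X1 ; Y1)"
    and "\<H>[P](T) < \<I>[P](W0 \<diamondop> W1 \<diamondop> T \<diamondop> X2 ; Y2)"
    and "\<H>[P](S | K) + \<H>[P](T | K)
           < \<I>[P](S \<diamondop> X1 ; Y1 | W0 \<diamondop> W1 \<diamondop> W2 \<diamondop> K) + \<I>[P](W1 \<diamondop> T \<diamondop> X2 ; Y2 | W0 \<diamondop> K)"
    and "\<H>[P](S | K) + \<H>[P](T | K)
           < \<I>[P](T \<diamondop> X2 ; Y2 | W0 \<diamondop> W1 \<diamondop> W2 \<diamondop> K) + \<I>[P](W2 \<diamondop> S \<diamondop> X1 ; Y1 | W0 \<diamondop> K)"
    and "\<H>[P](S | K) + \<H>[P](T | K)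
           < \<I>[P](S \<diamondop> W2 \<diamondop> X1 ; Y1 | W0 \<diamondop> W1 \<diamondop> K) + \<I>[P](T \<diamondop> W1 \<diamondop> X2 ; Y2 | W0 \<diamondop> W2 \<diamondop> K)"
    and "\<H>[P](S | K) + \<H>[P](T)
           < \<I>[P](W0 \<diamondop> W1 \<diamondop> T \<diamondop> X2 ; Y2) + \<I>[P](S \<diamondop> X1 ; Y1 | W0 \<diamondop> W1 \<diamondop> W2 \<diamondop> K)"
    and "\<H>[P](S) + \<H>[P](T | K)
           < \<I>[P](W0 \<diamondop> W2 \<diamondop> S \<diamondop> X1 ; Y1) + \<I>[P](T \<diamondop> X2 ; Y2 | W0 \<diamondop> W1 \<diamondop> W2 \<diamondop> K)"
    and "2 * \<H>[P](S | K) + \<H>[P](T | K)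
           < \<I>[P](S \<diamondop> X1 ; Y1 | W0 \<diamondop> W1 \<diamondop> W2 \<diamondop> K) + \<I>[P](S \<diamondop> W2 \<diamondop> X1 ; Y1 | W0 \<diamondop> K)
             + \<I>[P](T \<diamondop> W1 \<diamondop> X2 ; Y2 | W0 \<diamondop> W2 \<diamondop> K)"
    and "\<H>[P](S | K) + 2 * \<H>[P](T | K)
           < \<I>[P](T \<diamondop> X2 ; Y2 | W0 \<diamondop> W1 \<diamondop> W2 \<diamondop> K) + \<I>[P](T \<diamondop> W1 \<diamondop> X2 ; Y2 | W0 \<diamondop> K)
             + \<I>[P](S \<diamondop> W2 \<diamondop> X1 ; Y1 | W0 \<diamondop> W1 \<diamondop> K)"
    and "\<H>[P](S) + \<H>[P](S | K) + \<H>[P](T | K)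
           < \<I>[P](S \<diamondop> X1 ; Y1 | W0 \<diamondop> W1 \<diamondop> W2 \<diamondop> K) + \<I>[P](W0 \<diamondop> W2 \<diamondop> S \<diamondop> X1 ; Y1)
             + \<I>[P](T \<diamondop> W1 \<diamondop> X2 ; Y2 | W0 \<diamondop> W2 \<diamondop> K)"
    and "\<H>[P](T) + \<H>[P](S | K) + \<H>[P](T | K)
           < \<I>[P](T \<diamondop> X2 ; Y2 | W0 \<diamondop> W1 \<diamondop> W2 \<diamondop> K) + \<I>[P](W0 \<diamondop> W1 \<diamondop> T \<diamondop> X2 ; Y2)
             + \<I>[P](S \<diamondop> W2 \<diamondop> X1 ; Y1 | W0 \<diamondop> W1 \<diamondop> K)"
  shows "admissible p W"
proof -
  have agree: "f s = g t" if "(s, t) \<in> set_pmf p" for s t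
  proof -
    have "AE x in measure_pmf p. x \<in> {(s, t). f s = g t}"
      using common by (subst measure_pmf.prob_eq_1[symmetric]) (auto simp: common_part_def agree_as_def)
    with that show ?thesis by (auto simp: AE_measure_pmf_iff)
  qed
  note law = nn_integral_factorization[OF factorization]
  interpret D1: letters_joint p f g p_w0 p_w1 p_w2 p_x1 p_x2 "\<lambda>a b. map_pmf fst (W a b)" P S W0 W1 W2 X1 Y1 K
  proof
    show "(\<integral>\<^sup>+\<omega>. h (S \<omega>) (W0 \<omega>) (W1 \<omega>) (W2 \<omega>) (X1 \<omega>) (Y1 \<omega>) \<partial>measure_pmf P) =
      (\<integral>\<^sup>+st. \<integral>\<^sup>+z. \<integral>\<^sup>+u1. \<integral>\<^sup>+v1. \<integral>\<^sup>+u2. \<integral>\<^sup>+v2. \<integral>\<^sup>+y. h (fst st) z u1 u2 v1 y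
        \<partial>measure_pmf (map_pmf fst (W v1 v2)) \<partial>measure_pmf (p_x2 (snd st) u2 z) \<partial>measure_pmf (p_w2 z)
        \<partial>measure_pmf (p_x1 (fst st) u1 z) \<partial>measure_pmf (p_w1 z) \<partial>measure_pmf p_w0 \<partial>measure_pmf p)" for h
      using law[where h = "\<lambda>s t z u1 u2 v1 v2 y. h s z u1 u2 v1 (fst y)"] by simp
  qed (fact agree K)+
  \<comment> \<open>Receiver 2 is the same situation with the users exchanged. Its common part is a
    function of \<open>T\<close> and equals \<open>K\<close> only on the support, which
    \<open>cong\<close> below repairs.\<close>
  interpret D2: letters_joint "map_pmf prod.swap p" g f p_w0 p_w2 p_w1 p_x2 p_x1 "\<lambda>b a. map_pmf snd (W a b)" P T W0 W2 W1 X2 Y2 "\<lambda>\<omega>. g (T \<omega>)"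
  proof
    show "(\<integral>\<^sup>+\<omega>. h (T \<omega>) (W0 \<omega>) (W2 \<omega>) (W1 \<omega>) (X2 \<omega>) (Y2 \<omega>) \<partial>measure_pmf P) =
      (\<integral>\<^sup>+ts. \<integral>\<^sup>+z. \<integral>\<^sup>+u2. \<integral>\<^sup>+v2. \<integral>\<^sup>+u1. \<integral>\<^sup>+v1. \<integral>\<^sup>+y. h (fst ts) z u2 u1 v2 y
        \<partial>measure_pmf (map_pmf snd (W v1 v2)) \<partial>measure_pmf (p_x1 (snd ts) u1 z) \<partial>measure_pmf (p_w1 z)
        \<partial>measure_pmf (p_x2 (fst ts) u2 z) \<partial>measure_pmf (p_w2 z) \<partial>measure_pmf p_w0 \<partial>measure_pmf (map_pmf prod.swap p))" for h
      by (simp, rule trans[OF law[where h = "\<lambda>s t z u1 u2 v1 v2 y. h t z u2 u1 v2 (snd y)", unfolded snd_conv]])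
        (intro nn_integral_cong nn_integral_pmf_swap_blocks)
  qed (use agree in auto)
  have "map_pmf (S \<diamondop> T) P = p"
    by (rule pmf_eqI_nn_integral) (simp add: law[where h = "\<lambda>s t _ _ _ _ _ _. h (s, t)" for h])
  then have ST: "(S \<omega>, T \<omega>) \<in> set_pmf p" if "\<omega> \<in> set_pmf P" for \<omega>
    using that by (metis (no_types, lifting) image_eqI set_map_pmf)
  have K': "g (T \<omega>) = K \<omega>" if "\<omega> \<in> set_pmf P" for \<omega>
    using agree[OF ST[OF that]] by (simp add: K)
  note fr = finite_range_Pair D1.finite_range_K D2.finite_range_K finite
  have cong:
    "\<H>[P](T | \<lambda>\<omega>. g (T \<omega>)) = \<H>[P](T | K)"
    "\<I>[P](T \<diamondop> X2 ; Y2 | W0 \<diamondop> W2 \<diamondop> W1 \<diamondop> (\<lambda>\<omega>. g (T \<omega>))) = \<I>[P](T \<diamondop> X2 ; Y2 | W0 \<diamondop> W1 \<diamondop> W2 \<diamondop> K)"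
    "\<I>[P](T \<diamondop> W1 \<diamondop> X2 ; Y2 | W0 \<diamondop> W2 \<diamondop> (\<lambda>\<omega>. g (T \<omega>))) = \<I>[P](T \<diamondop> W1 \<diamondop> X2 ; Y2 | W0 \<diamondop> W2 \<diamondop> K)"
    "\<I>[P](T \<diamondop> X2 ; Y2 | W0 \<diamondop> W1 \<diamondop> (\<lambda>\<omega>. g (T \<omega>))) = \<I>[P](T \<diamondop> X2 ; Y2 | W0 \<diamondop> W1 \<diamondop> K)"
    "\<I>[P](T \<diamondop> W1 \<diamondop> X2 ; Y2 | W0 \<diamondop> (\<lambda>\<omega>. g (T \<omega>))) = \<I>[P](T \<diamondop> W1 \<diamondop> X2 ; Y2 | W0 \<diamondop> K)"
    "\<I>[P](W1 \<diamondop> T \<diamondop> X2 ; Y2 | W0 \<diamondop> K) = \<I>[P](T \<diamondop> W1 \<diamondop> X2 ; Y2 | W0 \<diamondop> K)"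
    "\<I>[P](W2 \<diamondop> S \<diamondop> X1 ; Y1 | W0 \<diamondop> K) = \<I>[P](S \<diamondop> W2 \<diamondop> X1 ; Y1 | W0 \<diamondop> K)"
    by (intro cond_mutual_information_cong cond_entropy_cong fr; auto simp: K')+
  \<comment> \<open>Instances of the chain rule in which the satellite of the other user moves from
    the tested to the conditioning side.\<close>
  have mono:
    "\<I>[P](S \<diamondop> X1 ; Y1 | W0 \<diamondop> W2 \<diamondop> K) \<le> \<I>[P](S \<diamondop> W2 \<diamondop> X1 ; Y1 | W0 \<diamondop> K)"
    "\<I>[P](T \<diamondop> X2 ; Y2 | W0 \<diamondop> W1 \<diamondop> K) \<le> \<I>[P](T \<diamondop> W1 \<diamondop> X2 ; Y2 | W0 \<diamondop> K)"
    "\<I>[P](S \<diamondop> X1 ; Y1 | W0 \<diamondop> W1 \<diamondop> W2 \<diamondop> K) \<le> \<I>[P](S \<diamondop> W2 \<diamondop> X1 ; Y1 | W0 \<diamondop> W1 \<diamondop> K)"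
    "\<I>[P](T \<diamondop> X2 ; Y2 | W0 \<diamondop> W1 \<diamondop> W2 \<diamondop> K) \<le> \<I>[P](T \<diamondop> W1 \<diamondop> X2 ; Y2 | W0 \<diamondop> W2 \<diamondop> K)"
    subgoal by (rule cond_mutual_information_mono[of W2]; (intro fr)?; auto)
    subgoal by (rule cond_mutual_information_mono[of W1]; (intro fr)?; auto)
    subgoal by (rule cond_mutual_information_mono[of W2]; (intro fr)?; auto)
    subgoal by (rule cond_mutual_information_mono[of W1]; (intro fr)?; auto)
    done
  obtain R1 R2 where R: "0 < R1" "0 < R2"
    "\<H>[P](S | K) - R1 < \<I>[P](S \<diamondop> X1 ; Y1 | W0 \<diamondop> W1 \<diamondop> W2 \<diamondop> K)"
    "\<H>[P](S | K) - R1 + R2 < \<I>[P](S \<diamondop> W2 \<diamondop> X1 ; Y1 | W0 \<diamondop> W1 \<diamondop> K)"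
    "\<H>[P](S | K) + R2 < \<I>[P](S \<diamondop> W2 \<diamondop> X1 ; Y1 | W0 \<diamondop> K)"
    "\<H>[P](S) + R2 < \<I>[P](W0 \<diamondop> W2 \<diamondop> S \<diamondop> X1 ; Y1)"
    "\<H>[P](T | K) - R2 < \<I>[P](T \<diamondop> X2 ; Y2 | W0 \<diamondop> W1 \<diamondop> W2 \<diamondop> K)"
    "\<H>[P](T | K) - R2 + R1 < \<I>[P](T \<diamondop> W1 \<diamondop> X2 ; Y2 | W0 \<diamondop> W2 \<diamondop> K)"
    "\<H>[P](T | K) + R1 < \<I>[P](T \<diamondop> W1 \<diamondop> X2 ; Y2 | W0 \<diamondop> K)"
    "\<H>[P](T) + R1 < \<I>[P](W0 \<diamondop> W1 \<diamondop> T \<diamondop> X2 ; Y2)"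
    using rate_splitting[OF assms(4-7) assms(8)[unfolded cong] assms(9)[unfolded cong] assms(10)] assms(11-) mono
    by (smt (verit))
  define B where "B n = block_codebook n (code_size R1 n) (code_size R2 n) f g p_w0 p_w1 p_w2 p_x1 p_x2" for n
  obtain \<delta>1 where \<delta>1: "\<delta>1 \<longlonglongrightarrow> 0" "\<And>n. \<exists>A. (\<integral>\<^sup>+C. error_prob (block_source n p)
      (block_channel n (\<lambda>a b. map_pmf fst (W a b))) A (block_map n f) ({..<n} \<rightarrow>\<^sub>E UNIV) (code_size R2 n) C
      \<partial>measure_pmf (B n)) \<le> ennreal (\<delta>1 n)"
    using D1.decoder_error_vanishes[OF R(1-4) assms(4) R(5,6)] unfolding B_def by blast
  obtain \<delta>2 where \<delta>2: "\<delta>2 \<longlonglongrightarrow> 0" "\<And>n. \<exists>A. (\<integral>\<^sup>+C. error_prob (block_source n (map_pmf prod.swap p))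
      (block_channel n (\<lambda>b a. map_pmf snd (W a b))) A (block_map n g) ({..<n} \<rightarrow>\<^sub>E UNIV) (code_size R1 n) C
      \<partial>measure_pmf (block_codebook n (code_size R2 n) (code_size R1 n) g f p_w0 p_w2 p_w1 p_x2 p_x1)) \<le> ennreal (\<delta>2 n)"
    using D2.decoder_error_vanishes[unfolded cong, OF R(2,1,7,8) assms(5) R(9,10)] by blast
  show ?thesis
    unfolding admissible_def
  proof
    fix \<epsilon> :: real assume \<epsilon>: "\<epsilon> \<in> {0<..<1}"
    have "\<forall>\<^sub>F n in sequentially. \<delta>1 n < \<epsilon> / 2 \<and> \<delta>2 n < \<epsilon> / 2"
      using \<epsilon> by (intro eventually_conj order_tendstoD(2)[OF \<delta>1(1)] order_tendstoD(2)[OF \<delta>2(1)]) auto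
    then show "\<forall>\<^sub>F n in sequentially. \<exists>f1 f2 \<phi>1 \<phi>2. block_code n f1 f2 \<phi>1 \<phi>2 \<and> max (P_e1 p W n f1 f2 \<phi>1) (P_e2 p W n f1 f2 \<phi>2) \<le> \<epsilon>"
    proof eventually_elim
      case (elim n)
      obtain A1 where A1: "(\<integral>\<^sup>+C. error_prob (block_source n p)
        (block_channel n (\<lambda>a b. map_pmf fst (W a b))) A1 (block_map n f) ({..<n} \<rightarrow>\<^sub>E UNIV) (code_size R2 n) C
        \<partial>measure_pmf (B n)) \<le> ennreal (\<delta>1 n)" using \<delta>1(2) by blast
      obtain A2 where "(\<integral>\<^sup>+C. error_prob (block_source n (map_pmf prod.swap p))
        (block_channel n (\<lambda>b a. map_pmf snd (W a b))) A2 (block_map n g) ({..<n} \<rightarrow>\<^sub>E UNIV) (code_size R1 n) C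
        \<partial>measure_pmf (block_codebook n (code_size R2 n) (code_size R1 n) g f p_w0 p_w2 p_w1 p_x2 p_x1)) \<le> ennreal (\<delta>2 n)"
        using \<delta>2(2) by blast
      \<comment> \<open>Undoing the exchange of users expresses both averages over the same random
        codebook.\<close>
      then have A2: "(\<integral>\<^sup>+(w0, c1, c2). error_prob (block_source n (map_pmf prod.swap p))
        (block_channel n (\<lambda>b a. map_pmf snd (W a b))) A2 (block_map n g) ({..<n} \<rightarrow>\<^sub>E UNIV) (code_size R1 n) (w0, c2, c1)
        \<partial>measure_pmf (B n)) \<le> ennreal (\<delta>2 n)"
        by (subst (asm) block_codebook_swap) (simp add: B_def split_def)
      \<comment> \<open>The sum of both errors is averaged, since codebooks found separately for the
        two receivers might differ.\<close>
      let ?err = "\<lambda>(w0, c1, c2). error_prob (block_source n p)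
          (block_channel n (\<lambda>a b. map_pmf fst (W a b))) A1 (block_map n f) ({..<n} \<rightarrow>\<^sub>E UNIV) (code_size R2 n) (w0, c1, c2) +
        error_prob (block_source n (map_pmf prod.swap p))
          (block_channel n (\<lambda>b a. map_pmf snd (W a b))) A2 (block_map n g) ({..<n} \<rightarrow>\<^sub>E UNIV) (code_size R1 n) (w0, c2, c1)"
      have "(\<integral>\<^sup>+C. ?err C \<partial>measure_pmf (B n)) \<le> ennreal (\<delta>1 n) + ennreal (\<delta>2 n)"
        using add_mono[OF A1 A2] by (simp add: split_def nn_integral_add)
      \<comment> \<open>The bounds are not known to be nonnegative; \<open>ennreal\<close> truncates
        them at 0.\<close>
      also have "\<dots> = ennreal (max 0 (\<delta>1 n) + max 0 (\<delta>2 n))"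
        by (subst ennreal_plus) auto
      also have "\<dots> < ennreal \<epsilon>"
        using elim \<epsilon> by (intro ennreal_lessI) (auto simp: max_def)
      finally obtain w0 b1 w1 x1 b2 w2 x2 where C: "?err (w0, (b1, w1, x1), (b2, w2, x2)) < ennreal \<epsilon>"
        using ex_nn_integral_less by (metis (no_types, lifting) prod_cases3)
      let ?C1 = "(w0, (b1, w1, x1), (b2, w2, x2))" and ?C2 = "(w0, (b2, w2, x2), (b1, w1, x1))"
      define d1 where "d1 = decode A1 (block_map n f) ({..<n} \<rightarrow>\<^sub>E UNIV) (code_size R2 n) ?C1"
      define d2 where "d2 = decode A2 (block_map n g) ({..<n} \<rightarrow>\<^sub>E UNIV) (code_size R1 n) ?C2"
      have d: "d1 y \<in> {..<n} \<rightarrow>\<^sub>E UNIV" "d2 y' \<in> {..<n} \<rightarrow>\<^sub>E UNIV" for y y'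
        unfolding d1_def d2_def by (rule decode_in, simp add: PiE_eq_empty_iff)+
      let ?f1 = "\<lambda>l. to_list n (x1 (of_list n l))" and ?f2 = "\<lambda>l. to_list n (x2 (of_list n l))"
      let ?\<phi>1 = "\<lambda>l. to_list n (d1 (of_list n l))" and ?\<phi>2 = "\<lambda>l. to_list n (d2 (of_list n l))"
      have le: "x \<le> ennreal \<epsilon>" "y \<le> ennreal \<epsilon>" if "x + y < ennreal \<epsilon>" for x y
        using order_trans[OF _ less_imp_le[OF that]] by (simp_all add: add_increasing add_increasing2)
      have "ennreal (P_e1 p W n ?f1 ?f2 ?\<phi>1) \<le> ennreal \<epsilon>"
        using P_e1_le[where d = d1 and p = p and W = W and ?e1.0 = x1 and ?e2.0 = x2, OF d(1)] le(1)[OF C[unfolded prod.case]]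
        unfolding error_prob_def d1_def encoder1.simps encoder2.simps by (rule order_trans)
      moreover have "ennreal (P_e2 p W n ?f1 ?f2 ?\<phi>2) \<le> ennreal \<epsilon>"
        using P_e2_le[where d = d2 and p = p and W = W and ?e1.0 = x1 and ?e2.0 = x2, OF d(2)] le(2)[OF C[unfolded prod.case]]
        unfolding error_prob_def d2_def encoder1.simps encoder2.simps by (rule order_trans)
      moreover have "block_code n ?f1 ?f2 ?\<phi>1 ?\<phi>2"
        by (simp add: block_code_def seqs_def)
      ultimately show ?case
        using \<epsilon> by (intro exI[of _ ?f1] exI[of _ ?f2] exI[of _ ?\<phi>1] exI[of _ ?\<phi>2]) (simp add: ennreal_le_iff)
    qed
  qed
qed

end
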